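(* For all positive integers $d$, $$B_d^* = \frac{\binom{2(d-1)}{d-1}}{d}.$$ Moreover, $A_1^* = A_2^* = A_3^* = 1$, $A_4^*$ is an algebraic number of degree $3$, and for all even integers $d \ge 4$, $A_d^* > 1$. More generally, for every positive integer $d$, the constant $A_d^*$ is the optimal value of an (explicit) semidefinite program.
   Context: $H_{n,k}$ is the space of homogeneous real polynomials (forms) in $n$ variables of degree $k$, and $C_{n,2d} = \{p \in H_{n,2d} : \nabla^2 p(\mathbf{x}) \succeq 0\ \forall \mathbf{x} \in \mathbb{R}^n\}$ is the cone of convex forms, where $\nabla^2 p(\mathbf{x})$ is the Hessian of $p$ at $\mathbf{x}$ and $\succeq 0$ means positive semidefinite. Every convex form of degree $2d$ is nonnegative on $\mathbb{R}^n$. For $p \in H_{n,2d}$, $T_p$ denotes the unique symmetric multilinear form of order $2d$ with $p(\mathbf{x}) = T_p(\mathbf{x}, \dots, \mathbf{x})$ for all $\mathbf{x} \in \mathbb{R}^n$, extended complex-multilinearly to $\mathbb{C}^n$. The biform of $p$ is $Q_p(\mathbf{x}, \mathbf{y}) = T_p(\mathbf{x}, \dots, \mathbf{x}, \mathbf{y}, \dots, \mathbf{y})$ with $d$ copies of $\mathbf{x}$ and $d$ copies of $\mathbf{y}$. For $\mathbf{z} \in \mathbb{C}^n$, $\bar{\mathbf{z}}$ is the complex conjugate, and $Q_p(\mathbf{z}, \bar{\mathbf{z}})$ is real. The optimal constants in the generalized Cauchy-Schwarz inequalities are defined, for each positive integer $d$, by $$A_d^* = \inf\{A \ge 0 : Q_p(\mathbf{x},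 \mathbf{y}) \le A\sqrt{p(\mathbf{x})p(\mathbf{y})}\ \text{ for all positive integers } n,\ \text{all } p \in C_{n,2d},\ \text{all } \mathbf{x}, \mathbf{y} \in \mathbb{R}^n\},$$ $$B_d^* = \inf\{B \ge 0 : |p(\mathbf{z})| \le B\, Q_p(\mathbf{z}, \bar{\mathbf{z}})\ \text{ for all positive integers } n,\ \text{all } p \in C_{n,2d},\ \text{all } \mathbf{z} \in \mathbb{C}^n\}.$$ A semidefinite program is the problem of optimizing a linear function over a set defined by linear equations and linear matrix inequalities (or over a linear projection of such a set). *)

theory Defs
  imports
    "HOL-Analysis.Analysis"
    "HOL-Library.Poly_Mapping"
    "HOL-Computational_Algebra.Polynomial"
    "Jordan_Normal_Form.Matrix"
begin

text \<open>
  Vectors and matrices are those of \<open>Jordan_Normal_Form.Matrix\<close>, since the dimension is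
  quantified over inside the definitions of the two constants.
  Real polynomials in the variables \<open>0, 1, 2, \<dots>\<close> are finitely supported coefficient
  functions on monomials, and a monomial is a finitely supported exponent function.
\<close>

no_notation Finite_Cartesian_Product.vec_nth (infixl \<open>$\<close> 90)

type_synonym rpoly = "(nat \<Rightarrow>\<^sub>0 nat) \<Rightarrow>\<^sub>0 real"

definition poly_value :: "rpoly \<Rightarrow> 'a :: {real_algebra_1, comm_ring_1} Matrix.vec \<Rightarrow> 'a" where
  "poly_value p x =
     (\<Sum>m\<in>Poly_Mapping.keys p. of_real (Poly_Mapping.lookup p m) * (\<Prod>i\<in>Poly_Mapping.keys m. (x $ i) ^ Poly_Mapping.lookup m i))"

definition forms :: "nat \<Rightarrow> nat \<Rightarrow> rpoly set" where
  "forms n k = {p. \<forall>m\<in>Poly_Mapping.keys p. Poly_Mapping.keys m \<subseteq> {..<n} \<and> (\<Sum>i\<in>Poly_Mapping.keys m. Poly_Mapping.lookup m i) = k}"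


subsection \<open>Convex forms\<close>

definition psd :: "real mat \<Rightarrow> bool" where
  "psd A \<longleftrightarrow> A \<in> carrier_mat (dim_row A) (dim_row A) \<and> transpose_mat A = A \<and>
     (\<forall>v\<in>carrier_vec (dim_row A). scalar_prod v (A *\<^sub>v v) \<ge> 0)"

definition partial_deriv :: "nat \<Rightarrow> nat \<Rightarrow> (real Matrix.vec \<Rightarrow> real) \<Rightarrow> real Matrix.vec \<Rightarrow> real" where
  "partial_deriv n i f x = deriv (\<lambda>t. f (x + t \<cdot>\<^sub>v unit_vec n i)) 0"

definition hessian :: "nat \<Rightarrow> (real Matrix.vec \<Rightarrow> real) \<Rightarrow> real Matrix.vec \<Rightarrow> real mat" where
  "hessian n f x = Matrix.mat n n (\<lambda>(i, j). partial_deriv n i (partial_deriv n j f) x)"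

definition convex_forms :: "nat \<Rightarrow> nat \<Rightarrow> rpoly set" where
  "convex_forms n k = {p \<in> forms n k. \<forall>x\<in>carrier_vec n. psd (hessian n (poly_value p) x)}"


subsection \<open>Polarization and biforms\<close>

text \<open>The arguments of a multilinear form are collected in a list.\<close>

definition vec_tuples :: "nat \<Rightarrow> nat \<Rightarrow> real Matrix.vec list set" where
  "vec_tuples k n = {xs. length xs = k \<and> set xs \<subseteq> carrier_vec n}"

definition sym_multilinear :: "nat \<Rightarrow> nat \<Rightarrow> (real Matrix.vec list \<Rightarrow> real) \<Rightarrow> bool" where
  "sym_multilinear k n T \<longleftrightarrow>
     (\<forall>xs\<in>vec_tuples k n. \<forall>ys. mset ys = mset xs \<longrightarrow> T ys = T xs) \<and>
     (\<forall>xs\<in>vec_tuples k n. \<forall>j<k. \<forall>u\<in>carrier_vec n. \<forall>w\<in>carrier_vec n. \<forall>a b.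
        T (xs[j := a \<cdot>\<^sub>v u + b \<cdot>\<^sub>v w]) = a * T (xs[j := u]) + b * T (xs[j := w]))"

text \<open>Extensionality only fixes the junk values outside the domain, so that \<open>T\<close> is unique.\<close>

definition polar_form :: "nat \<Rightarrow> nat \<Rightarrow> rpoly \<Rightarrow> real Matrix.vec list \<Rightarrow> real" where
  "polar_form k n p = (THE T. T \<in> extensional (vec_tuples k n) \<and> sym_multilinear k n T \<and>
     (\<forall>x\<in>carrier_vec n. T (replicate k x) = poly_value p x))"

text \<open>
  The complex-multilinear extension, by expanding each argument in the standard basis:
  \<open>idx\<close> runs over all choices of one basis vector per argument.
\<close>

definition complex_extension ::
    "nat \<Rightarrow> nat \<Rightarrow> (real Matrix.vec list \<Rightarrow> real) \<Rightarrow> complex Matrix.vec list \<Rightarrow> complex" where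
  "complex_extension k n T zs =
     (\<Sum>idx | length idx = k \<and> set idx \<subseteq> {..<n}.
        of_real (T (map (unit_vec n) idx)) * (\<Prod>j<k. (zs ! j) $ (idx ! j)))"

definition biform :: "nat \<Rightarrow> nat \<Rightarrow> rpoly \<Rightarrow> real Matrix.vec \<Rightarrow> real Matrix.vec \<Rightarrow> real" where
  "biform n d p x y = polar_form (2 * d) n p (replicate d x @ replicate d y)"

definition complex_biform ::
    "nat \<Rightarrow> nat \<Rightarrow> rpoly \<Rightarrow> complex Matrix.vec \<Rightarrow> complex Matrix.vec \<Rightarrow> complex" where
  "complex_biform n d p z w =
     complex_extension (2 * d) n (polar_form (2 * d) n p) (replicate d z @ replicate d w)"


subsection \<open>The optimal constants\<close>

definition A_star :: "nat \<Rightarrow> real" where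
  "A_star d = Inf {A. A \<ge> 0 \<and>
     (\<forall>n>0. \<forall>p\<in>convex_forms n (2 * d). \<forall>x\<in>carrier_vec n. \<forall>y\<in>carrier_vec n.
        biform n d p x y \<le> A * sqrt (poly_value p x * poly_value p y))}"

text \<open>The value of the biform at \<open>z\<close> and its conjugate is real; \<open>Re\<close> only adjusts its type.\<close>

definition B_star :: "nat \<Rightarrow> real" where
  "B_star d = Inf {B. B \<ge> 0 \<and>
     (\<forall>n>0. \<forall>p\<in>convex_forms n (2 * d). \<forall>z::complex Matrix.vec\<in>carrier_vec n.
        cmod (poly_value p z) \<le> B * Re (complex_biform n d p z (conjugate z)))}"


subsection \<open>Degree of an algebraic number\<close>

definition algebraic_degree :: "real \<Rightarrow> nat" where
  "algebraic_degree a = (LEAST k. \<exists>q :: rat poly. q \<noteq> 0 \<and> Polynomial.degree q = k \<and>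
     poly (map_poly of_rat q) a = 0)"


subsection \<open>Semidefinite programs\<close>

text \<open>
  Real decision variables indexed by a finite set \<open>vars\<close>, a linear objective, finitely many linear
  equations (coefficients, right-hand side), and one linear matrix inequality
  (several can be combined into a block-diagonal one).
\<close>

record 'v sdp =
  vars :: "'v set"
  objective :: "'v \<Rightarrow> real"
  equations :: "(('v \<Rightarrow> real) \<times> real) set"
  lmi_size :: nat
  lmi_const :: "real mat"
  lmi_coeff :: "'v \<Rightarrow> real mat"

definition is_sdp :: "'v sdp \<Rightarrow> bool" where
  "is_sdp P \<longleftrightarrow> finite (vars P) \<and> finite (equations P) \<and>
     lmi_const P \<in> carrier_mat (lmi_size P) (lmi_size P) \<and>
     transpose_mat (lmi_const P) = lmi_const P \<and>
     (\<forall>v\<in>vars P. lmi_coeff P v \<in> carrier_mat (lmi_size P) (lmi_size P) \<and>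
        transpose_mat (lmi_coeff P v) = lmi_coeff P v)"

definition lmi_matrix :: "'v sdp \<Rightarrow> ('v \<Rightarrow> real) \<Rightarrow> real mat" where
  "lmi_matrix P x = Matrix.mat (lmi_size P) (lmi_size P)
     (\<lambda>(i, j). lmi_const P $$ (i, j) + (\<Sum>v\<in>vars P. x v * (lmi_coeff P v $$ (i, j))))"

definition sdp_feasible :: "'v sdp \<Rightarrow> ('v \<Rightarrow> real) set" where
  "sdp_feasible P = {x. (\<forall>(a, b)\<in>equations P. (\<Sum>v\<in>vars P. a v * x v) = b) \<and>
     psd (lmi_matrix P x)}"

text \<open>Value of the maximization problem: \<open>-\<infinity>\<close> if infeasible, \<open>\<infinity>\<close> if unbounded.\<close>

definition sdp_max_value :: "'v sdp \<Rightarrow> ereal" where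
  "sdp_max_value P = (SUP x\<in>sdp_feasible P. ereal (\<Sum>v\<in>vars P. objective P v * x v))"

text \<open>
  The semidefinite program for the constant \<open>A_star d\<close>. Restricting a convex form to the span of
  two vectors and rescaling them gives a convex binary form
    \<open>p(s, t) = (\<Sum>k\<le>2d. (2d choose k) a\<^sub>k s^(2d-k) t^k)\<close>
  with \<open>p(1, 0) = a\<^sub>0 = 1\<close> and \<open>p(0, 1) = a\<^bsub>2d\<^esub> = 1\<close>, whose biform at the two basis vectors is
  \<open>a\<^sub>d\<close>. Up to the factor \<open>2d(2d-1)\<close>, the entry \<open>(\<alpha>, \<beta>)\<close> of its Hessian is
    \<open>(\<Sum>k\<le>2d-2. (2d-2 choose k) a\<^bsub>k+\<alpha>+\<beta>\<^esub> s^(2d-2-k) t^k)\<close>.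
  The Hessian is positive semidefinite everywhere iff the biform it defines in \<open>(s, t)\<close> and
  \<open>(y\<^sub>0, y\<^sub>1)\<close> is a sum of squares, i.e. has a positive semidefinite Gram matrix with respect to
  the monomials \<open>y\<^sub>\<alpha> s^(d-1-i) t^i\<close>, \<open>\<alpha> < 2\<close>, \<open>i < d\<close>. This monomial has index \<open>\<alpha> * d + i\<close>.
  \<open>Coef k\<close> stands for \<open>a\<^sub>k\<close>, \<open>Gram r s\<close> for an entry of a matrix whose symmetric part (doubled in
  the matrix inequality, to keep the data integral) is the Gram matrix; \<open>hessian_eq d \<alpha> \<beta> k\<close>
  compares coefficients.
\<close>

datatype sdp_var = Coef nat | Gram nat nat

fun hessian_eq :: "nat \<Rightarrow> nat \<Rightarrow> nat \<Rightarrow> nat \<Rightarrow> sdp_var \<Rightarrow> real" where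
  "hessian_eq d \<alpha> \<beta> k (Coef l) = (if l = k + \<alpha> + \<beta> then - real ((2 * d - 2) choose k) else 0)"
| "hessian_eq d \<alpha> \<beta> k (Gram r s) =
     (if r div d = \<alpha> \<and> s div d = \<beta> \<and> r mod d + s mod d = k then 1 else 0)"

fun gram_coeff :: "nat \<Rightarrow> sdp_var \<Rightarrow> real mat" where
  "gram_coeff d (Coef l) = 0\<^sub>m (2 * d) (2 * d)"
| "gram_coeff d (Gram r s) = Matrix.mat (2 * d) (2 * d)
     (\<lambda>(i, j). of_bool (i = r \<and> j = s) + of_bool (i = s \<and> j = r))"

definition A_sdp :: "nat \<Rightarrow> sdp_var sdp" where
  "A_sdp d = \<lparr>
     vars = Coef ` {..2 * d} \<union> (\<lambda>(r, s). Gram r s) ` ({..<2 * d} \<times> {..<2 * d}),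
     objective = (\<lambda>v. of_bool (v = Coef d)),
     equations =
       {(\<lambda>v. of_bool (v = Coef 0), 1), (\<lambda>v. of_bool (v = Coef (2 * d)), 1)} \<union>
       {(hessian_eq d \<alpha> \<beta> k, 0) | \<alpha> \<beta> k. \<alpha> < 2 \<and> \<beta> < 2 \<and> k \<le> 2 * d - 2},
     lmi_size = 2 * d,
     lmi_const = 0\<^sub>m (2 * d) (2 * d),
     lmi_coeff = gram_coeff d\<rparr>"

end

theory Submission
  imports Defs
begin

text \<open>
  Restricting a form \<open>p\<close> of degree \<open>k\<close> to the span of \<open>x\<close> and \<open>y\<close> yields the moments
  \<open>a\<^sub>j = T\<^sub>p(x, \<dots>, x, y, \<dots>, y)\<close> with \<open>j\<close> copies of \<open>y\<close>. Let \<open>L\<close> be the linear functional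
  \<open>X\<^sup>j \<mapsto> a\<^sub>j\<close> on polynomials. Then \<open>T\<^sub>p\<close> at vectors \<open>s\<^sub>i x + t\<^sub>i y\<close> is \<open>L (\<Prod>\<^sub>i (s\<^sub>i + t\<^sub>i X))\<close>, and
  convexity says that \<open>L ((s + t X)\<^bsup>k-2\<^esup> (u + v X)\<^sup>2) \<ge> 0\<close>. Both constants are thereby reduced to
  such sequences.

  For \<open>B_star\<close>, the Hessian in tangential direction is summed over \<open>d\<close> equally spaced points of a circle
  in the basis \<open>z, cnj z\<close>: only the coefficients belonging to \<open>p(z)\<close>, its conjugate and \<open>Q\<^sub>p(z, cnj z)\<close>
  survive. The bound is attained by \<open>(2d - 1)(x\<^sup>2 + y\<^sup>2)\<^sup>d + Re (x + \<i> y)\<^bsup>2d\<^esup>\<close>.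

  For \<open>A_star\<close>, positive semidefinite matrix polynomials in one variable are sums of squares, which gives
  the semidefinite program. For \<open>d = 4\<close> symmetrization leaves two parameters, and the Hessian
  determinant is a cubic polynomial whose degeneration determines the optimum.
\<close>

section \<open>Symmetric multilinear forms\<close>

text \<open>Each inequality involves only two real vectors, for \<open>B_star\<close> the real and
  imaginary parts of z, and every convex sequence comes from a binary form, so nothing is lost by
  forgetting n. The plane is also what makes sums of squares available: dehomogenized, the Hessian
  is a two by two matrix of polynomials in one variable. The value of \<open>B_star\<close> is the
  Catalan number with index d - 1. It appears as half the middle coefficient of (1 + X)^(2d-2) (\<i>
  - \<i> X)^2, whose outer coefficients are both -1; the summation over the circle compares exactly
  these three. For \<open>A_star\<close> the infimum over constants becomes a supremum of middle
  moments over sequences with end moments 1. A real supremum needs a bounded set, and the bound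
  comes from convexity on the segment between the two vectors: the form lies between 0 and 1 there,
  and enough values control all coefficients. For d \<le> 3 the value 1 is forced because (1 -
  X^d)^2 is a nonnegative combination of polynomials (s + t X)^(2d-2) (1 - X)^2.\<close>

definition symmetric_linear :: "nat \<Rightarrow> nat \<Rightarrow> ('a::comm_ring_1 Matrix.vec list \<Rightarrow> 'a) \<Rightarrow> bool" where
  "symmetric_linear k n T \<longleftrightarrow>
     (\<forall>xs ys. length xs = k \<longrightarrow> set xs \<subseteq> carrier_vec n \<longrightarrow> mset ys = mset xs \<longrightarrow> T ys = T xs) \<and>
     (\<forall>xs u w a b. Suc (length xs) = k \<longrightarrow> set xs \<subseteq> carrier_vec n \<longrightarrow> u \<in> carrier_vec n \<longrightarrow>
        w \<in> carrier_vec n \<longrightarrow> T ((a \<cdot>\<^sub>v u + b \<cdot>\<^sub>v w) # xs) = a * T (u # xs) + b * T (w # xs))"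

lemma symmetric_linear_perm:
  assumes "symmetric_linear k n T" "mset ys = mset xs" "length xs = k" "set xs \<subseteq> carrier_vec n"
  shows "T ys = T xs"
  using assms unfolding symmetric_linear_def by blast

lemma symmetric_linear_Cons:
  assumes "symmetric_linear k n T" "Suc (length xs) = k" "set xs \<subseteq> carrier_vec n"
    "u \<in> carrier_vec n" "w \<in> carrier_vec n"
  shows "T ((a \<cdot>\<^sub>v u + b \<cdot>\<^sub>v w) # xs) = a * T (u # xs) + b * T (w # xs)"
  using assms unfolding symmetric_linear_def by blast

text \<open>Symmetry moves every slot to the head of the list, so linearity there is enough.
  \<open>symmetric_linear\<close> lives over any commutative ring because the complex extension
  obeys the same calculus.\<close>

lemma sym_multilinear_iff: "sym_multilinear k n T \<longleftrightarrow> symmetric_linear k n T"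
proof
  assume T: "sym_multilinear k n T"
  have "T ((a \<cdot>\<^sub>v u + b \<cdot>\<^sub>v w) # xs) = a * T (u # xs) + b * T (w # xs)"
    if "Suc (length xs) = k" "set xs \<subseteq> carrier_vec n" "u \<in> carrier_vec n" "w \<in> carrier_vec n" for xs u w a b
  proof -
    have "u # xs \<in> vec_tuples k n" using that by (auto simp: vec_tuples_def)
    moreover have "0 < k" using that by simp
    ultimately have "T ((u # xs)[0 := a \<cdot>\<^sub>v u + b \<cdot>\<^sub>v w]) = a * T ((u # xs)[0 := u]) + b * T ((u # xs)[0 := w])"
      using T that unfolding sym_multilinear_def by blast
    then show ?thesis by simp
  qed
  moreover have "T ys = T xs" if "length xs = k" "set xs \<subseteq> carrier_vec n" "mset ys = mset xs" for xs ys
    using T that unfolding sym_multilinear_def vec_tuples_def by blast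
  ultimately show "symmetric_linear k n T" unfolding symmetric_linear_def by blast
next
  assume T: "symmetric_linear k n T"
  have "T (xs[j := a \<cdot>\<^sub>v u + b \<cdot>\<^sub>v w]) = a * T (xs[j := u]) + b * T (xs[j := w])"
    if "xs \<in> vec_tuples k n" "j < k" "u \<in> carrier_vec n" "w \<in> carrier_vec n" for xs j u w a b
  proof -
    let ?r = "take j xs @ drop (Suc j) xs"
    have xs: "length xs = k" "set xs \<subseteq> carrier_vec n" using that by (auto simp: vec_tuples_def)
    have r: "Suc (length ?r) = k" "set ?r \<subseteq> carrier_vec n"
      using xs that set_take_subset[of j xs] set_drop_subset[of "Suc j" xs] by auto
    have upd: "T (xs[j := v]) = T (v # ?r)" if "v \<in> carrier_vec n" for v
      using that r xs \<open>j < k\<close> by (intro symmetric_linear_perm[OF T]) (simp_all add: upd_conv_take_nth_drop)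
    have "a \<cdot>\<^sub>v u + b \<cdot>\<^sub>v w \<in> carrier_vec n" using that by simp
    from upd[OF this] upd[OF that(3)] upd[OF that(4)] symmetric_linear_Cons[OF T r that(3,4), of a b]
    show ?thesis by simp
  qed
  moreover have "T ys = T xs" if "xs \<in> vec_tuples k n" "mset ys = mset xs" for xs ys
    using symmetric_linear_perm[OF T that(2)] that(1) by (simp add: vec_tuples_def)
  ultimately show "sym_multilinear k n T" unfolding sym_multilinear_def by blast
qed

subsection \<open>Symmetric tensors\<close>

definition indices :: "nat \<Rightarrow> nat \<Rightarrow> nat list set" where
  "indices k n = {idx. length idx = k \<and> set idx \<subseteq> {..<n}}"

lemma finite_indices: "finite (indices k n)"
  using finite_lists_length_eq[of "{..<n}" k] by (simp add: indices_def conj_commute)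

lemma nth_indices: "idx \<in> indices k n \<Longrightarrow> j < k \<Longrightarrow> idx ! j < n"
  unfolding indices_def using nth_mem by fastforce

text \<open>Over the reals this is a tensor viewed as a multilinear form, over the complex numbers
  it has the shape of \<open>complex_extension\<close>. One definition serves both, so their
  properties are proved once.\<close>

definition tensor_form :: "nat \<Rightarrow> nat \<Rightarrow> (nat list \<Rightarrow> real) \<Rightarrow>
    'a::{real_algebra_1, comm_ring_1} Matrix.vec list \<Rightarrow> 'a" where
  "tensor_form k n c xs = (\<Sum>idx\<in>indices k n. of_real (c idx) * (\<Prod>j<k. (xs ! j) $ (idx ! j)))"

lemma permute_list_indices:
  assumes "f permutes {..<k}"
  shows "bij_betw (permute_list f) (indices k n) (indices k n)"
proof (rule bij_betwI[where g = "permute_list (Hilbert_Choice.inv f)"])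
  have g: "Hilbert_Choice.inv f permutes {..<k}" by (rule permutes_inv[OF assms])
  have perm: "permute_list f' idx \<in> indices k n" if "f' permutes {..<k}" "idx \<in> indices k n" for f' idx
    using that by (auto simp: indices_def)
  show "permute_list f \<in> indices k n \<rightarrow> indices k n" "permute_list (Hilbert_Choice.inv f) \<in> indices k n \<rightarrow> indices k n"
    using perm assms g by auto
  fix idx assume idx: "idx \<in> indices k n"
  then have len: "{..<k} = {..<length idx}" by (simp add: indices_def)
  show "permute_list (Hilbert_Choice.inv f) (permute_list f idx) = idx"
    using permute_list_compose[of "Hilbert_Choice.inv f" idx f] g assms permutes_inv_o[OF assms] unfolding len by simp
  show "permute_list f (permute_list (Hilbert_Choice.inv f) idx) = idx"
    using permute_list_compose[of f idx "Hilbert_Choice.inv f"] g assms permutes_inv_o[OF assms] unfolding len by simp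
qed

text \<open>A permutation of the arguments is undone by permuting the summation index, and
  \<open>c\<close> does not see the order of an index list.\<close>

lemma tensor_form_permute:
  assumes c: "\<And>idx idx'. mset idx = mset idx' \<Longrightarrow> c idx = c idx'"
    and perm: "mset ys = mset xs" and len: "length xs = k"
  shows "tensor_form k n c ys = tensor_form k n c xs"
proof -
  obtain f where f: "f permutes {..<length xs}" "permute_list f xs = ys"
    by (rule mset_eq_permutation[OF perm])
  have "tensor_form k n c ys =
      (\<Sum>idx\<in>indices k n. of_real (c (permute_list f idx)) * (\<Prod>j<k. (ys ! j) $ (permute_list f idx ! j)))"
    unfolding tensor_form_def
    using sum.reindex_bij_betw[OF permute_list_indices, of f k "\<lambda>idx. of_real (c idx) * (\<Prod>j<k. (ys ! j) $ (idx ! j))" n]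
      f len by simp
  also have "\<dots> = tensor_form k n c xs"
    unfolding tensor_form_def
  proof (rule sum.cong[OF refl])
    fix idx assume idx: "idx \<in> indices k n"
    then have len': "length idx = k" by (simp add: indices_def)
    have "(\<Prod>j<k. (ys ! j) $ (permute_list f idx ! j)) = (\<Prod>j<k. (\<lambda>j. (xs ! j) $ (idx ! j)) (f j))"
      using f len len' by (intro prod.cong) (auto simp: permute_list_nth)
    also have "\<dots> = (\<Prod>j<k. (xs ! j) $ (idx ! j))"
      using f len prod.permute[of f "{..<k}" "\<lambda>j. (xs ! j) $ (idx ! j)"] by (simp add: o_def)
    finally have "(\<Prod>j<k. (ys ! j) $ (permute_list f idx ! j)) = (\<Prod>j<k. (xs ! j) $ (idx ! j))" .
    moreover have "c (permute_list f idx) = c idx" using f len len' by (intro c) simp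
    ultimately show "of_real (c (permute_list f idx)) * (\<Prod>j<k. (ys ! j) $ (permute_list f idx ! j)) =
        of_real (c idx) * (\<Prod>j<k. (xs ! j) $ (idx ! j))" by simp
  qed
  finally show ?thesis .
qed

lemma tensor_form_symmetric_linear:
  assumes c: "\<And>idx idx'. mset idx = mset idx' \<Longrightarrow> c idx = c idx'"
  shows "symmetric_linear k n (tensor_form k n c)"
  unfolding symmetric_linear_def
proof (intro conjI allI impI)
  fix xs ys :: "'a Matrix.vec list" assume "length xs = k" "mset ys = mset xs"
  then show "tensor_form k n c ys = tensor_form k n c xs" using tensor_form_permute[of c] c by metis
next
  fix xs :: "'a Matrix.vec list" and u w :: "'a Matrix.vec" and a b :: 'a
  assume k: "Suc (length xs) = k" and u: "u \<in> carrier_vec n" and w: "w \<in> carrier_vec n"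
  let ?P = "\<lambda>idx. \<Prod>j<length xs. (xs ! j) $ (idx ! Suc j)"
  have expand: "tensor_form k n c (v # xs) = (\<Sum>idx\<in>indices k n. of_real (c idx) * (v $ (idx ! 0) * ?P idx))" for v
    unfolding tensor_form_def k[symmetric] prod.lessThan_Suc_shift by simp
  show "tensor_form k n c ((a \<cdot>\<^sub>v u + b \<cdot>\<^sub>v w) # xs)
      = a * tensor_form k n c (u # xs) + b * tensor_form k n c (w # xs)"
    unfolding expand sum_distrib_left sum.distrib[symmetric]
  proof (rule sum.cong[OF refl])
    fix idx assume "idx \<in> indices k n"
    then have "idx ! 0 < n" using k nth_indices by blast
    then have "(a \<cdot>\<^sub>v u + b \<cdot>\<^sub>v w) $ (idx ! 0) = a * u $ (idx ! 0) + b * w $ (idx ! 0)"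
      using u w by simp
    then show "of_real (c idx) * ((a \<cdot>\<^sub>v u + b \<cdot>\<^sub>v w) $ (idx ! 0) * ?P idx) =
        a * (of_real (c idx) * (u $ (idx ! 0) * ?P idx)) + b * (of_real (c idx) * (w $ (idx ! 0) * ?P idx))"
      by (simp add: algebra_simps)
  qed
qed

text \<open>Evaluation at basis vectors recovers the tensor; this later identifies the complex
  extension of a polar form with the same tensor over the complex numbers.\<close>

lemma tensor_form_unit_vec:
  assumes "idx \<in> indices k n"
  shows "tensor_form k n c (map (unit_vec n) idx) = of_real (c idx)"
proof -
  have "(\<Prod>j<k. (map (unit_vec n) idx ! j) $ (idx' ! j)) = (if idx' = idx then 1 else (0::'a))"
    if "idx' \<in> indices k n" for idx'
  proof (cases "idx' = idx")
    case True
    then show ?thesis using assms nth_indices[OF assms] by (auto simp: indices_def intro!: prod.neutral)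
  next
    case False
    moreover have "length idx = k" "length idx' = k" using that assms by (auto simp: indices_def)
    ultimately obtain j where j: "j < k" "idx' ! j \<noteq> idx ! j"
      using nth_equalityI by metis
    then have "(map (unit_vec n) idx ! j) $ (idx' ! j) = (0::'a)"
      using that assms nth_indices[OF that j(1)] nth_indices[OF assms j(1)]
      by (auto simp: indices_def)
    with j False show ?thesis by (auto intro!: prod_zero)
  qed
  then have "tensor_form k n c (map (unit_vec n) idx) = (\<Sum>idx'\<in>indices k n. if idx' = idx then of_real (c idx) else (0::'a))"
    unfolding tensor_form_def by (intro sum.cong) auto
  then show ?thesis using assms by (simp add: finite_indices)
qed

lemma tensor_form_of_real:
  assumes "length xs = k" "set xs \<subseteq> carrier_vec n"
  shows "tensor_form k n c (map (map_vec of_real) xs) = (of_real (tensor_form k n c xs) :: 'a::{real_algebra_1, comm_ring_1})"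
proof -
  have "(map (map_vec of_real) xs ! j) $ (idx ! j) = (of_real ((xs ! j) $ (idx ! j)) :: 'a)"
    if "idx \<in> indices k n" "j < k" for idx j
  proof -
    have "xs ! j \<in> carrier_vec n" "idx ! j < n" using that assms nth_indices by auto
    then show ?thesis using that assms by simp
  qed
  then show ?thesis
    unfolding tensor_form_def by simp
qed

subsection \<open>The symmetric tensor of a form\<close>

definition monomial_of :: "nat list \<Rightarrow> nat \<Rightarrow>\<^sub>0 nat" where
  "monomial_of idx = (\<Sum>i\<leftarrow>idx. Poly_Mapping.single i 1)"

lemma lookup_monomial_of: "Poly_Mapping.lookup (monomial_of idx) i = count_list idx i"
  by (induction idx) (auto simp: monomial_of_def lookup_add lookup_single when_def)

lemma monomial_of_mset: "mset idx = mset idx' \<Longrightarrow> monomial_of idx = monomial_of idx'"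
  by (rule poly_mapping_eqI) (simp add: lookup_monomial_of flip: count_mset)

lemma keys_monomial_of: "Poly_Mapping.keys (monomial_of idx) = set idx"
  by (auto simp: in_keys_iff lookup_monomial_of count_list_0_iff)

lemma prod_power_count_list:
  fixes x :: "'b \<Rightarrow> 'a::comm_monoid_mult"
  assumes "finite S" "set idx \<subseteq> S"
  shows "(\<Prod>i\<in>S. x i ^ count_list idx i) = prod_list (map x idx)"
  using assms(2)
proof (induction idx)
  case (Cons a idx)
  have "(\<Prod>i\<in>S. x i ^ count_list (a # idx) i) = (\<Prod>i\<in>S. (if i = a then x i else 1) * x i ^ count_list idx i)"
    by (intro prod.cong) auto
  also have "\<dots> = x a * (\<Prod>i\<in>S. x i ^ count_list idx i)"
    using assms(1) Cons.prems by (simp add: prod.distrib)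
  finally show ?case using Cons by simp
qed simp

lemma prod_monomial_of:
  fixes x :: "nat \<Rightarrow> 'a::comm_monoid_mult"
  shows "(\<Prod>i\<in>Poly_Mapping.keys (monomial_of idx). x i ^ Poly_Mapping.lookup (monomial_of idx) i)
    = (\<Prod>j<length idx. x (idx ! j))"
  using prod_power_count_list[of "set idx" idx x]
  by (simp add: keys_monomial_of lookup_monomial_of prod.list_conv_set_nth atLeast0LessThan)

section \<open>Evaluating polynomials at a sequence of moments\<close>

definition umbral :: "(nat \<Rightarrow> 'a::comm_ring_1) \<Rightarrow> 'a poly \<Rightarrow> 'a" where
  "umbral a q = (\<Sum>j\<le>degree q. a j * coeff q j)"

lemma umbral_altdef:
  assumes "degree q \<le> N"
  shows "umbral a q = (\<Sum>j\<le>N. a j * coeff q j)"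
  unfolding umbral_def using assms
  by (intro sum.mono_neutral_left) (auto simp: coeff_eq_0 not_le)

lemma umbral_add: "umbral a (p + q) = umbral a p + umbral a q"
  using umbral_altdef[of "p + q" "max (degree p) (degree q)" a]
    umbral_altdef[of p "max (degree p) (degree q)" a]
    umbral_altdef[of q "max (degree p) (degree q)" a]
  by (simp add: degree_add_le_max sum.distrib algebra_simps)

lemma umbral_smult: "umbral a (Polynomial.smult c p) = c * umbral a p"
  using umbral_altdef[of "Polynomial.smult c p" "degree p" a]
  by (simp add: degree_smult_le umbral_def sum_distrib_left mult_ac)

lemma umbral_0 [simp]: "umbral a 0 = 0"
  by (simp add: umbral_def)

lemma umbral_sum: "umbral a (sum f S) = (\<Sum>x\<in>S. umbral a (f x))"
  by (induction S rule: infinite_finite_induct) (simp_all add: umbral_add)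

lemma umbral_1 [simp]: "umbral a 1 = a 0"
  by (simp add: umbral_def)

lemma umbral_monom: "umbral a (monom c j) = c * a j"
  using umbral_altdef[of "monom c j" j a] by (simp add: degree_monom_le if_distrib mult.commute cong: if_cong)

lemma umbral_pCons: "umbral a (pCons c q) = c * a 0 + umbral (\<lambda>j. a (Suc j)) q"
proof -
  have "umbral a (pCons c q) = (\<Sum>j\<le>Suc (degree q). a j * coeff (pCons c q) j)"
    by (rule umbral_altdef) (simp add: degree_pCons_le)
  also have "\<dots> = a 0 * c + (\<Sum>j\<le>degree q. a (Suc j) * coeff q j)"
    by (subst sum.atMost_Suc_shift) simp
  finally show ?thesis by (simp add: umbral_def mult.commute)
qed

lemma umbral_seq_add: "umbral (\<lambda>j. a j + b j) q = umbral a q + umbral b q"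
  by (simp add: umbral_def sum.distrib distrib_right)

lemma umbral_seq_mult: "umbral (\<lambda>j. c * a j) q = c * umbral a q"
  by (simp add: umbral_def sum_distrib_left mult_ac)

lemma umbral_seq_sum: "umbral (\<lambda>j. \<Sum>i\<in>S. a i j) q = (\<Sum>i\<in>S. umbral (a i) q)"
  by (simp add: umbral_def sum_distrib_right sum.swap[of _ S])

text \<open>A linear factor of the argument is absorbed into the sequence. This mirrors linearity in
  one slot: putting \<open>s x + t y\<close> there turns the moments \<open>a j\<close> into
  \<open>s * a j + t * a (Suc j)\<close>, which is why products of linear factors encode lists of
  arguments.\<close>

lemma umbral_mult_linear: "umbral a ([:s, t:] * q) = umbral (\<lambda>j. s * a j + t * a (Suc j)) q"
  by (simp add: umbral_add umbral_smult umbral_pCons umbral_seq_add umbral_seq_mult)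

lemma umbral_cong: "(\<And>j. j \<le> N \<Longrightarrow> a j = b j) \<Longrightarrow> degree q \<le> N \<Longrightarrow> umbral a q = umbral b q"
  by (simp add: umbral_altdef)

lemma linear_power_expand:
  fixes s t :: "'a::comm_ring_1"
  shows "[:s, t:] ^ m = (\<Sum>l\<le>m. monom (of_nat (m choose l) * s ^ (m - l) * t ^ l) l)"
proof -
  have "[:s, t:] = monom t 1 + [:s:]" by (simp add: monom_altdef)
  then have "[:s, t:] ^ m = (\<Sum>l\<le>m. of_nat (m choose l) * monom t 1 ^ l * [:s:] ^ (m - l))"
    by (simp only: binomial_ring)
  also have "\<dots> = (\<Sum>l\<le>m. monom (of_nat (m choose l) * s ^ (m - l) * t ^ l) l)"
  proof (rule sum.cong[OF refl])
    fix l
    have "[:s:] ^ (m - l) = [:s ^ (m - l):]" by (rule poly_const_pow)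
    then show "of_nat (m choose l) * monom t 1 ^ l * [:s:] ^ (m - l) =
        monom (of_nat (m choose l) * s ^ (m - l) * t ^ l) l"
      by (simp add: monom_power of_nat_poly smult_monom mult_ac)
  qed
  finally show ?thesis .
qed

lemma umbral_X_power:
  fixes a :: "nat \<Rightarrow> 'a::comm_ring_1"
  shows "umbral a ([:0, 1:] ^ k) = a k"
proof -
  have "[:0, 1:] ^ k = monom (1::'a) k" using monom_power[of "1::'a" 1 k] by (simp add: monom_altdef)
  then show ?thesis by (simp add: umbral_monom)
qed

lemma umbral_linear_power:
  "umbral a ([:s, t:] ^ m) = (\<Sum>l\<le>m. of_nat (m choose l) * s ^ (m - l) * t ^ l * a l)"
  unfolding linear_power_expand by (simp add: umbral_sum umbral_monom)

lemma coeff_linear_power: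
  fixes s t :: "'a::comm_ring_1"
  shows "coeff ([:s, t:] ^ m) l = (if l \<le> m then of_nat (m choose l) * s ^ (m - l) * t ^ l else 0)"
  unfolding linear_power_expand by (simp add: coeff_sum coeff_monom)

lemma degree_linear_power_le: "degree ([:s, t:] ^ m) \<le> m"
  for s t :: "'a::comm_ring_1"
  by (rule degree_le) (simp add: coeff_linear_power)

lemma umbral_mult_square:
  "umbral a (q * [:u, v:] ^ 2) = umbral (\<lambda>j. u\<^sup>2 * a j + 2 * u * v * a (Suc j) + v\<^sup>2 * a (Suc (Suc j))) q"
proof -
  have "umbral a (q * [:u, v:] ^ 2) = umbral a ([:u, v:] * ([:u, v:] * q))"
    by (simp only: power2_eq_square mult_ac)
  also have "\<dots> = umbral (\<lambda>j. u\<^sup>2 * a j + 2 * u * v * a (Suc j) + v\<^sup>2 * a (Suc (Suc j))) q"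
    unfolding umbral_mult_linear by (intro arg_cong[of _ _ "\<lambda>f. umbral f q"] ext)
      (simp add: algebra_simps power2_eq_square)
  finally show ?thesis .
qed

text \<open>For the moments of a pure power of a linear form the functional is evaluation of the
  homogenized polynomial at (x, y), hence multiplicative.\<close>

lemma umbral_rank_one:
  fixes x y :: "'a::comm_ring_1"
  assumes "\<And>j. j \<le> length sts \<Longrightarrow> a j = x ^ (length sts - j) * y ^ j"
  shows "umbral a (\<Prod>(s, t)\<leftarrow>sts. [:s, t:]) = (\<Prod>(s, t)\<leftarrow>sts. s * x + t * y)"
  using assms
proof (induction sts arbitrary: a)
  case (Cons st sts)
  obtain s t where st: "st = (s, t)" by force
  have "s * a j + t * a (Suc j) = (s * x + t * y) * (x ^ (length sts - j) * y ^ j)" if "j \<le> length sts" for j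
    using that Cons.prems[of j] Cons.prems[of "Suc j"]
    by (simp add: Suc_diff_le algebra_simps)
  moreover have "degree (\<Prod>(s, t)\<leftarrow>sts. [:s, t:]) \<le> length sts"
  proof (induction sts)
    case (Cons st sts)
    have "degree [:fst st, snd st:] \<le> 1"
      using degree_pCons_le[of "fst st" "[:snd st:]"] by simp
    moreover have "(\<Prod>(s, t)\<leftarrow>st # sts. [:s, t:]) = [:fst st, snd st:] * (\<Prod>(s, t)\<leftarrow>sts. [:s, t:])"
      by (simp only: list.map prod_list.Cons case_prod_beta)
    ultimately show ?case
      using Cons degree_mult_le[of "[:fst st, snd st:]" "\<Prod>(s, t)\<leftarrow>sts. [:s, t:]"]
      by (simp only: list.size)
    qed simp
  ultimately have "umbral a (\<Prod>(s, t)\<leftarrow>st # sts. [:s, t:])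
      = umbral (\<lambda>j. (s * x + t * y) * (x ^ (length sts - j) * y ^ j)) (\<Prod>(s, t)\<leftarrow>sts. [:s, t:])"
    unfolding st by (simp only: list.map prod_list.Cons case_prod_conv umbral_mult_linear)
      (rule umbral_cong[where N = "length sts"]; simp)
  also have "\<dots> = (s * x + t * y) * (\<Prod>(s, t)\<leftarrow>sts. s * x + t * y)"
    by (subst umbral_seq_mult, subst Cons.IH) simp_all
  finally show ?case using st by simp
qed simp

text \<open>For k \<ge> 2 and up to the factor k (k - 1) this is the quadratic form of the Hessian,
  at (s, t) and in direction (u, v), of the binary form with coefficients (k choose j) a_j.\<close>

definition convex_seq :: "nat \<Rightarrow> (nat \<Rightarrow> real) \<Rightarrow> bool" where
  "convex_seq k a \<longleftrightarrow> (\<forall>s t u v. umbral a ([:s, t:] ^ (k - 2) * [:u, v:] ^ 2) \<ge> 0)"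

lemma umbral_hessian:
  "umbral a ([:s, t:] ^ m * [:u, v:] ^ 2) =
    (\<Sum>j\<le>m. of_nat (m choose j) * s ^ (m - j) * t ^ j * (u\<^sup>2 * a j + 2 * u * v * a (Suc j) + v\<^sup>2 * a (Suc (Suc j))))"
  by (simp only: umbral_mult_square umbral_linear_power)

section \<open>The polar form of a form\<close>

text \<open>The trailing copies of x and y are accumulators: each step splits the head vector into
  its two parts and moves x or y into its block; the second choice shifts the moments by
  one.\<close>

lemma symmetric_linear_umbral:
  fixes T :: "'a::comm_ring_1 Matrix.vec list \<Rightarrow> 'a"
  assumes T: "symmetric_linear k n T" and x: "x \<in> carrier_vec n" and y: "y \<in> carrier_vec n"
    and "length sts + i + j = k"
  shows "T (map (\<lambda>(s, t). s \<cdot>\<^sub>v x + t \<cdot>\<^sub>v y) sts @ replicate i x @ replicate j y) =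
    umbral (\<lambda>l. T (replicate (k - (j + l)) x @ replicate (j + l) y)) (\<Prod>(s, t)\<leftarrow>sts. [:s, t:])"
  using assms(4)
proof (induction sts arbitrary: i j)
  case Nil
  then show ?case by auto
next
  case (Cons st sts)
  obtain s t where st: "st = (s, t)" by force
  let ?M = "map (\<lambda>(s, t). s \<cdot>\<^sub>v x + t \<cdot>\<^sub>v y) sts"
  let ?P = "\<Prod>(s, t)\<leftarrow>sts. [:s, t:]"
  let ?f = "\<lambda>j l. T (replicate (k - (j + l)) x @ replicate (j + l) y)"
  have M: "set ?M \<subseteq> carrier_vec n" using x y by auto
  have R: "set (?M @ replicate i x @ replicate j y) \<subseteq> carrier_vec n" using M x y by auto
  have "T (map (\<lambda>(s, t). s \<cdot>\<^sub>v x + t \<cdot>\<^sub>v y) (st # sts) @ replicate i x @ replicate j y) =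
     s * T (x # ?M @ replicate i x @ replicate j y) + t * T (y # ?M @ replicate i x @ replicate j y)"
    using symmetric_linear_Cons[OF T _ R x y, of s t] Cons.prems st by simp
  also have "T (x # ?M @ replicate i x @ replicate j y) = T (?M @ replicate (Suc i) x @ replicate j y)"
    using M x y Cons.prems by (intro symmetric_linear_perm[OF T]) auto
  also have "T (y # ?M @ replicate i x @ replicate j y) = T (?M @ replicate i x @ replicate (Suc j) y)"
    using M x y Cons.prems by (intro symmetric_linear_perm[OF T]) auto
  also have "T (?M @ replicate (Suc i) x @ replicate j y) = umbral (?f j) ?P"
    using Cons.IH[of "Suc i" j] Cons.prems by simp
  also have "T (?M @ replicate i x @ replicate (Suc j) y) = umbral (?f (Suc j)) ?P"
    using Cons.IH[of i "Suc j"] Cons.prems by simp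
  also have "?f (Suc j) = (\<lambda>l. ?f j (Suc l))" by simp
  also have "s * umbral (?f j) ?P + t * umbral (\<lambda>l. ?f j (Suc l)) ?P = umbral (?f j) ([:s, t:] * ?P)"
    by (simp only: umbral_mult_linear umbral_seq_add umbral_seq_mult)
  finally show ?case using st by simp
qed

lemma symmetric_linear_umbral_power:
  fixes T :: "'a::comm_ring_1 Matrix.vec list \<Rightarrow> 'a"
  assumes T: "symmetric_linear k n T" and x: "x \<in> carrier_vec n" and y: "y \<in> carrier_vec n"
    and "i + j = k"
  shows "T (replicate i (s \<cdot>\<^sub>v x + t \<cdot>\<^sub>v y) @ replicate j (u \<cdot>\<^sub>v x + v \<cdot>\<^sub>v y)) =
    umbral (\<lambda>l. T (replicate (k - l) x @ replicate l y)) ([:s, t:] ^ i * [:u, v:] ^ j)"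
  using symmetric_linear_umbral[OF T x y, of "replicate i (s, t) @ replicate j (u, v)" 0 0] assms(4)
  by (simp add: prod_list_replicate)

lemma symmetric_linear_append:
  assumes T: "symmetric_linear k n T" and "m + length zs = k" "set zs \<subseteq> carrier_vec n"
  shows "symmetric_linear m n (\<lambda>xs. T (xs @ zs))"
  unfolding symmetric_linear_def
proof (intro conjI allI impI)
  fix xs ys :: "'a Matrix.vec list" assume "length xs = m" "set xs \<subseteq> carrier_vec n" "mset ys = mset xs"
  then show "T (ys @ zs) = T (xs @ zs)" using assms(2,3) by (intro symmetric_linear_perm[OF T]) auto
next
  fix xs :: "'a Matrix.vec list" and u w :: "'a Matrix.vec" and a b
  assume "Suc (length xs) = m" "set xs \<subseteq> carrier_vec n" "u \<in> carrier_vec n" "w \<in> carrier_vec n"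
  then show "T (((a \<cdot>\<^sub>v u + b \<cdot>\<^sub>v w) # xs) @ zs) = a * T ((u # xs) @ zs) + b * T ((w # xs) @ zs)"
    using assms(2,3) symmetric_linear_Cons[OF T, of "xs @ zs" u w a b] by simp
qed

text \<open>Polarization by induction instead of an alternating sum. Put x + t w into all of the
  first Suc m slots: the value is a polynomial in t that vanishes identically, and its linear
  coefficient is Suc m times the value with a single w. Characteristic zero thus frees one further
  argument.\<close>

lemma symmetric_linear_diag_zero:
  fixes T :: "real Matrix.vec list \<Rightarrow> real"
  assumes T: "symmetric_linear k n T" and diag: "\<And>x. x \<in> carrier_vec n \<Longrightarrow> T (replicate k x) = 0"
    and "m + length zs = k" "set zs \<subseteq> carrier_vec n" "x \<in> carrier_vec n"
  shows "T (replicate m x @ zs) = 0"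
  using assms(3-5)
proof (induction zs arbitrary: m x)
  case Nil
  then show ?case using diag by simp
next
  case (Cons w zs)
  have w: "w \<in> carrier_vec n" and zs: "set zs \<subseteq> carrier_vec n" using Cons.prems by auto
  let ?T = "\<lambda>xs. T (xs @ zs)"
  let ?f = "\<lambda>l. ?T (replicate (Suc m - l) x @ replicate l w)"
  have T': "symmetric_linear (Suc m) n ?T"
    using Cons.prems by (intro symmetric_linear_append[OF T]) auto
  have "(\<Sum>l\<le>Suc m. (of_nat (Suc m choose l) * ?f l) * t ^ l) = 0" for t
  proof -
    have "?T (replicate (Suc m) (1 \<cdot>\<^sub>v x + t \<cdot>\<^sub>v w)) = umbral ?f ([:1, t:] ^ Suc m)"
      using symmetric_linear_umbral_power[OF T' Cons.prems(3) w, of "Suc m" 0 1 t 0 0] by simp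
    moreover have "?T (replicate (Suc m) (1 \<cdot>\<^sub>v x + t \<cdot>\<^sub>v w)) = 0"
      using Cons.prems zs w by (intro Cons.IH) auto
    ultimately have "umbral ?f ([:1, t:] ^ Suc m) = 0" by (simp only:)
    then show ?thesis by (simp only: umbral_linear_power power_one mult_1_right mult_1_left mult_ac)
  qed
  then have "\<forall>t. (\<Sum>l\<le>Suc m. (of_nat (Suc m choose l) * ?f l) * t ^ l) = 0" by (rule allI)
  then have "\<forall>l\<le>Suc m. of_nat (Suc m choose l) * ?f l = 0"
    by (rule iffD1[OF polyfun_eq_0])
  then have "of_nat (Suc m choose 1) * ?f 1 = 0" by (rule allE[of _ 1]) (erule impE, simp, assumption)
  moreover have "?f 1 = T (replicate m x @ w # zs)" by simp
  ultimately have "of_nat (Suc m choose 1) * T (replicate m x @ w # zs) = 0" by (simp only:)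
  moreover have "real (Suc m choose 1) \<noteq> 0" by simp
  ultimately show ?case using mult_eq_0_iff by blast
qed

lemma symmetric_linear_unique:
  fixes T T' :: "real Matrix.vec list \<Rightarrow> real"
  assumes T: "symmetric_linear k n T" and T': "symmetric_linear k n T'"
    and diag: "\<And>x. x \<in> carrier_vec n \<Longrightarrow> T (replicate k x) = T' (replicate k x)"
    and xs: "xs \<in> vec_tuples k n"
  shows "T xs = T' xs"
proof -
  have "symmetric_linear k n (\<lambda>xs. T xs - T' xs)"
    unfolding symmetric_linear_def
  proof (intro conjI allI impI)
    fix xs ys :: "real Matrix.vec list" assume *: "length xs = k" "set xs \<subseteq> carrier_vec n" "mset ys = mset xs"
    show "T ys - T' ys = T xs - T' xs"
      by (simp only: symmetric_linear_perm[OF T *(3,1,2)] symmetric_linear_perm[OF T' *(3,1,2)])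
  next
    fix xs :: "real Matrix.vec list" and u w :: "real Matrix.vec" and a b
    assume *: "Suc (length xs) = k" "set xs \<subseteq> carrier_vec n" "u \<in> carrier_vec n" "w \<in> carrier_vec n"
    show "T ((a \<cdot>\<^sub>v u + b \<cdot>\<^sub>v w) # xs) - T' ((a \<cdot>\<^sub>v u + b \<cdot>\<^sub>v w) # xs) =
        a * (T (u # xs) - T' (u # xs)) + b * (T (w # xs) - T' (w # xs))"
      unfolding symmetric_linear_Cons[OF T *] symmetric_linear_Cons[OF T' *] by (simp add: algebra_simps)
  qed
  from symmetric_linear_diag_zero[OF this, of 0 xs "0\<^sub>v n"] diag xs
  show ?thesis by (simp add: vec_tuples_def)
qed

lemma symmetric_linear_cong:
  assumes T: "symmetric_linear k n T" and eq: "\<And>xs. length xs = k \<Longrightarrow> set xs \<subseteq> carrier_vec n \<Longrightarrow> T' xs = T xs"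
  shows "symmetric_linear k n T'"
  unfolding symmetric_linear_def
proof (intro conjI allI impI)
  fix xs ys :: "'a Matrix.vec list" assume xs: "length xs = k" "set xs \<subseteq> carrier_vec n" "mset ys = mset xs"
  then have "length ys = k" "set ys \<subseteq> carrier_vec n"
    using mset_eq_length[OF xs(3)] mset_eq_setD[OF xs(3)] by auto
  then show "T' ys = T' xs" using symmetric_linear_perm[OF T xs(3,1,2)] eq[of ys] eq[OF xs(1,2)] by simp
next
  fix xs :: "'a Matrix.vec list" and u w :: "'a Matrix.vec" and a b
  assume *: "Suc (length xs) = k" "set xs \<subseteq> carrier_vec n" "u \<in> carrier_vec n" "w \<in> carrier_vec n"
  then have "a \<cdot>\<^sub>v u + b \<cdot>\<^sub>v w \<in> carrier_vec n" by simp
  with * symmetric_linear_Cons[OF T *] eq[of "(a \<cdot>\<^sub>v u + b \<cdot>\<^sub>v w) # xs"] eq[of "u # xs"] eq[of "w # xs"]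
  show "T' ((a \<cdot>\<^sub>v u + b \<cdot>\<^sub>v w) # xs) = a * T' (u # xs) + b * T' (w # xs)" by simp
qed

text \<open>The coefficient of a monomial is shared equally among the index lists that spell it;
  their number is a multinomial coefficient.\<close>

definition form_tensor :: "nat \<Rightarrow> nat \<Rightarrow> rpoly \<Rightarrow> nat list \<Rightarrow> real" where
  "form_tensor k n p idx = Poly_Mapping.lookup p (monomial_of idx) /
     card {idx'\<in>indices k n. monomial_of idx' = monomial_of idx}"

lemma form_tensor_mset: "mset idx = mset idx' \<Longrightarrow> form_tensor k n p idx = form_tensor k n p idx'"
  using monomial_of_mset[of idx idx'] by (simp add: form_tensor_def)

lemma forms_keys_monomial:
  assumes "p \<in> forms n k"
  shows "Poly_Mapping.keys p \<subseteq> monomial_of ` indices k n"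
proof
  fix m assume m: "m \<in> Poly_Mapping.keys p"
  obtain idx where idx: "mset idx = (\<Sum>i\<in>Poly_Mapping.keys m. replicate_mset (Poly_Mapping.lookup m i) i)"
    using ex_mset by blast
  have cnt: "count_list idx i = Poly_Mapping.lookup m i" for i
    unfolding count_mset[symmetric] idx by (auto simp: count_sum in_keys_iff)
  then have m_eq: "m = monomial_of idx" by (intro poly_mapping_eqI) (simp add: lookup_monomial_of)
  have keys: "Poly_Mapping.keys m \<subseteq> {..<n}" "(\<Sum>i\<in>Poly_Mapping.keys m. Poly_Mapping.lookup m i) = k"
    using assms m by (auto simp: forms_def)
  have "length idx = (\<Sum>i\<in>Poly_Mapping.keys m. count_list idx i)"
    using sum_count_set[of idx "Poly_Mapping.keys m"] by (simp add: m_eq keys_monomial_of)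
  then have "idx \<in> indices k n" using keys by (simp add: indices_def cnt) (simp add: m_eq keys_monomial_of)
  then show "m \<in> monomial_of ` indices k n" using m_eq by blast
qed

lemma tensor_form_diag:
  fixes x :: "'a::{real_algebra_1, comm_ring_1} Matrix.vec"
  assumes "p \<in> forms n k"
  shows "tensor_form k n (form_tensor k n p) (replicate k x) = poly_value p x"
proof -
  let ?I = "indices k n"
  let ?v = "\<lambda>m. \<Prod>i\<in>Poly_Mapping.keys m. (x $ i) ^ Poly_Mapping.lookup m i"
  have "tensor_form k n (form_tensor k n p) (replicate k x) =
      (\<Sum>idx\<in>?I. of_real (form_tensor k n p idx) * ?v (monomial_of idx))"
    unfolding tensor_form_def
  proof (rule sum.cong[OF refl])
    fix idx assume "idx \<in> ?I"
    then have "k = length idx" by (simp add: indices_def)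
    then show "of_real (form_tensor k n p idx) * (\<Prod>j<k. replicate k x ! j $ (idx ! j)) =
        of_real (form_tensor k n p idx) * ?v (monomial_of idx)"
      using prod_monomial_of[of "\<lambda>i. x $ i" idx] by simp
  qed
  also have "\<dots> = (\<Sum>m\<in>monomial_of ` ?I. \<Sum>idx\<in>{idx\<in>?I. monomial_of idx = m}. of_real (form_tensor k n p idx) * ?v (monomial_of idx))"
    by (rule sum.image_gen[OF finite_indices])
  also have "\<dots> = (\<Sum>m\<in>monomial_of ` ?I. of_real (Poly_Mapping.lookup p m) * ?v m)"
  proof (rule sum.cong[OF refl])
    fix m assume "m \<in> monomial_of ` ?I"
    then have "{idx\<in>?I. monomial_of idx = m} \<noteq> {}" by auto
    then have card: "card {idx\<in>?I. monomial_of idx = m} \<noteq> 0" using finite_indices by simp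
    have "(\<Sum>idx\<in>{idx\<in>?I. monomial_of idx = m}. of_real (form_tensor k n p idx) * ?v (monomial_of idx)) =
       (\<Sum>idx\<in>{idx\<in>?I. monomial_of idx = m}. of_real (Poly_Mapping.lookup p m / card {idx\<in>?I. monomial_of idx = m}) * ?v m)"
      by (rule sum.cong) (auto simp: form_tensor_def)
    also have "\<dots> = of_real (card {idx\<in>?I. monomial_of idx = m} * (Poly_Mapping.lookup p m / card {idx\<in>?I. monomial_of idx = m})) * ?v m"
      by (simp only: sum_constant of_real_mult of_real_of_nat_eq mult.assoc)
    finally show "(\<Sum>idx\<in>{idx\<in>?I. monomial_of idx = m}. of_real (form_tensor k n p idx) * ?v (monomial_of idx)) =
        of_real (Poly_Mapping.lookup p m) * ?v m" using card by simp
  qed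
  also have "\<dots> = (\<Sum>m\<in>Poly_Mapping.keys p. of_real (Poly_Mapping.lookup p m) * ?v m)"
    using finite_indices forms_keys_monomial[OF assms]
    by (intro sum.mono_neutral_right) (auto simp: in_keys_iff)
  finally show ?thesis by (simp add: poly_value_def)
qed

lemma symmetric_linear_restrict_tensor_form:
  "symmetric_linear k n (restrict (tensor_form k n (form_tensor k n p)) (vec_tuples k n))"
proof (rule symmetric_linear_cong[OF tensor_form_symmetric_linear[of "form_tensor k n p"]])
  show "form_tensor k n p idx = form_tensor k n p idx'" if "mset idx = mset idx'" for idx idx'
    using form_tensor_mset[OF that] .
qed (simp add: vec_tuples_def)

text \<open>The definite description needs existence and uniqueness: the tensor supplies the form,
  and the values on the diagonal determine it.\<close>

lemma polar_form_eq_tensor_form: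
  assumes p: "p \<in> forms n k"
  shows "polar_form k n p = restrict (tensor_form k n (form_tensor k n p)) (vec_tuples k n)"
  unfolding polar_form_def
proof (rule the_equality)
  let ?T = "tensor_form k n (form_tensor k n p) :: real Matrix.vec list \<Rightarrow> real"
  let ?R = "restrict ?T (vec_tuples k n)"
  have R: "symmetric_linear k n ?R" by (rule symmetric_linear_restrict_tensor_form)
  have diag: "?R (replicate k x) = poly_value p x" if "x \<in> carrier_vec n" for x
    using that tensor_form_diag[OF p, of x] by (auto simp: vec_tuples_def)
  show "?R \<in> extensional (vec_tuples k n) \<and> sym_multilinear k n ?R \<and>
      (\<forall>x\<in>carrier_vec n. ?R (replicate k x) = poly_value p x)"
    using R diag by (simp add: sym_multilinear_iff)
  fix S assume S: "S \<in> extensional (vec_tuples k n) \<and> sym_multilinear k n S \<and>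
      (\<forall>x\<in>carrier_vec n. S (replicate k x) = poly_value p x)"
  show "S = ?R"
  proof (rule extensionalityI[of _ "vec_tuples k n"])
    fix xs assume "xs \<in> vec_tuples k n"
    then show "S xs = ?R xs"
      using S R diag symmetric_linear_unique[of k n S ?R xs] by (simp add: sym_multilinear_iff)
  qed (use S in auto)
qed

lemma
  assumes p: "p \<in> forms n k"
  shows polar_form_symmetric_linear: "symmetric_linear k n (polar_form k n p)"
    and polar_form_diag: "x \<in> carrier_vec n \<Longrightarrow> polar_form k n p (replicate k x) = poly_value p x"
    and complex_extension_polar_form: "complex_extension k n (polar_form k n p) = tensor_form k n (form_tensor k n p)"
proof -
  note eq = polar_form_eq_tensor_form[OF p]
  show "symmetric_linear k n (polar_form k n p)"
    unfolding eq by (rule symmetric_linear_restrict_tensor_form)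
  show "polar_form k n p (replicate k x) = poly_value p x" if "x \<in> carrier_vec n"
    using that tensor_form_diag[OF p, of x] by (auto simp: eq vec_tuples_def)
  have "polar_form k n p (map (unit_vec n) idx) = form_tensor k n p idx" if "idx \<in> indices k n" for idx
  proof -
    have "map (unit_vec n) idx \<in> vec_tuples k n" using that by (auto simp: vec_tuples_def indices_def)
    then show ?thesis using tensor_form_unit_vec[OF that, of "form_tensor k n p", where 'a = real] by (simp add: eq)
  qed
  then show "complex_extension k n (polar_form k n p) = tensor_form k n (form_tensor k n p)"
    by (intro ext) (simp add: complex_extension_def tensor_form_def flip: indices_def)
qed

definition coeffs_along :: "nat \<Rightarrow> nat \<Rightarrow> rpoly \<Rightarrow> real Matrix.vec \<Rightarrow> real Matrix.vec \<Rightarrow> nat \<Rightarrow> real" where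
  "coeffs_along k n p x y j = polar_form k n p (replicate (k - j) x @ replicate j y)"

lemma biform_coeffs_along: "biform n d p x y = coeffs_along (2 * d) n p x y d"
  by (simp add: biform_def coeffs_along_def mult_2)

lemma poly_value_coeffs_along:
  assumes "p \<in> forms n k" "x \<in> carrier_vec n" "y \<in> carrier_vec n"
  shows "poly_value p (s \<cdot>\<^sub>v x + t \<cdot>\<^sub>v y) = umbral (coeffs_along k n p x y) ([:s, t:] ^ k)"
  using symmetric_linear_umbral_power[OF polar_form_symmetric_linear[OF assms(1)] assms(2,3), of k 0 s t 0 0]
    polar_form_diag[OF assms(1), of "s \<cdot>\<^sub>v x + t \<cdot>\<^sub>v y"] assms
  by (simp add: coeffs_along_def[abs_def])

lemma poly_value_coeffs_along_0:
  assumes "p \<in> forms n k" "x \<in> carrier_vec n"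
  shows "coeffs_along k n p x y 0 = poly_value p x"
  using polar_form_diag[OF assms] by (simp add: coeffs_along_def)

lemma poly_value_coeffs_along_last:
  assumes "p \<in> forms n k" "y \<in> carrier_vec n"
  shows "coeffs_along k n p x y k = poly_value p y"
  using polar_form_diag[OF assms] by (simp add: coeffs_along_def)

lemma complex_vec_decompose:
  fixes z :: "complex Matrix.vec"
  assumes "z \<in> carrier_vec n"
  shows "z = 1 \<cdot>\<^sub>v map_vec of_real (map_vec Re z) + \<i> \<cdot>\<^sub>v map_vec of_real (map_vec Im z)"
    and "conjugate z = 1 \<cdot>\<^sub>v map_vec of_real (map_vec Re z) + (- \<i>) \<cdot>\<^sub>v map_vec of_real (map_vec Im z)"
  using assms by (auto intro!: eq_vecI simp: complex_eq_iff)

text \<open>The arguments are complex combinations of two real vectors, so the moments stay real and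
  complex numbers enter only through the polynomial. Thus p(z) and Q_p(z, cnj z) become values of
  one functional with real moments.\<close>

lemma tensor_form_complex_umbral:
  assumes p: "p \<in> forms n k" and x: "x \<in> carrier_vec n" and y: "y \<in> carrier_vec n" and "i + j = k"
  shows "tensor_form k n (form_tensor k n p)
      (replicate i (s \<cdot>\<^sub>v map_vec of_real x + t \<cdot>\<^sub>v map_vec of_real y) @
       replicate j (u \<cdot>\<^sub>v map_vec of_real x + v \<cdot>\<^sub>v map_vec of_real y)) =
    umbral (\<lambda>l. complex_of_real (coeffs_along k n p x y l)) ([:s, t:] ^ i * [:u, v:] ^ j)"
proof -
  have T: "symmetric_linear k n (tensor_form k n (form_tensor k n p) :: complex Matrix.vec list \<Rightarrow> complex)"
    by (rule tensor_form_symmetric_linear[OF form_tensor_mset])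
  have x': "map_vec complex_of_real x \<in> carrier_vec n" and y': "map_vec complex_of_real y \<in> carrier_vec n"
    using x y by auto
  have eq: "tensor_form k n (form_tensor k n p)
      (replicate (k - l) (map_vec complex_of_real x) @ replicate l (map_vec complex_of_real y)) =
      complex_of_real (coeffs_along k n p x y l)" if "l \<le> k" for l
  proof -
    let ?xs = "replicate (k - l) x @ replicate l y"
    have "?xs \<in> vec_tuples k n" using x y that by (auto simp: vec_tuples_def)
    then show ?thesis
      using tensor_form_of_real[of ?xs k n "form_tensor k n p", where 'a = complex]
      by (simp add: coeffs_along_def polar_form_eq_tensor_form[OF p] vec_tuples_def)
  qed
  have "degree ([:s, t:] ^ i * [:u, v:] ^ j) \<le> k"
    using degree_mult_le[of "[:s, t:] ^ i" "[:u, v:] ^ j"] degree_linear_power_le[of s t i]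
      degree_linear_power_le[of u v j] assms(4) by linarith
  then show ?thesis
    unfolding symmetric_linear_umbral_power[OF T x' y' assms(4)] by (intro umbral_cong[where N = k] eq)
qed

lemma complex_poly_value_coeffs_along:
  fixes z :: "complex Matrix.vec"
  assumes p: "p \<in> forms n k" and z: "z \<in> carrier_vec n"
  shows "poly_value p z = umbral (\<lambda>l. complex_of_real (coeffs_along k n p (map_vec Re z) (map_vec Im z) l)) ([:1, \<i>:] ^ k)"
  using tensor_form_complex_umbral[OF p, of "map_vec Re z" "map_vec Im z" k 0 1 \<i> 0 0] z
  by (simp only: complex_vec_decompose[OF z, symmetric] replicate_0 append_Nil2 power_0 mult_1_right tensor_form_diag[OF p]) simp

lemma complex_biform_coeffs_along:
  fixes z :: "complex Matrix.vec"
  assumes p: "p \<in> forms n (2 * d)" and z: "z \<in> carrier_vec n"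
  shows "complex_biform n d p z (conjugate z) =
    umbral (\<lambda>l. complex_of_real (coeffs_along (2 * d) n p (map_vec Re z) (map_vec Im z) l)) ([:1, \<i>:] ^ d * [:1, - \<i>:] ^ d)"
  using tensor_form_complex_umbral[OF p, of "map_vec Re z" "map_vec Im z" d d 1 \<i> 1 "- \<i>"] z
  by (simp only: complex_vec_decompose[OF z, symmetric] complex_biform_def complex_extension_polar_form[OF p]) simp

section \<open>Hessians and convexity\<close>

lemma symmetric_linear_DERIV:
  fixes T :: "real Matrix.vec list \<Rightarrow> real"
  assumes T: "symmetric_linear m n T" and x: "x \<in> carrier_vec n" and e: "e \<in> carrier_vec n"
  shows "((\<lambda>h. T (replicate m (x + h \<cdot>\<^sub>v e))) has_field_derivative m * T (replicate (m - 1) x @ [e])) (at 0)"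
proof -
  let ?f = "\<lambda>l. T (replicate (m - l) x @ replicate l e)"
  let ?c = "\<lambda>l. of_nat (m choose l) * ?f l"
  have "T (replicate m (x + h \<cdot>\<^sub>v e)) = (\<Sum>l\<le>m. ?c l * h ^ l)" for h
  proof -
    have "T (replicate m (1 \<cdot>\<^sub>v x + h \<cdot>\<^sub>v e)) = umbral ?f ([:1, h:] ^ m)"
      using symmetric_linear_umbral_power[OF T x e, of m 0 1 h 0 0] by (simp only: replicate_0 append_Nil2 power_0 mult_1_right)
    also have "\<dots> = (\<Sum>l\<le>m. ?c l * h ^ l)"
      by (simp only: umbral_linear_power power_one mult_1_right mult_1_left mult_ac)
    finally show ?thesis by simp
  qed
  moreover have "((\<lambda>h. \<Sum>l\<le>m. ?c l * h ^ l) has_field_derivative (\<Sum>l\<le>m. ?c l * (of_nat l * 0 ^ (l - 1)))) (at 0)"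
    by (auto intro!: derivative_eq_intros sum.cong simp: mult_ac)
  moreover have "(\<Sum>l\<le>m. ?c l * (of_nat l * 0 ^ (l - 1))) = (\<Sum>l\<le>m. if l = 1 then of_nat m * ?f 1 else 0)"
    by (intro sum.cong) (auto simp: power_0_left)
  moreover have "\<dots> = m * T (replicate (m - 1) x @ [e])" by (cases m) auto
  ultimately show ?thesis by simp
qed

lemma symmetric_linear_expand:
  fixes T :: "real Matrix.vec list \<Rightarrow> real"
  assumes T: "symmetric_linear m n T" and xs: "Suc (length xs) = m" "set xs \<subseteq> carrier_vec n"
    and v: "v \<in> carrier_vec n"
  shows "T (v # xs) = (\<Sum>i<n. v $ i * T (unit_vec n i # xs))"
proof -
  let ?w = "\<lambda>j. Matrix.vec n (\<lambda>i. if i < j then v $ i else 0)"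
  have "T (?w j # xs) = (\<Sum>i<j. v $ i * T (unit_vec n i # xs))" if "j \<le> n" for j
    using that
  proof (induction j)
    case 0
    have "?w 0 = 0 \<cdot>\<^sub>v v + 0 \<cdot>\<^sub>v v" using v by (intro eq_vecI) auto
    then show ?case using symmetric_linear_Cons[OF T xs v v, of 0 0] by (simp only:) simp
  next
    case (Suc j)
    have "?w (Suc j) = 1 \<cdot>\<^sub>v ?w j + (v $ j) \<cdot>\<^sub>v unit_vec n j" using Suc.prems
      by (intro eq_vecI) (auto simp: less_Suc_eq)
    then have "T (?w (Suc j) # xs) = 1 * T (?w j # xs) + v $ j * T (unit_vec n j # xs)"
      using symmetric_linear_Cons[OF T xs, of "?w j" "unit_vec n j" 1 "v $ j"] by (simp only:) simp
    with Suc show ?case by simp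
  qed
  moreover have "?w n = v" using v by (intro eq_vecI) auto
  ultimately show ?thesis by (metis order_refl)
qed

lemma hessian_poly_value:
  assumes p: "p \<in> forms n k" and x: "x \<in> carrier_vec n" and "i < n" "j < n"
  shows "hessian n (poly_value p) x $$ (i, j) =
    real k * (real k - 1) * polar_form k n p (replicate (k - 2) x @ [unit_vec n i, unit_vec n j])"
proof -
  let ?T = "polar_form k n p"
  have T: "symmetric_linear k n ?T" by (rule polar_form_symmetric_linear[OF p])
  have first: "partial_deriv n j (poly_value p) y = k * ?T (replicate (k - 1) y @ [unit_vec n j])"
    if y: "y \<in> carrier_vec n" for y
  proof -
    have "poly_value p (y + h \<cdot>\<^sub>v unit_vec n j) = ?T (replicate k (y + h \<cdot>\<^sub>v unit_vec n j))" for h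
      using y by (simp add: polar_form_diag[OF p])
    then show ?thesis
      using symmetric_linear_DERIV[OF T y, of "unit_vec n j"] by (simp add: partial_deriv_def DERIV_imp_deriv)
  qed
  have "partial_deriv n i (partial_deriv n j (poly_value p)) x =
      real k * (real (k - 1) * ?T (replicate (k - 2) x @ [unit_vec n i, unit_vec n j]))"
  \<comment> \<open>For k = 0 the list in \<open>first\<close> has one argument although
    \<open>?T\<close> takes none, so multilinearity says nothing about it; the factor k removes that
    value.\<close>
  proof (cases "k = 0")
    case True
    have "partial_deriv n j (poly_value p) (x + h \<cdot>\<^sub>v unit_vec n i) = 0" for h
      using first[of "x + h \<cdot>\<^sub>v unit_vec n i"] x True by simp
    then show ?thesis using True by (simp add: partial_deriv_def[of n i])
  next
    case False
    let ?S = "\<lambda>xs. ?T (xs @ [unit_vec n j])"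
    have S: "symmetric_linear (k - 1) n ?S" using False by (intro symmetric_linear_append[OF T]) auto
    have "partial_deriv n j (poly_value p) (x + h \<cdot>\<^sub>v unit_vec n i) = k * ?S (replicate (k - 1) (x + h \<cdot>\<^sub>v unit_vec n i))" for h
      using first[of "x + h \<cdot>\<^sub>v unit_vec n i"] x by simp
    then show ?thesis
      using DERIV_cmult[OF symmetric_linear_DERIV[OF S x, of "unit_vec n i"], of "real k"]
      by (simp add: partial_deriv_def[of n i] DERIV_imp_deriv numeral_2_eq_2)
  qed
  then show ?thesis using assms(3,4) by (cases "k = 0") (simp_all add: hessian_def of_nat_diff Suc_leI)
qed

lemma hessian_quadratic_form:
  assumes p: "p \<in> forms n k" and "k \<ge> 2" and x: "x \<in> carrier_vec n" and v: "v \<in> carrier_vec n"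
  shows "scalar_prod v (hessian n (poly_value p) x *\<^sub>v v) =
    real k * (real k - 1) * polar_form k n p (replicate (k - 2) x @ replicate 2 v)"
proof -
  let ?T = "polar_form k n p"
  let ?R = "replicate (k - 2) x"
  have T: "symmetric_linear k n ?T" by (rule polar_form_symmetric_linear[OF p])
  have R: "set ?R \<subseteq> carrier_vec n" using x by auto
  have perm: "?T (?R @ [u, w]) = ?T (w # u # ?R)" "?T (?R @ [u, w]) = ?T (u # w # ?R)"
    if "u \<in> carrier_vec n" "w \<in> carrier_vec n" for u w
    using that R \<open>k \<ge> 2\<close> by (auto intro!: symmetric_linear_perm[OF T])
  have "?T (?R @ [v, v]) = (\<Sum>i<n. v $ i * ?T (unit_vec n i # v # ?R))"
    using symmetric_linear_expand[OF T, of "v # ?R" v] perm(1)[OF v v] R v \<open>k \<ge> 2\<close> by simp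
  also have "\<dots> = (\<Sum>i<n. v $ i * (\<Sum>j<n. v $ j * ?T (?R @ [unit_vec n i, unit_vec n j])))"
  proof (intro sum.cong refl arg_cong2[of _ _ _ _ "(*)"])
    fix i
    have "?T (unit_vec n i # v # ?R) = ?T (v # unit_vec n i # ?R)"
      using perm[of "unit_vec n i" v] v by simp
    also have "\<dots> = (\<Sum>j<n. v $ j * ?T (unit_vec n j # unit_vec n i # ?R))"
      using symmetric_linear_expand[OF T, of "unit_vec n i # ?R" v] R v \<open>k \<ge> 2\<close> by simp
    also have "\<dots> = (\<Sum>j<n. v $ j * ?T (?R @ [unit_vec n i, unit_vec n j]))"
      using perm(1)[of "unit_vec n i" "unit_vec n _"] by simp
    finally show "?T (unit_vec n i # v # ?R) = (\<Sum>j<n. v $ j * ?T (?R @ [unit_vec n i, unit_vec n j]))" .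
  qed
  finally have T_vv: "?T (?R @ replicate 2 v) = (\<Sum>i<n. v $ i * (\<Sum>j<n. v $ j * ?T (?R @ [unit_vec n i, unit_vec n j])))"
    by (simp add: numeral_2_eq_2)
  have H: "hessian n (poly_value p) x \<in> carrier_mat n n" by (simp add: hessian_def)
  have "scalar_prod v (hessian n (poly_value p) x *\<^sub>v v) =
      (\<Sum>i<n. v $ i * (\<Sum>j<n. hessian n (poly_value p) x $$ (i, j) * v $ j))"
    using H v by (simp add: scalar_prod_def atLeast0LessThan)
  also have "\<dots> = (\<Sum>i<n. v $ i * (\<Sum>j<n. real k * (real k - 1) * ?T (?R @ [unit_vec n i, unit_vec n j]) * v $ j))"
    by (intro sum.cong refl arg_cong2[of _ _ _ _ "(*)"]) (simp add: hessian_poly_value[OF p x])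
  also have "\<dots> = real k * (real k - 1) * ?T (?R @ replicate 2 v)"
    unfolding T_vv by (simp add: sum_distrib_left mult_ac)
  finally show ?thesis .
qed

lemma convex_forms_iff:
  assumes p: "p \<in> forms n k" and "k \<ge> 2"
  shows "p \<in> convex_forms n k \<longleftrightarrow>
    (\<forall>x\<in>carrier_vec n. \<forall>v\<in>carrier_vec n. polar_form k n p (replicate (k - 2) x @ replicate 2 v) \<ge> 0)"
proof -
  have T: "symmetric_linear k n (polar_form k n p)" by (rule polar_form_symmetric_linear[OF p])
  have "psd (hessian n (poly_value p) x) \<longleftrightarrow>
      (\<forall>v\<in>carrier_vec n. polar_form k n p (replicate (k - 2) x @ replicate 2 v) \<ge> 0)"
    if x: "x \<in> carrier_vec n" for x
  proof -
    let ?H = "hessian n (poly_value p) x"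
    have H: "?H \<in> carrier_mat n n" by (simp add: hessian_def)
    have "transpose_mat ?H = ?H"
    proof (rule eq_matI)
      fix i j assume "i < dim_row ?H" "j < dim_col ?H"
      then have ij: "i < n" "j < n" using H by auto
      have "polar_form k n p (replicate (k - 2) x @ [unit_vec n i, unit_vec n j]) =
          polar_form k n p (replicate (k - 2) x @ [unit_vec n j, unit_vec n i])"
        using x \<open>k \<ge> 2\<close> by (intro symmetric_linear_perm[OF T]) auto
      then have "?H $$ (i, j) = ?H $$ (j, i)" using hessian_poly_value[OF p x] ij by simp
      then show "transpose_mat ?H $$ (i, j) = ?H $$ (i, j)" using ij H by auto
    qed (use H in auto)
    moreover have "scalar_prod v (?H *\<^sub>v v) \<ge> 0 \<longleftrightarrow> polar_form k n p (replicate (k - 2) x @ replicate 2 v) \<ge> 0"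
      if "v \<in> carrier_vec n" for v
    proof -
      have cancel: "0 \<le> c * b \<longleftrightarrow> 0 \<le> b" if "c > 0" for b c :: real
        using that by (simp add: zero_le_mult_iff)
      have "real k * (real k - 1) > 0" using \<open>k \<ge> 2\<close> by simp
      then show ?thesis unfolding hessian_quadratic_form[OF p \<open>k \<ge> 2\<close> x that] by (rule cancel)
    qed
    ultimately show ?thesis using H unfolding psd_def by (simp add: carrier_matD)
  qed
  then show ?thesis using p by (simp add: convex_forms_def)
qed

lemma convex_seq_coeffs_along:
  assumes p: "p \<in> convex_forms n k" and "k \<ge> 2" and x: "x \<in> carrier_vec n" and y: "y \<in> carrier_vec n"
  shows "convex_seq k (coeffs_along k n p x y)"
  unfolding convex_seq_def
proof (intro allI)
  fix s t u v
  have p': "p \<in> forms n k" using p by (simp add: convex_forms_def)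
  have "polar_form k n p (replicate (k - 2) (s \<cdot>\<^sub>v x + t \<cdot>\<^sub>v y) @ replicate 2 (u \<cdot>\<^sub>v x + v \<cdot>\<^sub>v y)) =
      umbral (coeffs_along k n p x y) ([:s, t:] ^ (k - 2) * [:u, v:] ^ 2)"
    using symmetric_linear_umbral_power[OF polar_form_symmetric_linear[OF p'] x y, of "k - 2" 2] \<open>k \<ge> 2\<close>
    by (simp only: coeffs_along_def[abs_def])
  moreover have "polar_form k n p (replicate (k - 2) (s \<cdot>\<^sub>v x + t \<cdot>\<^sub>v y) @ replicate 2 (u \<cdot>\<^sub>v x + v \<cdot>\<^sub>v y)) \<ge> 0"
    using p x y unfolding convex_forms_iff[OF p' \<open>k \<ge> 2\<close>] by auto
  ultimately show "0 \<le> umbral (coeffs_along k n p x y) ([:s, t:] ^ (k - 2) * [:u, v:] ^ 2)" by simp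
qed

subsection \<open>Binary forms\<close>

definition binary_monomial :: "nat \<Rightarrow> nat \<Rightarrow> nat \<Rightarrow>\<^sub>0 nat" where
  "binary_monomial k j = Poly_Mapping.single 0 (k - j) + Poly_Mapping.single 1 j"

text \<open>The binomial factors make \<open>a j\<close> itself the j-th moment along the two basis
  vectors, so any prescribed sequence is realized by a form.\<close>

definition binary_form :: "nat \<Rightarrow> (nat \<Rightarrow> real) \<Rightarrow> rpoly" where
  "binary_form k a = (\<Sum>j\<le>k. Poly_Mapping.single (binary_monomial k j) (of_nat (k choose j) * a j))"

lemma lookup_binary_monomial:
  "Poly_Mapping.lookup (binary_monomial k j) i = (if i = 0 then k - j else if i = 1 then j else 0)"
  by (simp add: binary_monomial_def lookup_add lookup_single when_def)

lemma keys_binary_monomial: "Poly_Mapping.keys (binary_monomial k j) \<subseteq> {0, 1}"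
  by (auto simp: in_keys_iff lookup_binary_monomial split: if_splits)

lemma binary_monomial_inject: "binary_monomial k j = binary_monomial k j' \<longleftrightarrow> j = j'"
  by (metis lookup_binary_monomial zero_neq_one)

lemma lookup_binary_form:
  "Poly_Mapping.lookup (binary_form k a) m = (\<Sum>j\<le>k. if binary_monomial k j = m then of_nat (k choose j) * a j else 0)"
  unfolding binary_form_def lookup_sum by (simp add: lookup_single when_def)

lemma keys_binary_form: "Poly_Mapping.keys (binary_form k a) \<subseteq> binary_monomial k ` {..k}"
proof
  fix m assume "m \<in> Poly_Mapping.keys (binary_form k a)"
  then have "(\<Sum>j\<le>k. if binary_monomial k j = m then of_nat (k choose j) * a j else 0) \<noteq> 0"
    unfolding in_keys_iff lookup_binary_form .
  then have "\<exists>j\<in>{..k}. (if binary_monomial k j = m then of_nat (k choose j) * a j else 0) \<noteq> 0"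
    using sum.neutral[of "{..k}" "\<lambda>j. if binary_monomial k j = m then of_nat (k choose j) * a j else 0"] by blast
  then show "m \<in> binary_monomial k ` {..k}" by (auto split: if_splits)
qed

lemma binary_form_in_forms: "binary_form k a \<in> forms 2 k"
proof -
  have "(\<Sum>i\<in>Poly_Mapping.keys (binary_monomial k j). Poly_Mapping.lookup (binary_monomial k j) i) = k"
    if "j \<le> k" for j
  proof -
    have "(\<Sum>i\<in>Poly_Mapping.keys (binary_monomial k j). Poly_Mapping.lookup (binary_monomial k j) i) =
        (\<Sum>i\<in>{0, 1}. Poly_Mapping.lookup (binary_monomial k j) i)"
      using keys_binary_monomial by (intro sum.mono_neutral_left) (auto simp: in_keys_iff)
    then show ?thesis using that by (simp add: lookup_binary_monomial)
  qed
  moreover have "Poly_Mapping.keys (binary_monomial k j) \<subseteq> {..<2}" for j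
    using keys_binary_monomial[of k j] by (auto simp: numeral_2_eq_2)
  ultimately show ?thesis using keys_binary_form[of k a] unfolding forms_def by fastforce
qed

lemma poly_value_binary_form:
  "poly_value (binary_form k a) x = (\<Sum>j\<le>k. of_real (of_nat (k choose j) * a j) * ((x $ 0) ^ (k - j) * (x $ 1) ^ j))"
proof -
  let ?v = "\<lambda>m. \<Prod>i\<in>Poly_Mapping.keys m. (x $ i) ^ Poly_Mapping.lookup m i"
  have "poly_value (binary_form k a) x = (\<Sum>m\<in>binary_monomial k ` {..k}. of_real (Poly_Mapping.lookup (binary_form k a) m) * ?v m)"
    unfolding poly_value_def using keys_binary_form[of k a]
    by (intro sum.mono_neutral_left) (auto simp: in_keys_iff)
  also have "\<dots> = (\<Sum>j\<le>k. of_real (Poly_Mapping.lookup (binary_form k a) (binary_monomial k j)) * ?v (binary_monomial k j))"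
    by (subst sum.reindex) (auto simp: inj_on_def binary_monomial_inject)
  also have "\<dots> = (\<Sum>j\<le>k. of_real (of_nat (k choose j) * a j) * ((x $ 0) ^ (k - j) * (x $ 1) ^ j))"
  proof (rule sum.cong[OF refl])
    fix j assume "j \<in> {..k}"
    then have "Poly_Mapping.lookup (binary_form k a) (binary_monomial k j) = of_nat (k choose j) * a j"
      by (simp add: lookup_binary_form binary_monomial_inject)
    moreover have "?v (binary_monomial k j) = (\<Prod>i\<in>{0, 1}. (x $ i) ^ Poly_Mapping.lookup (binary_monomial k j) i)"
      using keys_binary_monomial by (intro prod.mono_neutral_left) (auto simp: in_keys_iff)
    ultimately show "of_real (Poly_Mapping.lookup (binary_form k a) (binary_monomial k j)) * ?v (binary_monomial k j) =
        of_real (of_nat (k choose j) * a j) * ((x $ 0) ^ (k - j) * (x $ 1) ^ j)"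
      by (simp add: lookup_binary_monomial)
  qed
  finally show ?thesis .
qed

lemma coeffs_along_binary_form:
  assumes "j \<le> k"
  shows "coeffs_along k 2 (binary_form k a) (unit_vec 2 0) (unit_vec 2 1) j = a j"
proof -
  let ?c = "coeffs_along k 2 (binary_form k a) (unit_vec 2 0) (unit_vec 2 1)"
  have "(\<Sum>l\<le>k. (of_nat (k choose l) * ?c l) * t ^ l) = (\<Sum>l\<le>k. (of_nat (k choose l) * a l) * t ^ l)" for t
  proof -
    have "(\<Sum>l\<le>k. (of_nat (k choose l) * ?c l) * t ^ l) = umbral ?c ([:1, t:] ^ k)"
      by (simp only: umbral_linear_power power_one mult_1_right mult_1_left mult_ac)
    also have "\<dots> = poly_value (binary_form k a) (1 \<cdot>\<^sub>v unit_vec 2 0 + t \<cdot>\<^sub>v unit_vec 2 1)"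
      by (subst poly_value_coeffs_along[OF binary_form_in_forms]) auto
    also have "\<dots> = (\<Sum>l\<le>k. (of_nat (k choose l) * a l) * t ^ l)"
      by (simp add: poly_value_binary_form)
    finally show ?thesis .
  qed
  then have "\<forall>l\<le>k. of_nat (k choose l) * ?c l = of_nat (k choose l) * a l"
    by (simp only: polyfun_eq_coeffs[symmetric]) simp
  then show ?thesis using assms by auto
qed

lemma binary_form_in_convex_forms:
  assumes a: "convex_seq k a" and "k \<ge> 2"
  shows "binary_form k a \<in> convex_forms 2 k"
  unfolding convex_forms_iff[OF binary_form_in_forms \<open>k \<ge> 2\<close>]
proof (intro ballI)
  let ?T = "polar_form k 2 (binary_form k a)"
  fix x v :: "real Matrix.vec" assume x: "x \<in> carrier_vec 2" and v: "v \<in> carrier_vec 2"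
  have decomp: "w = (w $ 0) \<cdot>\<^sub>v unit_vec 2 0 + (w $ 1) \<cdot>\<^sub>v unit_vec 2 1" if "w \<in> carrier_vec 2" for w :: "real Matrix.vec"
    using that by (intro eq_vecI) (auto simp: numeral_2_eq_2 less_Suc_eq)
  have "?T (replicate (k - 2) x @ replicate 2 v) =
     ?T (replicate (k - 2) ((x $ 0) \<cdot>\<^sub>v unit_vec 2 0 + (x $ 1) \<cdot>\<^sub>v unit_vec 2 1) @
         replicate 2 ((v $ 0) \<cdot>\<^sub>v unit_vec 2 0 + (v $ 1) \<cdot>\<^sub>v unit_vec 2 1))"
    using decomp[OF x] decomp[OF v] by simp
  also have "\<dots> = umbral (coeffs_along k 2 (binary_form k a) (unit_vec 2 0) (unit_vec 2 1))
      ([:x $ 0, x $ 1:] ^ (k - 2) * [:v $ 0, v $ 1:] ^ 2)"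
    using symmetric_linear_umbral_power[OF polar_form_symmetric_linear[OF binary_form_in_forms], of "unit_vec 2 0" "unit_vec 2 1" "k - 2" 2] \<open>k \<ge> 2\<close>
    by (simp only: coeffs_along_def[abs_def]) simp
  also have "\<dots> = umbral a ([:x $ 0, x $ 1:] ^ (k - 2) * [:v $ 0, v $ 1:] ^ 2)"
  proof (rule umbral_cong[where N = k])
    show "degree ([:x $ 0, x $ 1:] ^ (k - 2) * [:v $ 0, v $ 1:] ^ 2) \<le> k"
      using degree_mult_le[of "[:x $ 0, x $ 1:] ^ (k - 2)" "[:v $ 0, v $ 1:] ^ 2"]
        degree_linear_power_le[of "x $ 0" "x $ 1" "k - 2"] degree_linear_power_le[of "v $ 0" "v $ 1" 2] \<open>k \<ge> 2\<close>
      by linarith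
  qed (rule coeffs_along_binary_form)
  also have "\<dots> \<ge> 0" using a by (simp add: convex_seq_def)
  finally show "?T (replicate (k - 2) x @ replicate 2 v) \<ge> 0" .
qed

section \<open>Reduction of both constants to convex sequences\<close>

lemma A_star_convex_seq:
  assumes "d \<ge> 1"
  shows "A_star d = Inf {A. A \<ge> 0 \<and> (\<forall>a. convex_seq (2 * d) a \<longrightarrow> a d \<le> A * sqrt (a 0 * a (2 * d)))}"
proof -
  have "(\<forall>n>0. \<forall>p\<in>convex_forms n (2 * d). \<forall>x\<in>carrier_vec n. \<forall>y\<in>carrier_vec n.
        biform n d p x y \<le> A * sqrt (poly_value p x * poly_value p y)) \<longleftrightarrow>
      (\<forall>a. convex_seq (2 * d) a \<longrightarrow> a d \<le> A * sqrt (a 0 * a (2 * d)))" for A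
  proof (intro iffI allI impI ballI)
    fix a assume *: "\<forall>n>0. \<forall>p\<in>convex_forms n (2 * d). \<forall>x\<in>carrier_vec n. \<forall>y\<in>carrier_vec n.
        biform n d p x y \<le> A * sqrt (poly_value p x * poly_value p y)" and a: "convex_seq (2 * d) a"
    let ?p = "binary_form (2 * d) a"
    have p: "?p \<in> convex_forms 2 (2 * d)" using binary_form_in_convex_forms[OF a] assms by simp
    have "biform 2 d ?p (unit_vec 2 0) (unit_vec 2 1) \<le> A * sqrt (poly_value ?p (unit_vec 2 0) * poly_value ?p (unit_vec 2 1))"
      using * p by simp
    moreover have "biform 2 d ?p (unit_vec 2 0) (unit_vec 2 1) = a d"
      unfolding biform_coeffs_along by (rule coeffs_along_binary_form) simp
    moreover have "poly_value ?p (unit_vec 2 0) = a 0"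
      by (rule trans[OF poly_value_coeffs_along_0[OF binary_form_in_forms unit_vec_carrier, symmetric] coeffs_along_binary_form]) simp
    moreover have "poly_value ?p (unit_vec 2 1) = a (2 * d)"
      by (rule trans[OF poly_value_coeffs_along_last[OF binary_form_in_forms unit_vec_carrier, symmetric] coeffs_along_binary_form]) simp
    ultimately show "a d \<le> A * sqrt (a 0 * a (2 * d))" by (simp only:)
  next
    fix n p and x y :: "real Matrix.vec" assume *: "\<forall>a. convex_seq (2 * d) a \<longrightarrow> a d \<le> A * sqrt (a 0 * a (2 * d))"
      and p: "p \<in> convex_forms n (2 * d)" and x: "x \<in> carrier_vec n" and y: "y \<in> carrier_vec n"
    have p': "p \<in> forms n (2 * d)" using p by (simp add: convex_forms_def)
    have "convex_seq (2 * d) (coeffs_along (2 * d) n p x y)"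
      using convex_seq_coeffs_along[OF p _ x y] assms by simp
    with * show "biform n d p x y \<le> A * sqrt (poly_value p x * poly_value p y)"
      unfolding biform_coeffs_along poly_value_coeffs_along_0[OF p' x, symmetric, of y]
        poly_value_coeffs_along_last[OF p' y, symmetric, of x] by blast
  qed
  then show ?thesis unfolding A_star_def by simp
qed

lemma B_star_convex_seq:
  assumes "d \<ge> 1"
  shows "B_star d = Inf {B. B \<ge> 0 \<and> (\<forall>a. convex_seq (2 * d) a \<longrightarrow>
    cmod (umbral (\<lambda>l. complex_of_real (a l)) ([:1, \<i>:] ^ (2 * d))) \<le>
      B * Re (umbral (\<lambda>l. complex_of_real (a l)) ([:1, \<i>:] ^ d * [:1, - \<i>:] ^ d)))}"
proof -
  have deg: "degree ([:1, \<i>:] ^ (2 * d)) \<le> 2 * d" by (rule degree_linear_power_le)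
  have deg': "degree ([:1, \<i>:] ^ d * [:1, - \<i>:] ^ d) \<le> 2 * d"
    using degree_mult_le[of "[:1, \<i>:] ^ d" "[:1, - \<i>:] ^ d"] degree_linear_power_le[of 1 \<i> d]
      degree_linear_power_le[of 1 "- \<i>" d] by linarith
  have "(\<forall>n>0. \<forall>p\<in>convex_forms n (2 * d). \<forall>z::complex Matrix.vec\<in>carrier_vec n.
        cmod (poly_value p z) \<le> B * Re (complex_biform n d p z (conjugate z))) \<longleftrightarrow>
      (\<forall>a. convex_seq (2 * d) a \<longrightarrow>
    cmod (umbral (\<lambda>l. complex_of_real (a l)) ([:1, \<i>:] ^ (2 * d))) \<le>
      B * Re (umbral (\<lambda>l. complex_of_real (a l)) ([:1, \<i>:] ^ d * [:1, - \<i>:] ^ d)))" for B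
  proof (intro iffI allI impI ballI)
    fix a assume *: "\<forall>n>0. \<forall>p\<in>convex_forms n (2 * d). \<forall>z::complex Matrix.vec\<in>carrier_vec n.
        cmod (poly_value p z) \<le> B * Re (complex_biform n d p z (conjugate z))" and a: "convex_seq (2 * d) a"
    let ?p = "binary_form (2 * d) a"
    \<comment> \<open>The point (1, \<i>) has the two basis vectors as real and imaginary part, so
      the moments along them are the given sequence.\<close>
    let ?z = "Matrix.vec 2 (\<lambda>i. if i = 0 then 1 else \<i>)"
    have z: "?z \<in> carrier_vec 2" by simp
    have "map_vec Re ?z = unit_vec 2 0" "map_vec Im ?z = unit_vec 2 1" by (auto intro!: eq_vecI)
    then have re_im: "coeffs_along (2 * d) 2 ?p (map_vec Re ?z) (map_vec Im ?z) l = a l" if "l \<le> 2 * d" for l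
      using that coeffs_along_binary_form by simp
    have p: "?p \<in> convex_forms 2 (2 * d)" using binary_form_in_convex_forms[OF a] assms by simp
    have "cmod (poly_value ?p ?z) \<le> B * Re (complex_biform 2 d ?p ?z (conjugate ?z))"
      using * p z by (meson zero_less_numeral)
    moreover have "poly_value ?p ?z = umbral (\<lambda>l. complex_of_real (a l)) ([:1, \<i>:] ^ (2 * d))"
      unfolding complex_poly_value_coeffs_along[OF binary_form_in_forms z]
      by (rule umbral_cong[OF _ deg]) (simp only: re_im)
    moreover have "complex_biform 2 d ?p ?z (conjugate ?z) = umbral (\<lambda>l. complex_of_real (a l)) ([:1, \<i>:] ^ d * [:1, - \<i>:] ^ d)"
      unfolding complex_biform_coeffs_along[OF binary_form_in_forms z]
      by (rule umbral_cong[OF _ deg']) (simp only: re_im)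
    ultimately show "cmod (umbral (\<lambda>l. complex_of_real (a l)) ([:1, \<i>:] ^ (2 * d))) \<le>
      B * Re (umbral (\<lambda>l. complex_of_real (a l)) ([:1, \<i>:] ^ d * [:1, - \<i>:] ^ d))" by (simp only:)
  next
    fix n p and z :: "complex Matrix.vec"
    assume *: "\<forall>a. convex_seq (2 * d) a \<longrightarrow>
      cmod (umbral (\<lambda>l. complex_of_real (a l)) ([:1, \<i>:] ^ (2 * d))) \<le>
      B * Re (umbral (\<lambda>l. complex_of_real (a l)) ([:1, \<i>:] ^ d * [:1, - \<i>:] ^ d))"
      and p: "p \<in> convex_forms n (2 * d)" and z: "z \<in> carrier_vec n"
    have p': "p \<in> forms n (2 * d)" using p by (simp add: convex_forms_def)
    have "convex_seq (2 * d) (coeffs_along (2 * d) n p (map_vec Re z) (map_vec Im z))"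
      using convex_seq_coeffs_along[OF p] z assms by simp
    with * show "cmod (poly_value p z) \<le> B * Re (complex_biform n d p z (conjugate z))"
      unfolding complex_poly_value_coeffs_along[OF p' z] complex_biform_coeffs_along[OF p' z] by blast
  qed
  then show ?thesis unfolding B_star_def by simp
qed

section \<open>The constant \<open>B_star\<close>\<close>

text \<open>The counterpart of \<open>symmetric_linear_umbral\<close> on the side of polynomials,
  with P and M in place of the two vectors: products of their combinations are evaluated through the
  moments in the new basis.\<close>

lemma umbral_basis_change:
  fixes a :: "nat \<Rightarrow> 'a::comm_ring_1"
  assumes "length sts + i + j = k"
  shows "umbral a ((\<Prod>(s, t)\<leftarrow>sts. Polynomial.smult s P + Polynomial.smult t M) * P ^ i * M ^ j) =
    umbral (\<lambda>l. umbral a (P ^ (k - (j + l)) * M ^ (j + l))) (\<Prod>(s, t)\<leftarrow>sts. [:s, t:])"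
  using assms
proof (induction sts arbitrary: i j)
  case Nil
  then show ?case by auto
next
  case (Cons st sts)
  obtain s t where st: "st = (s, t)" by force
  let ?Q = "\<Prod>(s, t)\<leftarrow>sts. Polynomial.smult s P + Polynomial.smult t M"
  let ?R = "\<Prod>(s, t)\<leftarrow>sts. [:s, t:]"
  let ?f = "\<lambda>j l. umbral a (P ^ (k - (j + l)) * M ^ (j + l))"
  have "(\<Prod>(s, t)\<leftarrow>st # sts. Polynomial.smult s P + Polynomial.smult t M) * P ^ i * M ^ j =
     Polynomial.smult s (?Q * P ^ Suc i * M ^ j) + Polynomial.smult t (?Q * P ^ i * M ^ Suc j)"
    using st by (simp add: algebra_simps smult_add_right)
  then have "umbral a ((\<Prod>(s, t)\<leftarrow>st # sts. Polynomial.smult s P + Polynomial.smult t M) * P ^ i * M ^ j) =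
     s * umbral a (?Q * P ^ Suc i * M ^ j) + t * umbral a (?Q * P ^ i * M ^ Suc j)"
    by (simp only: umbral_add umbral_smult)
  also have "\<dots> = s * umbral (?f j) ?R + t * umbral (?f (Suc j)) ?R"
    using Cons.IH[of "Suc i" j] Cons.IH[of i "Suc j"] Cons.prems by simp
  also have "?f (Suc j) = (\<lambda>l. ?f j (Suc l))" by simp
  also have "s * umbral (?f j) ?R + t * umbral (\<lambda>l. ?f j (Suc l)) ?R = umbral (?f j) ([:s, t:] * ?R)"
    by (simp only: umbral_mult_linear umbral_seq_add umbral_seq_mult)
  finally show ?case using st by simp
qed

text \<open>The moments in the basis x + \<i> y, x - \<i> y of the complexified plane, which is
  isotropic when x and y are orthonormal. For k = 2d the entries 0 and d are p(z) and Q_p(z, cnj z),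
  so the inequality for \<open>B_star\<close> compares two entries.\<close>

definition isotropic_coeffs :: "nat \<Rightarrow> (nat \<Rightarrow> real) \<Rightarrow> nat \<Rightarrow> complex" where
  "isotropic_coeffs k a m = umbral (\<lambda>l. complex_of_real (a l)) ([:1, \<i>:] ^ (k - m) * [:1, - \<i>:] ^ m)"

text \<open>The combinations z (1 + \<i> X) + cnj z (1 - \<i> X) = 2 Re z - 2 Im z X are the real
  linear factors; this accounts for the factors 2 and the signs.\<close>

lemma umbral_isotropic_coeffs:
  assumes "k \<ge> 2"
  shows "complex_of_real (umbral a ([:2 * Re z, - 2 * Im z:] ^ (k - 2) * [:2 * Re h, - 2 * Im h:] ^ 2)) =
    umbral (isotropic_coeffs k a) ([:z, cnj z:] ^ (k - 2) * [:h, cnj h:] ^ 2)"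
proof -
  let ?a = "\<lambda>l. complex_of_real (a l)"
  have lin: "Polynomial.smult w [:1, \<i>:] + Polynomial.smult (cnj w) [:1, - \<i>:] = [:complex_of_real (2 * Re w), complex_of_real (- 2 * Im w):]" for w
    by (simp add: complex_eq_iff)
  have "complex_of_real (umbral a ([:2 * Re z, - 2 * Im z:] ^ (k - 2) * [:2 * Re h, - 2 * Im h:] ^ 2)) =
     umbral ?a ([:complex_of_real (2 * Re z), complex_of_real (- 2 * Im z):] ^ (k - 2) *
        [:complex_of_real (2 * Re h), complex_of_real (- 2 * Im h):] ^ 2)"
    by (simp only: umbral_hessian of_real_sum of_real_mult of_real_add of_real_power of_real_of_nat_eq of_real_numeral)
  also have "\<dots> = umbral (isotropic_coeffs k a) ([:z, cnj z:] ^ (k - 2) * [:h, cnj h:] ^ 2)"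
    using umbral_basis_change[of "replicate (k - 2) (z, cnj z) @ replicate 2 (h, cnj h)" 0 0 k ?a "[:1, \<i>:]" "[:1, - \<i>:]"] assms
    by (simp only: map_append map_replicate prod_list.append prod_list_replicate case_prod_conv lin
        isotropic_coeffs_def[abs_def] power_0 mult_1_right add_0 length_append length_replicate)
  finally show ?thesis .
qed

lemma isotropic_coeffs_last: "isotropic_coeffs k a k = cnj (isotropic_coeffs k a 0)"
  by (simp add: isotropic_coeffs_def umbral_linear_power)

lemma coeff_mult_square:
  fixes q :: "'a::comm_ring_1 poly"
  shows "coeff (q * [:u, v:] ^ 2) 0 = u\<^sup>2 * coeff q 0"
    and "coeff (q * [:u, v:] ^ 2) 1 = u\<^sup>2 * coeff q 1 + 2 * u * v * coeff q 0"
    and "coeff (q * [:u, v:] ^ 2) (Suc (Suc l)) =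
      u\<^sup>2 * coeff q (Suc (Suc l)) + 2 * u * v * coeff q (Suc l) + v\<^sup>2 * coeff q l"
proof -
  have lin: "coeff ([:u, v:] * p) 0 = u * coeff p 0"
    "coeff ([:u, v:] * p) (Suc l) = u * coeff p (Suc l) + v * coeff p l" for p l
    by simp_all
  have "q * [:u, v:] ^ 2 = [:u, v:] * ([:u, v:] * q)" by (simp only: power2_eq_square mult_ac)
  then show "coeff (q * [:u, v:] ^ 2) 0 = u\<^sup>2 * coeff q 0"
    and "coeff (q * [:u, v:] ^ 2) 1 = u\<^sup>2 * coeff q 1 + 2 * u * v * coeff q 0"
    and "coeff (q * [:u, v:] ^ 2) (Suc (Suc l)) =
      u\<^sup>2 * coeff q (Suc (Suc l)) + 2 * u * v * coeff q (Suc l) + v\<^sup>2 * coeff q l"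
    by (simp_all only: lin One_nat_def) (simp_all add: power2_eq_square algebra_simps)
qed

lemma binomial_central_neighbour:
  "d * ((2 * (d - 1)) choose d) = (d - 1) * ((2 * (d - 1)) choose (d - 1))"
proof (cases d)
  case (Suc n)
  have "Suc n * ((2 * n) choose Suc n) = 2 * n * ((2 * n - 1) choose n)" by (rule binomial_absorption)
  also have "\<dots> = (2 * n - n) * ((2 * n) choose n)" by (rule binomial_absorb_comp[symmetric])
  finally have "Suc n * ((2 * n) choose Suc n) = n * ((2 * n) choose n)" by simp
  then show ?thesis using Suc by simp
qed simp

text \<open>Only the outer and the middle moments survive in the argument for \<open>B_star\<close>,
  so these coefficients suffice. \<open>B\<close> is the claimed value: for d > 1 the three
  binomials that enter the middle coefficient are (d - 1) B, d B and (d - 1) B, by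
  \<open>binomial_central_neighbour\<close> and symmetry.\<close>

lemma coeff_hessian_symbol:
  fixes z w h g :: complex
  assumes "d \<ge> 1"
  defines "q \<equiv> [:z, w:] ^ (2 * d - 2) * [:h, g:] ^ 2"
    and "B \<equiv> complex_of_nat ((2 * (d - 1)) choose (d - 1)) / of_nat d"
  shows "coeff q 0 = z ^ (2 * d - 2) * h\<^sup>2"
    and "coeff q (2 * d) = w ^ (2 * d - 2) * g\<^sup>2"
    and "coeff q d = (if d = 1 then 2 * h * g else
      B * ((of_nat d - 1) * (z * w) ^ (d - 2) * ((w * h)\<^sup>2 + (z * g)\<^sup>2) + 2 * of_nat d * (z * w) ^ (d - 1) * (h * g)))"
proof -
  show "coeff q 0 = z ^ (2 * d - 2) * h\<^sup>2"
    unfolding q_def coeff_mult_square(1) by (simp add: coeff_linear_power)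
  have "2 * d = Suc (Suc (2 * d - 2))" using assms(1) by simp
  then show "coeff q (2 * d) = w ^ (2 * d - 2) * g\<^sup>2"
    unfolding q_def by (metis (no_types, lifting) coeff_mult_square(3) coeff_linear_power[of z w]
        binomial_n_n diff_self_eq_0 lessI less_imp_le not_less_eq_eq mult.commute mult_zero_right add_0 of_nat_1 mult_1 power_0 le_refl mult.right_neutral Suc_n_not_le_n)
  show "coeff q d = (if d = 1 then 2 * h * g else
      B * ((of_nat d - 1) * (z * w) ^ (d - 2) * ((w * h)\<^sup>2 + (z * g)\<^sup>2) + 2 * of_nat d * (z * w) ^ (d - 1) * (h * g)))"
  proof (cases "d = 1")
    case True
    then show ?thesis unfolding q_def using coeff_mult_square(2)[of "1 :: complex poly" h g] by simp
  next
    case False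
    then obtain n where n: "d = Suc (Suc n)" using assms(1) by (metis One_nat_def not0_implies_Suc not_one_le_zero)
    have m: "2 * d - 2 = 2 * n + 2" "2 * (d - 1) = 2 * n + 2" "d - 1 = Suc n" "d - 2 = n" using n by auto
    have c: "complex_of_nat ((2 * n + 2) choose Suc n) = of_nat d * B"
      using assms(1) unfolding B_def m(2,3) by simp
    have "of_nat d * complex_of_nat ((2 * n + 2) choose d) = of_nat (d - 1) * complex_of_nat ((2 * n + 2) choose Suc n)"
      using binomial_central_neighbour[of d] m by (metis of_nat_mult)
    then have c1: "complex_of_nat ((2 * n + 2) choose d) = of_nat (d - 1) * B"
      using assms(1) unfolding c by simp
    have c2: "complex_of_nat ((2 * n + 2) choose n) = of_nat (d - 1) * B"
      using c1 binomial_symmetric[of n "2 * n + 2"] n by simp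
    let ?r = "[:z, w:] ^ (2 * n + 2)"
    have e: "2 * n + 2 - d = n" "2 * n + 2 - Suc n = Suc n" "2 * n + 2 - n = d"
      "d \<le> 2 * n + 2" "Suc n \<le> 2 * n + 2" "n \<le> 2 * n + 2" using n by auto
    have "coeff ?r d = of_nat ((2 * n + 2) choose d) * z ^ n * w ^ d"
      "coeff ?r (Suc n) = of_nat ((2 * n + 2) choose Suc n) * z ^ Suc n * w ^ Suc n"
      "coeff ?r n = of_nat ((2 * n + 2) choose n) * z ^ d * w ^ n"
      by (simp_all only: coeff_linear_power e if_True)
    moreover have "coeff q d = h\<^sup>2 * coeff ?r d + 2 * h * g * coeff ?r (Suc n) + g\<^sup>2 * coeff ?r n"
      unfolding q_def m(1) using coeff_mult_square(3)[of ?r h g n] n by (simp only:)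
    ultimately have "coeff q d = h\<^sup>2 * (of_nat ((2 * n + 2) choose d) * z ^ n * w ^ d) +
        2 * h * g * (of_nat ((2 * n + 2) choose Suc n) * z ^ Suc n * w ^ Suc n) + g\<^sup>2 * (of_nat ((2 * n + 2) choose n) * z ^ d * w ^ n)"
      by (simp only:)
    also have "\<dots> = B * (of_nat (d - 1) * (z * w) ^ n * ((w * h)\<^sup>2 + (z * g)\<^sup>2) + 2 * of_nat d * (z * w) ^ Suc n * (h * g))"
      unfolding c c1 c2 by (simp add: n power_mult_distrib algebra_simps power2_eq_square)
    finally have fin: "coeff q d = B * (of_nat (d - 1) * (z * w) ^ n * ((w * h)\<^sup>2 + (z * g)\<^sup>2) +
        2 * of_nat d * (z * w) ^ Suc n * (h * g))" .
    have pred: "of_nat d - 1 = complex_of_nat (Suc n)" using n by simp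
    show ?thesis unfolding if_not_P[OF False] m(3,4) pred using fin unfolding m(3) .
  qed
qed

lemma sum_cis_multiples:
  assumes "d \<ge> 1"
  shows "(\<Sum>k<d. cis (2 * pi * real l / real d) ^ k) = (if d dvd l then of_nat d else 0)"
proof -
  let ?x = "cis (2 * pi * real l / real d)"
  have one_iff: "?x = 1 \<longleftrightarrow> d dvd l"
  proof
    assume "?x = 1"
    then have "exp (\<i> * complex_of_real (2 * pi * real l / real d)) = 1" by (simp add: cis_conv_exp)
    then obtain n :: int where "2 * pi * real l / real d = real_of_int (2 * n) * pi"
      unfolding exp_eq_1 by auto
    then have "real l = real_of_int n * real d" using assms by (simp add: field_simps)
    then have "int l = n * int d" by (metis of_int_eq_iff of_int_mult of_int_of_nat_eq)
    then have "int d dvd int l" by simp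
    then show "d dvd l" by simp
  next
    assume "d dvd l"
    then obtain n where "l = d * n" by blast
    then have "2 * pi * real l / real d = 2 * pi * of_int (int n)" using assms by simp
    then show "?x = 1" using cis_multiple_2pi[of "of_int (int n)"] by simp
  qed
  have "?x ^ d = cis (2 * pi * of_int (int l))" using assms by (simp add: Complex.DeMoivre mult.commute)
  also have "\<dots> = 1" by (rule cis_multiple_2pi) simp
  finally have xd: "?x ^ d = 1" .
  show ?thesis
  proof (cases "?x = 1")
    case True
    then show ?thesis using one_iff by simp
  next
    case False
    then show ?thesis using one_iff xd geometric_sum[OF False, of d] by simp
  qed
qed

text \<open>Only the even multiple 2d - 2l of the angle \<pi> k / d occurs, so the summands are
  powers of a d-th root of unity. Hence d points on a half circle suffice, and the sum detects the
  multiples of d.\<close>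

lemma sum_cis_powers:
  assumes "d \<ge> 1" "l \<le> 2 * d"
  shows "(\<Sum>k<d. cis (pi * real k / real d) ^ (2 * d - l) * cnj (cis (pi * real k / real d)) ^ l) =
    (if l \<in> {0, d, 2 * d} then of_nat d else 0)"
proof -
  have "cis (pi * real k / real d) ^ (2 * d - l) * cnj (cis (pi * real k / real d)) ^ l =
      cnj (cis (2 * pi * real l / real d) ^ k)" for k
  proof -
    have "cis (pi * real k / real d) ^ (2 * d - l) * cnj (cis (pi * real k / real d)) ^ l =
       cis (real (2 * d - l) * (pi * real k / real d) + real l * (- (pi * real k / real d)))"
      by (simp only: cis_cnj Complex.DeMoivre cis_mult)
    also have "real (2 * d - l) * (pi * real k / real d) + real l * (- (pi * real k / real d)) =
       2 * pi * of_int (int k) + - (real k * (2 * pi * real l / real d))"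
      using assms by (simp add: of_nat_diff field_simps)
    also have "cis \<dots> = cis (- (real k * (2 * pi * real l / real d)))"
      unfolding cis_mult[symmetric] using cis_multiple_2pi[of "of_int (int k)"] by simp
    finally show ?thesis by (simp only: Complex.DeMoivre cis_cnj complex_cnj_power)
  qed
  then have "(\<Sum>k<d. cis (pi * real k / real d) ^ (2 * d - l) * cnj (cis (pi * real k / real d)) ^ l) =
     cnj (\<Sum>k<d. cis (2 * pi * real l / real d) ^ k)" by (simp only: cnj_sum)
  also have "\<dots> = (if d dvd l then of_nat d else 0)" unfolding sum_cis_multiples[OF assms(1)] by simp
  also have "d dvd l \<longleftrightarrow> l \<in> {0, d, 2 * d}"
  proof
    assume "d dvd l"
    then obtain n where n: "l = d * n" by blast
    then have "n \<le> 2" using assms by simp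
    then have "n = 0 \<or> n = 1 \<or> n = 2" by auto
    then show "l \<in> {0, d, 2 * d}" using n by auto
  qed auto
  finally show ?thesis .
qed

lemma umbral_three_terms:
  fixes f :: "nat \<Rightarrow> 'a::comm_ring_1"
  assumes "degree q \<le> 2 * d" "d \<ge> 1" "\<And>l. l \<le> 2 * d \<Longrightarrow> l \<notin> {0, d, 2 * d} \<Longrightarrow> f l = 0"
  shows "umbral f q = f 0 * coeff q 0 + f d * coeff q d + f (2 * d) * coeff q (2 * d)"
proof -
  have "umbral f q = (\<Sum>l\<le>2 * d. f l * coeff q l)" by (rule umbral_altdef[OF assms(1)])
  also have "\<dots> = (\<Sum>l\<in>{0, d, 2 * d}. f l * coeff q l)"
    using assms(3) by (intro sum.mono_neutral_right) auto
  finally show ?thesis using assms(2) by (simp add: algebra_simps)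
qed

lemma degree_hessian_symbol:
  fixes s t u v :: "'a::comm_ring_1"
  assumes "d \<ge> 1"
  shows "degree ([:s, t:] ^ (2 * d - 2) * [:u, v:] ^ 2) \<le> 2 * d"
  using degree_mult_le[of "[:s, t:] ^ (2 * d - 2)" "[:u, v:] ^ 2"]
    degree_linear_power_le[of s t "2 * d - 2"] degree_linear_power_le[of u v 2] assms
  by linarith

text \<open>The tangential second derivatives at the \<open>d\<close> points \<open>z \<omega>\<^sup>k\<close>, \<open>\<omega> = exp (\<pi> \<i> / d)\<close>, of the unit
  circle are summed; all isotropic coefficients other than the extreme and the middle ones cancel.\<close>

lemma isotropic_coeffs_extreme_bound:
  assumes a: "convex_seq (2 * d) a" and d: "d \<ge> 1"
  shows "cmod (isotropic_coeffs (2 * d) a 0) \<le>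
    real ((2 * (d - 1)) choose (d - 1)) / real d * Re (isotropic_coeffs (2 * d) a d)"
proof -
  let ?e = "isotropic_coeffs (2 * d) a"
  let ?q = "[:1, 1:] ^ (2 * d - 2) * [:\<i>, - \<i>:] ^ 2"
  define B where "B = real ((2 * (d - 1)) choose (d - 1)) / real d"
  \<comment> \<open>This rotation makes the extreme coefficient real and nonnegative: z^(2d) times
    it is its modulus.\<close>
  define z where "z = cis (- Arg (?e 0) / (2 * d))"
  define w where "w k = z * cis (pi * real k / real d)" for k
  have wu: "w k * cnj (w k) = 1" for k by (simp add: w_def z_def cis_cnj cis_mult)
  have pos: "Re (umbral ?e ([:w k, cnj (w k):] ^ (2 * d - 2) * [:\<i> * w k, cnj (\<i> * w k):] ^ 2)) \<ge> 0" for k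
    using umbral_isotropic_coeffs[of "2 * d" a "w k" "\<i> * w k"] d a unfolding convex_seq_def
    by (metis Re_complex_of_real mult_2 nat_mult_le_cancel1 mult.right_neutral mult_le_mono2)
  have rotate: "umbral ?e ([:w k, cnj (w k):] ^ (2 * d - 2) * [:\<i> * w k, cnj (\<i> * w k):] ^ 2) =
      umbral (\<lambda>l. (w k ^ (2 * d - l) * cnj (w k) ^ l) * ?e l) ?q" for k
    unfolding umbral_hessian
  proof (rule sum.cong[OF refl])
    fix j assume "j \<in> {..2 * d - 2}"
    then obtain i where i: "2 * d = i + j + 2" using d by (metis (no_types, lifting) atMost_iff le_add_diff_inverse2 add.commute mult_2 add_le_mono add.assoc one_add_one)
    then have s: "2 * d - 2 - j = i" "2 * d - j = Suc (Suc i)" "2 * d - Suc j = Suc i" "2 * d - Suc (Suc j) = i" by auto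
    show "of_nat (2 * d - 2 choose j) * w k ^ (2 * d - 2 - j) * cnj (w k) ^ j *
         ((\<i> * w k)\<^sup>2 * ?e j + 2 * (\<i> * w k) * cnj (\<i> * w k) * ?e (Suc j) + (cnj (\<i> * w k))\<^sup>2 * ?e (Suc (Suc j))) =
         of_nat (2 * d - 2 choose j) * 1 ^ (2 * d - 2 - j) * 1 ^ j *
         (\<i>\<^sup>2 * (w k ^ (2 * d - j) * cnj (w k) ^ j * ?e j) + 2 * \<i> * - \<i> * (w k ^ (2 * d - Suc j) * cnj (w k) ^ Suc j * ?e (Suc j)) +
          (- \<i>)\<^sup>2 * (w k ^ (2 * d - Suc (Suc j)) * cnj (w k) ^ Suc (Suc j) * ?e (Suc (Suc j))))"
      unfolding s by (simp add: power2_eq_square algebra_simps)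
  qed
  have filter: "(\<Sum>k<d. w k ^ (2 * d - l) * cnj (w k) ^ l) =
      z ^ (2 * d - l) * cnj z ^ l * (if l \<in> {0, d, 2 * d} then of_nat d else 0)" if "l \<le> 2 * d" for l
    unfolding sum_cis_powers[OF d that, symmetric] sum_distrib_left
    by (simp add: w_def power_mult_distrib mult_ac)
  have "0 \<le> Re (\<Sum>k<d. umbral ?e ([:w k, cnj (w k):] ^ (2 * d - 2) * [:\<i> * w k, cnj (\<i> * w k):] ^ 2))"
    unfolding Re_sum using pos by (intro sum_nonneg) auto
  also have "(\<Sum>k<d. umbral ?e ([:w k, cnj (w k):] ^ (2 * d - 2) * [:\<i> * w k, cnj (\<i> * w k):] ^ 2)) =
     umbral (\<lambda>l. (\<Sum>k<d. w k ^ (2 * d - l) * cnj (w k) ^ l) * ?e l) ?q"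
    unfolding rotate umbral_seq_sum[symmetric] sum_distrib_right ..
  also have "\<dots> = of_nat d * (z ^ (2 * d) * ?e 0 * (- 1) + ?e d * (2 * of_real B) + cnj z ^ (2 * d) * ?e (2 * d) * (- 1))"
  proof -
    \<comment> \<open>With h = \<i> and g = - \<i> the middle coefficient is B (- 2 (d - 1) + 2 d) =
      2 B. The dependence on d cancels and leaves the claimed constant.\<close>
    have c: "coeff ?q 0 = - 1" "coeff ?q (2 * d) = - 1" "coeff ?q d = 2 * of_real B"
      using coeff_hessian_symbol[OF d, of 1 1 \<i> "- \<i>"] by (simp_all add: B_def field_simps)
    have "umbral (\<lambda>l. (\<Sum>k<d. w k ^ (2 * d - l) * cnj (w k) ^ l) * ?e l) ?q =
      (\<Sum>k<d. w k ^ (2 * d - 0) * cnj (w k) ^ 0) * ?e 0 * (- 1) + (\<Sum>k<d. w k ^ (2 * d - d) * cnj (w k) ^ d) * ?e d * (2 * of_real B)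
        + (\<Sum>k<d. w k ^ (2 * d - 2 * d) * cnj (w k) ^ (2 * d)) * ?e (2 * d) * (- 1)"
      by (subst umbral_three_terms[OF degree_hessian_symbol[OF d] d]) (simp_all only: c filter, simp)
    also have "(\<Sum>k<d. w k ^ (2 * d - 0) * cnj (w k) ^ 0) = of_nat d * z ^ (2 * d)" by (subst filter) auto
    also have "(\<Sum>k<d. w k ^ (2 * d - d) * cnj (w k) ^ d) = of_nat d"
    proof -
      have "w k ^ (2 * d - d) * cnj (w k) ^ d = 1" for k
        using wu[of k] by (simp flip: power_mult_distrib)
      then show ?thesis by simp
    qed
    also have "(\<Sum>k<d. w k ^ (2 * d - 2 * d) * cnj (w k) ^ (2 * d)) = of_nat d * cnj z ^ (2 * d)" by (subst filter) auto
    finally show ?thesis by (simp add: algebra_simps)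
  qed
  also have "?e (2 * d) = cnj (?e 0)" by (rule isotropic_coeffs_last)
  also have "cnj z ^ (2 * d) * cnj (?e 0) = cnj (z ^ (2 * d) * ?e 0)" by simp
  also have "z ^ (2 * d) * ?e 0 = cmod (?e 0)"
  proof -
    have "z ^ (2 * d) = cis (- Arg (?e 0))" using d by (simp add: z_def Complex.DeMoivre)
    moreover have "?e 0 = rcis (cmod (?e 0)) (Arg (?e 0))" by (simp add: rcis_cmod_Arg)
    then have "?e 0 = of_real (cmod (?e 0)) * cis (Arg (?e 0))" by (simp add: rcis_def)
    ultimately have "z ^ (2 * d) * ?e 0 = of_real (cmod (?e 0)) * (cis (- Arg (?e 0)) * cis (Arg (?e 0)))"
      by (metis mult.assoc mult.commute)
    then show ?thesis by (simp add: cis_mult)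
  qed
  finally have "0 \<le> real d * (2 * (B * Re (?e d) - cmod (?e 0)))" by (simp add: algebra_simps)
  then have "cmod (?e 0) \<le> B * Re (?e d)" using d by (simp add: zero_le_mult_iff)
  then show ?thesis by (simp add: B_def)
qed

text \<open>The coefficients of a multiple of \<open>(2d - 1) (x\<^sup>2 + y\<^sup>2)\<^sup>d + Re (x + \<i> y)\<^bsup>2d\<^esup>\<close>, where the first
  summand is replaced by a mean of \<open>2d\<close>-th powers of linear forms plus a multiple of the second one.\<close>

definition extremal_seq :: "nat \<Rightarrow> nat \<Rightarrow> real" where
  "extremal_seq d j = (\<Sum>k<d. cos (pi * real k / real d) ^ (2 * d - j) * sin (pi * real k / real d) ^ j) / real d
     + (real ((2 * (d - 1)) choose (d - 1)) / real d - 1) / 2 ^ (2 * d - 1) * Re (\<i> ^ j)"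

text \<open>The mean of the powers contributes 1 at the positions 0, d and 2d. The term with
  \<open>Re (\<i> ^ j)\<close> is half the sum of the rank-one sequences of (1, \<i>) and (1, -
  \<i>), each of which is seen at one end only, with value 2^(2d). The division by 2^(2d-1)
  therefore turns the end values from 1 into the Catalan number.\<close>

lemma isotropic_coeffs_extremal_seq:
  assumes d: "d \<ge> 1" and m: "m \<le> 2 * d"
  shows "isotropic_coeffs (2 * d) (extremal_seq d) m =
    (if m = 0 \<or> m = 2 * d then of_nat ((2 * (d - 1)) choose (d - 1)) / of_nat d else if m = d then 1 else 0)"
proof -
  let ?B = "complex_of_nat ((2 * (d - 1)) choose (d - 1)) / of_nat d"
  let ?q = "[:1, \<i>:] ^ (2 * d - m) * [:1, - \<i>:] ^ m"
  let ?c = "\<lambda>k. cos (pi * real k / real d)" and ?s = "\<lambda>k. sin (pi * real k / real d)"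
  have rank_one: "umbral (\<lambda>j. x ^ (2 * d - j) * y ^ j) ?q = (x + \<i> * y) ^ (2 * d - m) * (x - \<i> * y) ^ m" for x y
    using umbral_rank_one[of "replicate (2 * d - m) (1, \<i>) @ replicate m (1, - \<i>)" "\<lambda>j. x ^ (2 * d - j) * y ^ j" x y] m
    by (simp add: prod_list_replicate)
  have "complex_of_real (extremal_seq d j) =
      (1 / of_nat d) * (\<Sum>k<d. complex_of_real (?c k) ^ (2 * d - j) * complex_of_real (?s k) ^ j) +
      (?B - 1) / 2 ^ (2 * d) * (1 ^ (2 * d - j) * \<i> ^ j + 1 ^ (2 * d - j) * (- \<i>) ^ j)" for j
  proof -
    have "\<i> ^ j + cnj (\<i> ^ j) = complex_of_real (2 * Re (\<i> ^ j))" by (rule complex_add_cnj)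
    then have re: "complex_of_real (Re (\<i> ^ j)) = (\<i> ^ j + (- \<i>) ^ j) / 2" by simp
    have "2 * d = Suc (2 * d - 1)" using d by simp
    then have pw: "(2::complex) ^ (2 * d) = 2 * 2 ^ (2 * d - 1)" by (metis power_Suc)
    have "complex_of_real (extremal_seq d j) =
        (\<Sum>k<d. complex_of_real (?c k) ^ (2 * d - j) * complex_of_real (?s k) ^ j) / of_nat d +
        (?B - 1) / 2 ^ (2 * d - 1) * complex_of_real (Re (\<i> ^ j))"
      by (simp add: extremal_seq_def)
    also have "\<dots> = (1 / of_nat d) * (\<Sum>k<d. complex_of_real (?c k) ^ (2 * d - j) * complex_of_real (?s k) ^ j) +
      (?B - 1) / (2 * 2 ^ (2 * d - 1)) * (1 ^ (2 * d - j) * \<i> ^ j + 1 ^ (2 * d - j) * (- \<i>) ^ j)"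
      unfolding re by (simp add: mult.commute)
    finally show ?thesis unfolding pw .
  qed
  then have "isotropic_coeffs (2 * d) (extremal_seq d) m = umbral (\<lambda>j.
      (1 / of_nat d) * (\<Sum>k<d. complex_of_real (?c k) ^ (2 * d - j) * complex_of_real (?s k) ^ j) +
      (?B - 1) / 2 ^ (2 * d) * (1 ^ (2 * d - j) * \<i> ^ j + 1 ^ (2 * d - j) * (- \<i>) ^ j)) ?q"
    by (simp only: isotropic_coeffs_def)
  also have "\<dots> = (1 / of_nat d) * (\<Sum>k<d. (of_real (?c k) + \<i> * of_real (?s k)) ^ (2 * d - m) * (of_real (?c k) - \<i> * of_real (?s k)) ^ m) +
     (?B - 1) / 2 ^ (2 * d) * ((1 + \<i> * \<i>) ^ (2 * d - m) * (1 - \<i> * \<i>) ^ m + (1 + \<i> * - \<i>) ^ (2 * d - m) * (1 - \<i> * - \<i>) ^ m)"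
    unfolding umbral_seq_add umbral_seq_mult umbral_seq_sum rank_one ..
  also have "(\<Sum>k<d. (of_real (?c k) + \<i> * of_real (?s k)) ^ (2 * d - m) * (of_real (?c k) - \<i> * of_real (?s k)) ^ m) =
      (\<Sum>k<d. cis (pi * real k / real d) ^ (2 * d - m) * cnj (cis (pi * real k / real d)) ^ m)"
  proof (rule sum.cong[OF refl])
    fix k
    have "of_real (?c k) + \<i> * of_real (?s k) = cis (pi * real k / real d)"
      "of_real (?c k) - \<i> * of_real (?s k) = cnj (cis (pi * real k / real d))"
      by (simp_all add: complex_eq_iff)
    then show "(of_real (?c k) + \<i> * of_real (?s k)) ^ (2 * d - m) * (of_real (?c k) - \<i> * of_real (?s k)) ^ m =
      cis (pi * real k / real d) ^ (2 * d - m) * cnj (cis (pi * real k / real d)) ^ m" by (simp only:)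
  qed
  also have "(\<Sum>k<d. cis (pi * real k / real d) ^ (2 * d - m) * cnj (cis (pi * real k / real d)) ^ m) =
      (if m \<in> {0, d, 2 * d} then of_nat d else 0)" by (rule sum_cis_powers[OF d m])
  finally show ?thesis using d m by (auto simp: power_0_left)
qed

text \<open>The estimates balance exactly. Of the 2 d copies of B |z|^(2d-2) |h|^2 in the middle
  term, the real part of (cnj z h)^2 costs at most 2 (d - 1), and the two outer terms cost at most
  the remaining 2.\<close>

lemma convex_extremal_seq:
  assumes d: "d \<ge> 1"
  shows "convex_seq (2 * d) (extremal_seq d)"
  unfolding convex_seq_def
proof (intro allI)
  fix s t u v :: real
  let ?e = "isotropic_coeffs (2 * d) (extremal_seq d)"
  define B where "B = real ((2 * (d - 1)) choose (d - 1)) / real d"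
  \<comment> \<open>These choices undo the factors of \<open>umbral_isotropic_coeffs\<close>: 2 Re z
    = s and - 2 Im z = t, likewise for h.\<close>
  define z h where "z = Complex (s / 2) (- t / 2)" and "h = Complex (u / 2) (- v / 2)"
  let ?q = "[:z, cnj z:] ^ (2 * d - 2) * [:h, cnj h:] ^ 2"
  have B: "B \<ge> 0" by (simp add: B_def)
  have e: "?e 0 = B" "?e (2 * d) = B" "?e d = 1" "\<And>l. l \<le> 2 * d \<Longrightarrow> l \<notin> {0, d, 2 * d} \<Longrightarrow> ?e l = 0"
    using isotropic_coeffs_extremal_seq[OF d] d by (auto simp: B_def)
  have "complex_of_real (umbral (extremal_seq d) ([:s, t:] ^ (2 * d - 2) * [:u, v:] ^ 2)) = umbral ?e ?q"
    using umbral_isotropic_coeffs[of "2 * d" "extremal_seq d" z h] d by (simp add: z_def h_def)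
  also have "\<dots> = B * coeff ?q 0 + coeff ?q d + B * coeff ?q (2 * d)"
    using umbral_three_terms[OF degree_hessian_symbol[OF d] d, of ?e z "cnj z" h "cnj h"] e by simp
  finally have "umbral (extremal_seq d) ([:s, t:] ^ (2 * d - 2) * [:u, v:] ^ 2) =
      Re (B * coeff ?q 0 + coeff ?q d + B * coeff ?q (2 * d))"
    by (metis Re_complex_of_real)
  also have "\<dots> = 2 * B * Re (z ^ (2 * d - 2) * h\<^sup>2) + Re (coeff ?q d)"
  proof -
    define W where "W = z ^ (2 * d - 2) * h\<^sup>2"
    have "coeff ?q (2 * d) = cnj W" "coeff ?q 0 = W"
      unfolding coeff_hessian_symbol(1,2)[OF d] by (simp_all add: W_def)
    then show ?thesis unfolding W_def[symmetric] by simp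
  qed
  also have "\<dots> \<ge> 0"
  proof -
    have "Re (z ^ (2 * d - 2) * h\<^sup>2) \<ge> - cmod (z ^ (2 * d - 2) * h\<^sup>2)"
      using abs_Re_le_cmod[of "z ^ (2 * d - 2) * h\<^sup>2"] by linarith
    then have first: "Re (z ^ (2 * d - 2) * h\<^sup>2) \<ge> - (cmod z ^ (2 * d - 2) * (cmod h)\<^sup>2)"
      by (simp add: norm_mult norm_power)
    show ?thesis
    proof (cases "d = 1")
      case True
      then have "coeff ?q d = 2 * (h * cnj h)" using coeff_hessian_symbol(3)[OF d, of z "cnj z" h "cnj h"] by simp
      then have "Re (coeff ?q d) = 2 * (cmod h)\<^sup>2" by (simp add: complex_mult_cnj cmod_power2)
      then show ?thesis using first True by (simp add: B_def)
    next
      case False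
      have zz: "z * cnj z = complex_of_real ((cmod z)\<^sup>2)" and hh: "h * cnj h = complex_of_real ((cmod h)\<^sup>2)"
        by (simp_all add: complex_norm_square[symmetric] complex_mult_cnj cmod_power2)
      have sq: "(cnj z * h)\<^sup>2 + (z * cnj h)\<^sup>2 = complex_of_real (2 * Re ((cnj z * h)\<^sup>2))"
        using complex_add_cnj[of "(cnj z * h)\<^sup>2"] by simp
      have "coeff ?q d = of_real (B * ((real d - 1) * ((cmod z)\<^sup>2) ^ (d - 2) * (2 * Re ((cnj z * h)\<^sup>2))
          + 2 * real d * ((cmod z)\<^sup>2) ^ (d - 1) * (cmod h)\<^sup>2))"
        using coeff_hessian_symbol(3)[OF d, of z "cnj z" h "cnj h"] False unfolding zz hh sq by (simp add: B_def)
      then have mid: "Re (coeff ?q d) = B * ((real d - 1) * ((cmod z)\<^sup>2) ^ (d - 2) * (2 * Re ((cnj z * h)\<^sup>2))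
          + 2 * real d * ((cmod z)\<^sup>2) ^ (d - 1) * (cmod h)\<^sup>2)" by simp
      have "Re ((cnj z * h)\<^sup>2) \<ge> - cmod ((cnj z * h)\<^sup>2)"
        using abs_Re_le_cmod[of "(cnj z * h)\<^sup>2"] by linarith
      then have "Re ((cnj z * h)\<^sup>2) \<ge> - ((cmod z)\<^sup>2 * (cmod h)\<^sup>2)" by (simp add: norm_mult norm_power power_mult_distrib)
      moreover have "(real d - 1) * ((cmod z)\<^sup>2) ^ (d - 2) * 2 \<ge> 0" using d by simp
      ultimately have "(real d - 1) * ((cmod z)\<^sup>2) ^ (d - 2) * 2 * Re ((cnj z * h)\<^sup>2) \<ge>
          (real d - 1) * ((cmod z)\<^sup>2) ^ (d - 2) * 2 * - ((cmod z)\<^sup>2 * (cmod h)\<^sup>2)" by (intro mult_left_mono)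
      moreover have pw: "((cmod z)\<^sup>2) ^ (d - 1) = ((cmod z)\<^sup>2) ^ (d - 2) * (cmod z)\<^sup>2" "cmod z ^ (2 * d - 2) = ((cmod z)\<^sup>2) ^ (d - 1)"
      proof -
        have "d - 1 = Suc (d - 2)" using False d by simp
        then show "((cmod z)\<^sup>2) ^ (d - 1) = ((cmod z)\<^sup>2) ^ (d - 2) * (cmod z)\<^sup>2" by (metis power_Suc2)
        show "cmod z ^ (2 * d - 2) = ((cmod z)\<^sup>2) ^ (d - 1)" by (simp add: power_mult[symmetric] right_diff_distrib')
      qed
      ultimately have "(real d - 1) * ((cmod z)\<^sup>2) ^ (d - 2) * (2 * Re ((cnj z * h)\<^sup>2))
          + 2 * real d * ((cmod z)\<^sup>2) ^ (d - 1) * (cmod h)\<^sup>2 \<ge> 2 * ((cmod z)\<^sup>2) ^ (d - 1) * (cmod h)\<^sup>2"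
        by (simp add: algebra_simps)
      then have "Re (coeff ?q d) \<ge> B * (2 * ((cmod z)\<^sup>2) ^ (d - 1) * (cmod h)\<^sup>2)"
        unfolding mid using B by (rule mult_left_mono)
      moreover have "2 * B * Re (z ^ (2 * d - 2) * h\<^sup>2) \<ge> 2 * B * - (((cmod z)\<^sup>2) ^ (d - 1) * (cmod h)\<^sup>2)"
        using first B unfolding pw(2) by (intro mult_left_mono) auto
      ultimately show ?thesis by (simp add: algebra_simps)
    qed
  qed
  finally show "0 \<le> umbral (extremal_seq d) ([:s, t:] ^ (2 * d - 2) * [:u, v:] ^ 2)" .
qed

theorem Inf_B_convex_seq:
  assumes d: "d \<ge> 1"
  shows "Inf {B. B \<ge> 0 \<and> (\<forall>a. convex_seq (2 * d) a \<longrightarrow>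
    cmod (umbral (\<lambda>l. complex_of_real (a l)) ([:1, \<i>:] ^ (2 * d))) \<le>
      B * Re (umbral (\<lambda>l. complex_of_real (a l)) ([:1, \<i>:] ^ d * [:1, - \<i>:] ^ d)))} =
    real ((2 * (d - 1)) choose (d - 1)) / real d" (is "Inf ?S = ?B")
proof -
  have e: "umbral (\<lambda>l. complex_of_real (a l)) ([:1, \<i>:] ^ (2 * d)) = isotropic_coeffs (2 * d) a 0"
    "umbral (\<lambda>l. complex_of_real (a l)) ([:1, \<i>:] ^ d * [:1, - \<i>:] ^ d) = isotropic_coeffs (2 * d) a d" for a
    by (simp_all add: isotropic_coeffs_def mult_2)
  show ?thesis unfolding e
  proof (rule cInf_eq_minimum)
    show "?B \<in> {B. B \<ge> 0 \<and> (\<forall>a. convex_seq (2 * d) a \<longrightarrow>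
      cmod (isotropic_coeffs (2 * d) a 0) \<le> B * Re (isotropic_coeffs (2 * d) a d))}"
      using isotropic_coeffs_extreme_bound[OF _ d] by simp
    fix B assume "B \<in> {B. B \<ge> 0 \<and> (\<forall>a. convex_seq (2 * d) a \<longrightarrow>
      cmod (isotropic_coeffs (2 * d) a 0) \<le> B * Re (isotropic_coeffs (2 * d) a d))}"
    then have "cmod (isotropic_coeffs (2 * d) (extremal_seq d) 0) \<le> B * Re (isotropic_coeffs (2 * d) (extremal_seq d) d)"
      using convex_extremal_seq[OF d] by blast
    then show "?B \<le> B" using isotropic_coeffs_extremal_seq[OF d] d by (simp add: norm_divide)
  qed
qed

section \<open>Positive semidefinite polynomial matrices in one variable\<close>

lemma poly_nonneg_at_limit:
  fixes p :: "real poly"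
  assumes "\<And>t. t \<noteq> t0 \<Longrightarrow> poly p t \<ge> 0"
  shows "poly p t0 \<ge> 0"
proof (rule tendsto_lowerbound[where F = "at t0"])
  show "(poly p \<longlongrightarrow> poly p t0) (at t0)" using poly_isCont[of t0 p] by (simp add: isCont_def)
  show "\<forall>\<^sub>F t in at t0. 0 \<le> poly p t" using assms by (simp add: eventually_at_filter)
qed simp

text \<open>A root of a nonnegative polynomial is a minimum, so the derivative vanishes there as
  well.\<close>

lemma poly_nonneg_double_root:
  fixes p :: "real poly"
  assumes nonneg: "\<And>t. poly p t \<ge> 0" and root: "poly p t0 = 0"
  obtains q where "p = [:- t0, 1:]\<^sup>2 * q" "\<And>t. poly q t \<ge> 0"
proof -
  obtain r where r: "p = [:- t0, 1:] * r" using root poly_eq_0_iff_dvd[of p t0] unfolding dvd_def by blast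
  have "DERIV (poly p) t0 :> poly (pderiv p) t0" by (rule poly_DERIV)
  then have "poly (pderiv p) t0 = 0"
    by (rule DERIV_local_min[where d = 1]) (use nonneg root in auto)
  moreover have "poly (pderiv p) t0 = poly r t0"
    unfolding r by (subst pderiv_mult) (simp add: pderiv_pCons)
  ultimately have "poly r t0 = 0" by simp
  then obtain q where q: "r = [:- t0, 1:] * q" using poly_eq_0_iff_dvd[of r t0] unfolding dvd_def by blast
  have p: "p = [:- t0, 1:]\<^sup>2 * q" using r q by (simp only: power2_eq_square mult.assoc)
  have "poly q t \<ge> 0" if "t \<noteq> t0" for t
  proof -
    have "poly p t = (t - t0)\<^sup>2 * poly q t" by (simp add: p power2_eq_square algebra_simps)
    with nonneg[of t] that show ?thesis by (simp add: zero_le_mult_iff)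
  qed
  then have "poly q t \<ge> 0" for t
    using poly_nonneg_at_limit[of t0 q] by (cases "t = t0") auto
  with p that show ?thesis by blast
qed

lemma poly_nonneg_eventually_dominates:
  fixes p q :: "real poly"
  assumes nonneg: "\<And>t. poly p t \<ge> 0" and deg: "degree q < degree p"
  obtains R where "\<And>t. t \<ge> R \<Longrightarrow> poly q t < poly p t"
proof -
  have "lead_coeff p > 0"
  proof (rule ccontr)
    assume "\<not> ?thesis"
    then have "lead_coeff (- p) > 0" using deg
      by (auto simp: not_less order.order_iff_strict)
    from poly_pinfty_gt_lc[OF this] obtain n where "poly (- p) n \<ge> lead_coeff (- p)" by blast
    with \<open>lead_coeff (- p) > 0\<close> nonneg[of n] show False by simp
  qed
  moreover have "degree (p - q) = degree p"
    using deg degree_add_eq_left[of "- q" p] by simp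
  ultimately have lc: "lead_coeff (p - q) > 0" using deg by (simp add: coeff_eq_0)
  from poly_pinfty_gt_lc[OF this] obtain n where "\<And>t. t \<ge> n \<Longrightarrow> poly (p - q) t \<ge> lead_coeff (p - q)"
    by blast
  with lc that[of n] show ?thesis by (force intro: that[of n])
qed

text \<open>Subtracting l q, where l is the minimum of p / q, produces a real root without losing
  nonnegativity. The degree inductions below need such a root in order to split off a
  square.\<close>

lemma poly_quotient_attains_min:
  fixes p q :: "real poly"
  assumes nonneg: "\<And>t. poly p t \<ge> 0" and pos: "\<And>t. poly q t > 0"
    and deg: "degree q < degree p"
  obtains l t0 where "l \<ge> 0" "\<And>t. poly (p - Polynomial.smult l q) t \<ge> 0" "poly (p - Polynomial.smult l q) t0 = 0"
proof -
  \<comment> \<open>The value of p / q at 0 is the level to beat: outside [-R, R] the quotient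
    exceeds it, so the minimum over that interval is global.\<close>
  define c where "c = poly p 0 / poly q 0"
  let ?q = "Polynomial.smult c q"
  have degq: "degree ?q < degree p"
    using deg degree_smult_le[of c q] by simp
  obtain R1 where R1: "\<And>t. t \<ge> R1 \<Longrightarrow> poly ?q t < poly p t"
    using poly_nonneg_eventually_dominates[OF nonneg degq] by blast
  have "\<And>t. poly (pcompose p [:0, -1:]) t \<ge> 0" using nonneg by (simp add: poly_pcompose)
  moreover have "degree (pcompose ?q [:0, -1:]) < degree (pcompose p [:0, -1:])"
    using degq by (simp only: degree_pcompose) simp
  ultimately obtain R2 where R2: "\<And>t. t \<ge> R2 \<Longrightarrow> poly (pcompose ?q [:0, -1:]) t < poly (pcompose p [:0, -1:]) t"
    using poly_nonneg_eventually_dominates by blast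
  define R where "R = max 0 (max R1 R2)"
  have "continuous_on {-R..R} (\<lambda>t. poly p t / poly q t)"
    using pos by (intro continuous_intros) (metis less_irrefl)
  then obtain t0 where t0: "t0 \<in> {-R..R}" "\<And>t. t \<in> {-R..R} \<Longrightarrow> poly p t0 / poly q t0 \<le> poly p t / poly q t"
    using continuous_attains_inf[of "{-R..R}" "\<lambda>t. poly p t / poly q t"] by (auto simp: R_def)
  define l where "l = poly p t0 / poly q t0"
  have le: "l \<le> poly p t / poly q t" for t
  proof (cases "t \<in> {-R..R}")
    case True
    then show ?thesis using t0 by (simp add: l_def)
  next
    case False
    then have "t \<ge> R1 \<or> - t \<ge> R2" by (auto simp: R_def)
    then have "poly ?q t < poly p t" using R1[of t] R2[of "- t"] by (auto simp: poly_pcompose)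
    then have "c \<le> poly p t / poly q t" using pos[of t] by (simp add: field_simps)
    moreover have "l \<le> c" using t0(2)[of 0] by (simp add: l_def c_def R_def)
    ultimately show ?thesis by simp
  qed
  have "poly (p - Polynomial.smult l q) t \<ge> 0" for t
    using pos[of t] le[of t] by (simp add: pos_le_divide_eq)
  moreover have "poly (p - Polynomial.smult l q) t0 = 0" using pos[of t0] by (simp add: l_def)
  moreover have "l \<ge> 0" using nonneg[of t0] pos[of t0] by (simp add: l_def)
  ultimately show ?thesis using that by blast
qed

lemma poly_nonneg_sum_squares:
  fixes p :: "real poly"
  assumes "\<And>t. poly p t \<ge> 0"
  shows "\<exists>fs. p = (\<Sum>f\<leftarrow>fs. f * f)"
  using assms
proof (induction "degree p" arbitrary: p rule: less_induct)
  case less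
  show ?case
  proof (cases "degree p = 0")
    case True
    then obtain c where c: "p = [:c:]" by (rule degree_eq_zeroE)
    have "p = (\<Sum>f\<leftarrow>[[:sqrt c:]]. f * f)" using less.prems[of 0] by (simp add: c)
    then show ?thesis by blast
  next
    case False
    obtain l t0 where l: "l \<ge> 0" "\<And>t. poly (p - Polynomial.smult l 1) t \<ge> 0" "poly (p - Polynomial.smult l 1) t0 = 0"
      using poly_quotient_attains_min[of p 1] less.prems False by auto
    obtain q where q: "p - Polynomial.smult l 1 = [:- t0, 1:]\<^sup>2 * q" "\<And>t. poly q t \<ge> 0"
      using poly_nonneg_double_root[OF l(2,3)] by blast
    have deg: "degree (p - [:l:]) = degree p"
    proof -
      have "p - [:l:] = p + [:- l:]" by simp
      then show ?thesis using False degree_add_eq_left[of "[:- l:]" p] by (simp only:) simp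
    qed
    then have "q \<noteq> 0" using q(1) False by auto
    then have "degree (p - [:l:]) = 2 + degree q"
      using q(1) by (simp add: degree_mult_eq degree_power_eq)
    with deg less.hyps[of q] q(2) obtain fs where fs: "q = (\<Sum>f\<leftarrow>fs. f * f)" by auto
    have "p = [:l:] + [:- t0, 1:]\<^sup>2 * q" using q(1) by (simp add: algebra_simps)
    also have "\<dots> = (\<Sum>f\<leftarrow>[:sqrt l:] # map (\<lambda>f. [:- t0, 1:] * f) fs. f * f)"
    proof -
      have "[:- t0, 1:]\<^sup>2 * (\<Sum>f\<leftarrow>fs. f * f) = (\<Sum>f\<leftarrow>fs. ([:- t0, 1:] * f) * ([:- t0, 1:] * f))"
        unfolding sum_list_const_mult[symmetric] by (simp only: power2_eq_square mult_ac)
      then show ?thesis using l(1) by (simp add: fs o_def del: mult_pCons_left mult_pCons_right) simp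
    qed
    finally show ?thesis by blast
  qed
qed

section \<open>Two by two matrices of univariate polynomials\<close>

definition sos2 :: "real poly \<Rightarrow> real poly \<Rightarrow> real poly \<Rightarrow> bool" where
  "sos2 a b c \<longleftrightarrow> (\<exists>fs. a = (\<Sum>(f, g)\<leftarrow>fs. f * f) \<and> b = (\<Sum>(f, g)\<leftarrow>fs. f * g) \<and> c = (\<Sum>(f, g)\<leftarrow>fs. g * g))"

definition psd2 :: "real poly \<Rightarrow> real poly \<Rightarrow> real poly \<Rightarrow> bool" where
  "psd2 a b c \<longleftrightarrow> (\<forall>t. poly a t \<ge> 0 \<and> poly c t \<ge> 0 \<and> poly (a * c - b\<^sup>2) t \<ge> 0)"

lemma sos2_add:
  assumes "sos2 a b c" "sos2 a' b' c'"
  shows "sos2 (a + a') (b + b') (c + c')"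
proof -
  obtain fs gs where "a = (\<Sum>(f, g)\<leftarrow>fs. f * f)" "b = (\<Sum>(f, g)\<leftarrow>fs. f * g)" "c = (\<Sum>(f, g)\<leftarrow>fs. g * g)"
    "a' = (\<Sum>(f, g)\<leftarrow>gs. f * f)" "b' = (\<Sum>(f, g)\<leftarrow>gs. f * g)" "c' = (\<Sum>(f, g)\<leftarrow>gs. g * g)"
    using assms unfolding sos2_def by blast
  then show ?thesis unfolding sos2_def by (intro exI[of _ "fs @ gs"]) simp
qed

text \<open>Congruence of the matrix with rows (a, b) and (b, c) by the polynomial matrix with rows
  (p, q) and (r, s); it acts on each vector (f, g) of the decomposition.\<close>

lemma sos2_transform:
  assumes "sos2 a b c"
  shows "sos2 (p * p * a + 2 * p * q * b + q * q * c) (p * r * a + (p * s + q * r) * b + q * s * c)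
    (r * r * a + 2 * r * s * b + s * s * c)"
proof -
  obtain fs where fs: "a = (\<Sum>(f, g)\<leftarrow>fs. f * f)" "b = (\<Sum>(f, g)\<leftarrow>fs. f * g)" "c = (\<Sum>(f, g)\<leftarrow>fs. g * g)"
    using assms unfolding sos2_def by blast
  let ?fs = "map (\<lambda>(f, g). (p * f + q * g, r * f + s * g)) fs"
  have "p * p * a + 2 * p * q * b + q * q * c = (\<Sum>(f, g)\<leftarrow>?fs. f * f)"
    "p * r * a + (p * s + q * r) * b + q * s * c = (\<Sum>(f, g)\<leftarrow>?fs. f * g)"
    "r * r * a + 2 * r * s * b + s * s * c = (\<Sum>(f, g)\<leftarrow>?fs. g * g)"
    unfolding fs by (induction fs) (auto simp: algebra_simps)
  then show ?thesis unfolding sos2_def by blast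
qed

lemma sos2_swap: "sos2 c b a \<Longrightarrow> sos2 a b c"
  using sos2_transform[of c b a 0 1 1 0] by simp

lemma sos2_first:
  assumes "\<And>t. poly a t \<ge> 0"
  shows "sos2 a 0 0"
proof -
  obtain fs where "a = (\<Sum>f\<leftarrow>fs. f * f)" using poly_nonneg_sum_squares[OF assms] by blast
  then show ?thesis unfolding sos2_def
    by (intro exI[of _ "map (\<lambda>f. (f, 0)) fs"]) (simp add: o_def)
qed

lemma sos2_diagonal:
  assumes "\<And>t. poly a t \<ge> 0" "\<And>t. poly c t \<ge> 0"
  shows "sos2 a 0 c"
  using sos2_add[OF sos2_first sos2_swap[OF sos2_first], of a c] assms by simp

lemma psd2_swap: "psd2 a b c \<Longrightarrow> psd2 c b a"
  unfolding psd2_def by (simp add: mult.commute)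

lemma psd2_quadratic_nonneg:
  assumes "psd2 a b c"
  shows "poly a t * x\<^sup>2 + 2 * poly b t * x + poly c t \<ge> 0"
proof (cases "poly a t = 0")
  case True
  have "poly (a * c - b\<^sup>2) t \<ge> 0" "poly c t \<ge> 0" using assms by (auto simp: psd2_def)
  with True show ?thesis by simp
next
  case False
  have *: "poly a t > 0" "poly a t * poly c t \<ge> (poly b t)\<^sup>2"
    using assms False unfolding psd2_def by (auto simp: order.order_iff_strict)
  have "poly a t * (poly a t * x\<^sup>2 + 2 * poly b t * x + poly c t) =
      (poly a t * x + poly b t)\<^sup>2 + (poly a t * poly c t - (poly b t)\<^sup>2)"
    by (simp add: algebra_simps power2_eq_square)
  also have "\<dots> \<ge> 0" using * by simp
  finally show ?thesis using *(1) by (simp add: zero_le_mult_iff)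
qed

text \<open>A unipotent congruence, subtracting q times the first basis vector from the second; the
  determinant is unchanged.\<close>

lemma psd2_shift:
  assumes "psd2 a b c"
  shows "psd2 a (b - q * a) (c - 2 * q * b + q * q * a)"
proof -
  have "a * (c - 2 * q * b + q * q * a) - (b - q * a)\<^sup>2 = a * c - b\<^sup>2"
    by (simp add: algebra_simps power2_eq_square)
  moreover have "poly (c - 2 * q * b + q * q * a) t \<ge> 0" for t
    using psd2_quadratic_nonneg[OF assms, of t "- poly q t"] by (simp add: algebra_simps power2_eq_square)
  ultimately show ?thesis using assms by (simp add: psd2_def)
qed

lemma sos2_unshift:
  assumes "sos2 a (b - q * a) (c - 2 * q * b + q * q * a)"
  shows "sos2 a b c"
  using sos2_transform[OF assms, of 1 0 q 1] by (simp add: algebra_simps)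

text \<open>At a zero of a the determinant is - b^2, so b vanishes too, while a vanishes doubly. The
  matrix therefore arises, by the diagonal congruence with entries t - t0 and 1, from one whose
  determinant has lost the factor (t - t0)^2.\<close>

lemma sos2_det_root_aligned:
  assumes psd: "psd2 a b c" and root: "poly a t0 = 0" and det: "a * c - b\<^sup>2 \<noteq> 0"
    and smaller: "\<And>a' b' c'. psd2 a' b' c' \<Longrightarrow>
      degree (a' * c' - b'\<^sup>2) < degree (a * c - b\<^sup>2) \<Longrightarrow> sos2 a' b' c'"
  shows "sos2 a b c"
proof -
  obtain a' where a': "a = [:- t0, 1:]\<^sup>2 * a'" "\<And>t. poly a' t \<ge> 0"
    using poly_nonneg_double_root[of a t0] psd root by (auto simp: psd2_def)
  have "poly (a * c - b\<^sup>2) t0 \<ge> 0" using psd by (simp add: psd2_def)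
  then have "poly b t0 = 0" using root by simp
  then obtain b' where b': "b = [:- t0, 1:] * b'" using poly_eq_0_iff_dvd[of b t0] unfolding dvd_def by blast
  have D: "a * c - b\<^sup>2 = [:- t0, 1:]\<^sup>2 * (a' * c - b'\<^sup>2)"
    unfolding a' b' by (simp only: power_mult_distrib right_diff_distrib mult.assoc)
  have "poly (a' * c - b'\<^sup>2) t \<ge> 0" if "t \<noteq> t0" for t
  proof -
    have "poly (a * c - b\<^sup>2) t = (t - t0)\<^sup>2 * poly (a' * c - b'\<^sup>2) t" unfolding D by (simp add: power2_eq_square algebra_simps)
    moreover have "poly (a * c - b\<^sup>2) t \<ge> 0" using psd by (simp add: psd2_def)
    ultimately show ?thesis using that by (simp add: zero_le_mult_iff)
  qed
  then have "poly (a' * c - b'\<^sup>2) t \<ge> 0" for t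
    using poly_nonneg_at_limit[of t0 "a' * c - b'\<^sup>2"] by (cases "t = t0") blast+
  then have "psd2 a' b' c"
    using a'(2) psd unfolding psd2_def by blast
  moreover have "a' * c - b'\<^sup>2 \<noteq> 0" using det D by auto
  then have "degree (a * c - b\<^sup>2) = 2 + degree (a' * c - b'\<^sup>2)"
    unfolding D by (simp add: degree_mult_eq degree_power_eq)
  ultimately have "sos2 a' b' c" using smaller by simp
  from sos2_transform[OF this, of "[:- t0, 1:]" 0 0 1] show ?thesis
    by (simp only: a'(1) b' power2_eq_square mult_zero_left mult_zero_right add_0_left add_0_right mult_1_right mult_1_left mult_1)
qed

text \<open>A constant shift turns the kernel of the matrix at t0 into a coordinate direction: with
  q = b(t0) / a(t0) the new lower right entry at t0 is the determinant divided by a(t0), which is 0.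
  After a swap the aligned case applies.\<close>

lemma sos2_det_root:
  assumes psd: "psd2 a b c" and root: "poly (a * c - b\<^sup>2) t0 = 0" and det: "a * c - b\<^sup>2 \<noteq> 0"
    and smaller: "\<And>a' b' c'. psd2 a' b' c' \<Longrightarrow>
      degree (a' * c' - b'\<^sup>2) < degree (a * c - b\<^sup>2) \<Longrightarrow> sos2 a' b' c'"
  shows "sos2 a b c"
proof (cases "poly a t0 = 0")
  case True
  then show ?thesis using sos2_det_root_aligned assms by blast
next
  case False
  define q where "q = [:poly b t0 / poly a t0:]"
  define c' where "c' = c - 2 * q * b + q * q * a"
  define b' where "b' = b - q * a"
  have psd': "psd2 a b' c'" unfolding b'_def c'_def by (rule psd2_shift[OF psd])
  have D: "c' * a - b'\<^sup>2 = a * c - b\<^sup>2"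
    by (simp add: b'_def c'_def algebra_simps power2_eq_square)
  have "poly c' t0 = poly (a * c - b\<^sup>2) t0 / poly a t0"
    using False by (simp add: c'_def q_def field_simps power2_eq_square)
  then have root': "poly c' t0 = 0" using root by (simp only: div_0)
  have "sos2 c' b' a"
  proof (rule sos2_det_root_aligned[OF psd2_swap[OF psd'] root'])
    show "c' * a - b'\<^sup>2 \<noteq> 0" unfolding D by (rule det)
  qed (unfold D, rule smaller)
  then have "sos2 a b' c'" by (rule sos2_swap)
  then show ?thesis unfolding b'_def c'_def by (rule sos2_unshift)
qed

text \<open>Lexicographic induction on the degrees of the determinant and of \<open>a\<close>. A shift reduces \<open>b\<close> modulo
  \<open>a\<close>, and afterwards \<open>a\<close> and \<open>c\<close> are swapped if this lowers the degree of \<open>a\<close>. Otherwise the determinant has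
  larger degree than \<open>a\<close>, so that \<open>c\<close> can be lowered by a constant until the determinant acquires a
  real root, whose square is then split off.\<close>

theorem psd2_imp_sos2:
  assumes "psd2 a b c"
  shows "sos2 a b c"
proof -
  \<comment> \<open>A vanishing determinant has to rank below a nonzero constant one, although both
    have degree 0; hence the \<open>Suc\<close>.\<close>
  define deg_det where "deg_det = (\<lambda>(a, b, c). if a * c - b\<^sup>2 = 0 then 0 else Suc (degree (a * c - b\<^sup>2 :: real poly)))"
  define deg_a where "deg_a = (\<lambda>(a, b :: real poly, c :: real poly). degree (a :: real poly))"
  have "case x of (a, b, c) \<Rightarrow> psd2 a b c \<longrightarrow> sos2 a b c" for x
  proof (induction x rule: wf_induct_rule[OF wf_measures[of "[deg_det, deg_a]"]])
    case (1 x)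
    obtain a b c where x: "x = (a, b, c)" by (cases x)
    have IH: "sos2 a' b' c'" if "psd2 a' b' c'"
      "deg_det (a', b', c') < deg_det (a, b, c) \<or> deg_det (a', b', c') = deg_det (a, b, c) \<and> degree a' < degree a"
      for a' b' c'
      using 1[of "(a', b', c')"] that by (auto simp: x deg_a_def)
    have "sos2 a b c" if psd: "psd2 a b c"
    proof (cases "a = 0")
      case True
      have "poly b t = 0" for t
      proof -
        have "poly (a * c - b\<^sup>2) t \<ge> 0" using psd by (simp add: psd2_def)
        then show ?thesis using True by simp
      qed
      then have "b = 0" using poly_all_0_iff_0 by blast
      then show ?thesis using True sos2_diagonal[of a c] psd by (simp add: psd2_def)
    next
      case False
      define q r c' where "q = b div a" and "r = b - q * a" and "c' = c - 2 * q * b + q * q * a"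
      have r: "r = b mod a" by (simp add: r_def q_def minus_div_mult_eq_mod)
      have psd': "psd2 a r c'" unfolding r_def c'_def by (rule psd2_shift[OF psd])
      have D: "a * c' - r\<^sup>2 = a * c - b\<^sup>2"
        by (simp add: r_def c'_def algebra_simps power2_eq_square)
      have "sos2 a r c'"
      proof (cases "r = 0")
        case True
        then show ?thesis using psd' sos2_diagonal[of a c'] by (simp add: psd2_def)
      next
        case False': False
        have deg_r: "degree r < degree a"
          using degree_mod_less[OF \<open>a \<noteq> 0\<close>, of b] False' r by simp
        show ?thesis
        proof (cases "degree c' < degree a")
          case True
          have "deg_det (c', r, a) = deg_det (a, b, c)"
            using D by (simp add: deg_det_def mult.commute)
          then have "sos2 c' r a" using True psd2_swap[OF psd'] by (intro IH) auto
          then show ?thesis by (rule sos2_swap)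
        next
          case deg_c': False
          then have "c' \<noteq> 0" using deg_r by auto
          then have "degree (a * c') = degree a + degree c'"
            using False by (simp add: degree_mult_eq)
          moreover have "degree (- (r\<^sup>2)) = 2 * degree r"
            using False' by (simp add: degree_power_eq)
          \<comment> \<open>Here deg r < deg a \<le> deg c', so r^2 does not reach the leading term
            of a c'. Since deg c' > 0, the determinant has larger degree than a, as the minimization
            of its quotient by a requires.\<close>
          ultimately have deg_D: "degree (a * c' - r\<^sup>2) = degree a + degree c'"
            using deg_r deg_c' degree_add_eq_left[of "- (r\<^sup>2)" "a * c'"] by simp
          then have D0: "a * c' - r\<^sup>2 \<noteq> 0" using deg_r by auto
          have small: "sos2 a' b' c''" if "psd2 a' b' c''" "a' * c'' - b'\<^sup>2 = 0 \<or>
              degree (a' * c'' - b'\<^sup>2) < degree (a * c' - r\<^sup>2)" for a' b' c''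
            using that D0 D by (intro IH) (auto simp: deg_det_def)
          show ?thesis
          proof (cases "\<exists>t0. poly (a * c' - r\<^sup>2) t0 = 0")
            case True
            then show ?thesis using sos2_det_root[OF psd' _ D0] small by blast
          next
            case False
            have Dpos: "poly (a * c' - r\<^sup>2) t > 0" for t
              using psd' False by (auto simp: psd2_def order.order_iff_strict)
            have apos: "poly a t > 0" for t
            proof -
              have "poly a t \<ge> 0" using psd' by (simp add: psd2_def)
              moreover have "poly a t \<noteq> 0" using Dpos[of t] by (auto simp: not_less)
              ultimately show ?thesis by simp
            qed
            have "degree a < degree (a * c' - r\<^sup>2)" using deg_D deg_c' deg_r by simp
            from poly_quotient_attains_min[OF less_imp_le[OF Dpos] apos this]
            obtain l t0 where l: "l \<ge> 0" "\<And>t. poly (a * c' - r\<^sup>2 - Polynomial.smult l a) t \<ge> 0"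
              "poly (a * c' - r\<^sup>2 - Polynomial.smult l a) t0 = 0" by blast
            define c'' where "c'' = c' - [:l:]"
            have D'': "a * c'' - r\<^sup>2 = a * c' - r\<^sup>2 - Polynomial.smult l a"
              by (simp add: c''_def algebra_simps)
            have deg_D'': "degree (a * c'' - r\<^sup>2) \<le> degree (a * c' - r\<^sup>2)"
              unfolding D'' using deg_D degree_smult_le[of l a] degree_diff_le_max[of "a * c' - r\<^sup>2" "Polynomial.smult l a"] by simp
            have "poly c'' t \<ge> 0" for t
            proof -
              have "poly a t * poly c'' t \<ge> (poly r t)\<^sup>2" using l(2)[of t] unfolding D''[symmetric] by simp
              then have "poly a t * poly c'' t \<ge> 0" by (meson order_trans zero_le_power2)
              with apos[of t] show ?thesis by (simp add: zero_le_mult_iff)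
            qed
            with l(2) apos have psd'': "psd2 a r c''" unfolding psd2_def D''[symmetric] by (auto intro: less_imp_le)
            have "sos2 a r c''"
            proof (cases "a * c'' - r\<^sup>2 = 0")
              case True
              then show ?thesis using small psd'' by blast
            next
              case D0'': False
              have root: "poly (a * c'' - r\<^sup>2) t0 = 0" unfolding D'' by (rule l(3))
              show ?thesis
              proof (rule sos2_det_root[OF psd'' root D0''])
                fix a' b' c3
                assume "psd2 a' b' c3" "degree (a' * c3 - b'\<^sup>2) < degree (a * c'' - r\<^sup>2)"
                then show "sos2 a' b' c3" by (intro small disjI2 less_le_trans[OF _ deg_D''])
              qed
            qed
            moreover have "sos2 0 0 [:l:]" using sos2_swap[OF sos2_first, of "[:l:]"] l(1) by simp
            ultimately have "sos2 (a + 0) (r + 0) (c'' + [:l:])" by (rule sos2_add)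
            then show ?thesis by (simp add: c''_def)
          qed
        qed
      qed
      then show ?thesis unfolding r_def c'_def by (rule sos2_unshift)
    qed
    then show ?case by (simp add: x)
  qed
  from this[of "(a, b, c)"] assms show ?thesis by simp
qed

lemma psd2I:
  assumes "\<And>t x y. x\<^sup>2 * poly a t + 2 * x * y * poly b t + y\<^sup>2 * poly c t \<ge> 0"
  shows "psd2 a b c"
  unfolding psd2_def
proof (intro allI conjI)
  fix t
  show a: "poly a t \<ge> 0" using assms[of 1 t 0] by simp
  show "poly c t \<ge> 0" using assms[of 0 t 1] by simp
  have "poly a t * poly c t \<ge> (poly b t)\<^sup>2"
  proof (cases "poly a t = 0")
    case True
    have "poly b t = 0"
    proof (rule ccontr)
      assume "poly b t \<noteq> 0"
      \<comment> \<open>This value of x, with y = 1, makes the quadratic form equal to -1.\<close>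
      then have "2 * (- (poly c t + 1) / (2 * poly b t)) * 1 * poly b t = - (poly c t + 1)" by (simp add: field_simps)
      with assms[of "- (poly c t + 1) / (2 * poly b t)" t 1] True show False by simp
    qed
    then show ?thesis using True by simp
  next
    case False
    have "(- poly b t)\<^sup>2 * poly a t + 2 * (- poly b t) * poly a t * poly b t + (poly a t)\<^sup>2 * poly c t =
        poly a t * (poly a t * poly c t - (poly b t)\<^sup>2)" by (simp add: algebra_simps power2_eq_square)
    with assms[of "- poly b t" t "poly a t"] False a show ?thesis by (simp add: zero_le_mult_iff)
  qed
  then show "poly (a * c - b\<^sup>2) t \<ge> 0" by simp
qed

text \<open>If M is the largest degree in the list, the coefficients at X^(2M) are squares and
  cannot cancel. This later bounds the size of the Gram matrix.\<close>

lemma sum_squares_degree: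
  fixes fs :: "real poly list"
  assumes "degree (\<Sum>f\<leftarrow>fs. f * f) \<le> 2 * m" "f \<in> set fs"
  shows "degree f \<le> m"
proof (rule ccontr)
  define M where "M = Max (degree ` set fs)"
  assume "\<not> ?thesis"
  moreover have le: "degree g \<le> M" if "g \<in> set fs" for g using that by (simp add: M_def)
  ultimately have "m < M" using assms(2) by (meson le_less_trans less_le_trans not_le)
  have "M \<in> degree ` set fs" unfolding M_def using assms(2) by (intro Max_in) auto
  then obtain g where g: "g \<in> set fs" "degree g = M" by blast
  have "coeff (h * h) (2 * M) = (coeff h M)\<^sup>2" if "h \<in> set fs" for h
  proof (cases "degree h = M")
    case True
    then show ?thesis using coeff_mult_degree_sum[of h h] by (simp add: mult_2 power2_eq_square)
  next
    case False
    then have "degree h < M" using le[OF that] by simp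
    then show ?thesis using degree_mult_le[of h h] by (simp add: coeff_eq_0)
  qed
  moreover have "coeff (sum_list (map F hs)) k = (\<Sum>h\<leftarrow>hs. coeff (F h) k)" for F :: "real poly \<Rightarrow> real poly" and hs k
    by (induction hs) auto
  ultimately have "coeff (\<Sum>f\<leftarrow>fs. f * f) (2 * M) = (\<Sum>h\<leftarrow>fs. (coeff h M)\<^sup>2)"
    by (simp cong: map_cong)
  moreover have "coeff (\<Sum>f\<leftarrow>fs. f * f) (2 * M) = 0"
    using assms(1) \<open>m < M\<close> by (intro coeff_eq_0) simp
  moreover have "(coeff g M)\<^sup>2 \<le> (\<Sum>h\<leftarrow>fs. (coeff h M)\<^sup>2)"
    using g(1) by (intro member_le_sum_list) auto
  ultimately have "lead_coeff g = 0" using g(2) by simp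
  then show False using g \<open>m < M\<close> by auto
qed

section \<open>The constant \<open>A_star\<close>\<close>

lemma convex_seq_add: "convex_seq k a \<Longrightarrow> convex_seq k b \<Longrightarrow> convex_seq k (\<lambda>j. a j + b j)"
  unfolding convex_seq_def by (simp add: umbral_seq_add)

lemma convex_seq_cmult: "convex_seq k a \<Longrightarrow> c \<ge> 0 \<Longrightarrow> convex_seq k (\<lambda>j. c * a j)"
  unfolding convex_seq_def by (simp add: umbral_seq_mult)

lemma umbral_hessian_scale:
  fixes a :: "nat \<Rightarrow> 'a::comm_ring_1"
  shows "umbral a ([:c * s, c * t:] ^ m * [:e * u, e * v:] ^ 2) = c ^ m * e\<^sup>2 * umbral a ([:s, t:] ^ m * [:u, v:] ^ 2)"
proof -
  have "[:c * s, c * t:] ^ m = Polynomial.smult (c ^ m) ([:s, t:] ^ m)"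
    "[:e * u, e * v:] ^ 2 = Polynomial.smult (e\<^sup>2) ([:u, v:] ^ 2)" by (simp_all flip: smult_power)
  then show ?thesis by (simp only: mult_smult_left mult_smult_right umbral_smult mult_ac)
qed

lemma umbral_hessian_rank_one:
  fixes x y :: "'a::comm_ring_1"
  shows "umbral (\<lambda>j. x ^ (m + 2 - j) * y ^ j) ([:s, t:] ^ m * [:u, v:] ^ 2) = (s * x + t * y) ^ m * (u * x + v * y)\<^sup>2"
  using umbral_rank_one[of "replicate m (s, t) @ replicate 2 (u, v)" "\<lambda>j. x ^ (m + 2 - j) * y ^ j" x y]
  by (simp add: prod_list_replicate)

lemma convex_seq_rank_one:
  assumes "k \<ge> 2" "even k"
  shows "convex_seq k (\<lambda>j. x ^ (k - j) * y ^ j)"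
  unfolding convex_seq_def
proof (intro allI)
  fix s t u v
  obtain m where m: "k = m + 2" using assms(1) by (metis le_add_diff_inverse2)
  have "umbral (\<lambda>j. x ^ (k - j) * y ^ j) ([:s, t:] ^ (k - 2) * [:u, v:] ^ 2) = (s * x + t * y) ^ m * (u * x + v * y)\<^sup>2"
    unfolding m by (simp only: add_diff_cancel_right' umbral_hessian_rank_one)
  also have "\<dots> \<ge> 0" using assms(2) m by (intro mult_nonneg_nonneg) (auto simp: zero_le_even_power)
  finally show "0 \<le> umbral (\<lambda>j. x ^ (k - j) * y ^ j) ([:s, t:] ^ (k - 2) * [:u, v:] ^ 2)" .
qed

lemma convex_seq_ones:
  assumes "d \<ge> 1"
  shows "convex_seq (2 * d) (\<lambda>j. 1)"
  using convex_seq_rank_one[of "2 * d" 1 1] assms by simp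

lemma convex_seq_power_nonneg:
  assumes "convex_seq k a" "k \<ge> 2"
  shows "umbral a ([:s, t:] ^ k) \<ge> 0"
proof -
  have "[:s, t:] ^ k = [:s, t:] ^ (k - 2) * [:s, t:] ^ 2"
    using assms(2) by (simp only: power_add[symmetric] le_add_diff_inverse2)
  then show ?thesis using assms(1) by (simp add: convex_seq_def)
qed

lemma convex_seq_ends_nonneg:
  assumes "convex_seq k a" "k \<ge> 2"
  shows "a 0 \<ge> 0" "a k \<ge> 0"
proof -
  show "a 0 \<ge> 0" using convex_seq_power_nonneg[OF assms, of 1 0] by (simp flip: one_pCons)
  show "a k \<ge> 0" using convex_seq_power_nonneg[OF assms, of 0 1] by (simp only: umbral_X_power)
qed

lemma convex_seq_scale:
  assumes a: "convex_seq k a" and "k \<ge> 2"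
  shows "convex_seq k (\<lambda>j. x ^ (k - j) * y ^ j * a j)"
  unfolding convex_seq_def
proof (intro allI)
  fix s t u v
  have "umbral (\<lambda>j. x ^ (k - j) * y ^ j * a j) ([:s, t:] ^ (k - 2) * [:u, v:] ^ 2) =
      umbral a ([:x * s, y * t:] ^ (k - 2) * [:x * u, y * v:] ^ 2)"
    unfolding umbral_hessian
  proof (rule sum.cong[OF refl])
    fix j assume "j \<in> {..k - 2}"
    then obtain i where i: "k = i + j + 2" using \<open>k \<ge> 2\<close> by (metis atMost_iff le_add_diff_inverse2 add.commute le_diff_conv2 add.assoc)
    then have e: "k - 2 - j = i" "k - j = Suc (Suc i)" "k - Suc j = Suc i" "k - Suc (Suc j) = i" by auto
    show "of_nat (k - 2 choose j) * s ^ (k - 2 - j) * t ^ j * (u\<^sup>2 * (x ^ (k - j) * y ^ j * a j) +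
        2 * u * v * (x ^ (k - Suc j) * y ^ Suc j * a (Suc j)) + v\<^sup>2 * (x ^ (k - Suc (Suc j)) * y ^ Suc (Suc j) * a (Suc (Suc j)))) =
      of_nat (k - 2 choose j) * (x * s) ^ (k - 2 - j) * (y * t) ^ j * ((x * u)\<^sup>2 * a j +
        2 * (x * u) * (y * v) * a (Suc j) + (y * v)\<^sup>2 * a (Suc (Suc j)))"
      unfolding e by (simp add: power_mult_distrib power2_eq_square algebra_simps)
  qed
  then show "0 \<le> umbral (\<lambda>j. x ^ (k - j) * y ^ j * a j) ([:s, t:] ^ (k - 2) * [:u, v:] ^ 2)"
    using a by (simp add: convex_seq_def)
qed

section \<open>Normalization of the end moments\<close>

definition normalized_convex_seqs :: "nat \<Rightarrow> (nat \<Rightarrow> real) set" where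
  "normalized_convex_seqs k = {a. convex_seq k a \<and> a 0 = 1 \<and> a k = 1}"

text \<open>A form vanishing at one of the two vectors is first perturbed by \<open>\<epsilon> (s\<^bsup>2d\<^esup> + t\<^bsup>2d\<^esup>)\<close>, which
  does not affect the middle coefficient.\<close>

lemma normalized_bound_imp_bound:
  assumes d: "d \<ge> 1" and M: "\<And>a. a \<in> normalized_convex_seqs (2 * d) \<Longrightarrow> a d \<le> M"
    and a: "convex_seq (2 * d) a"
  shows "a d \<le> M * sqrt (a 0 * a (2 * d))"
proof -
  have pos: "a d \<le> M * sqrt ((a 0 + e) * (a (2 * d) + e))" if "e > 0" for e
  proof -
    define b where "b j = a j + e * (1 ^ (2 * d - j) * 0 ^ j + 0 ^ (2 * d - j) * 1 ^ j)" for j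
    have b: "convex_seq (2 * d) b" unfolding b_def
      using that d by (intro convex_seq_add convex_seq_cmult a convex_seq_rank_one) auto
    have b_vals: "b 0 = a 0 + e" "b (2 * d) = a (2 * d) + e" "b d = a d"
      using d by (simp_all add: b_def power_0_left)
    have b_pos: "b 0 > 0" "b (2 * d) > 0"
      using convex_seq_ends_nonneg[OF a] d that by (auto simp: b_vals)
    define x y where "x = root (2 * d) (1 / b 0)" and "y = root (2 * d) (1 / b (2 * d))"
    have xy: "x > 0" "y > 0" "x ^ (2 * d) = 1 / b 0" "y ^ (2 * d) = 1 / b (2 * d)"
      using b_pos d by (auto simp: x_def y_def)
    have "(\<lambda>j. x ^ (2 * d - j) * y ^ j * b j) \<in> normalized_convex_seqs (2 * d)"
      using convex_seq_scale[OF b, of x y] d xy b_pos by (simp add: normalized_convex_seqs_def)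
    from M[OF this] have le: "(x * y) ^ d * a d \<le> M" by (simp add: b_vals power_mult_distrib mult_2)
    have "((x * y) ^ d)\<^sup>2 = 1 / (b 0 * b (2 * d))"
      using xy(3,4) by (simp add: power_mult_distrib power_mult[symmetric] mult.commute)
    then have "sqrt (1 / (b 0 * b (2 * d))) = (x * y) ^ d"
      using xy(1,2) by (intro real_sqrt_unique) auto
    then have "(x * y) ^ d = 1 / sqrt (b 0 * b (2 * d))" by (simp add: real_sqrt_divide)
    then have "a d / sqrt (b 0 * b (2 * d)) \<le> M" using le by simp
    then show ?thesis using b_pos by (simp add: pos_divide_le_eq b_vals)
  qed
  show ?thesis
  proof (rule tendsto_lowerbound[where F = "at_right 0"])
    have "((\<lambda>e. M * sqrt ((a 0 + e) * (a (2 * d) + e))) \<longlongrightarrow> M * sqrt ((a 0 + 0) * (a (2 * d) + 0))) (at_right 0)"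
      by (intro tendsto_intros)
    then show "((\<lambda>e. M * sqrt ((a 0 + e) * (a (2 * d) + e))) \<longlongrightarrow> M * sqrt (a 0 * a (2 * d))) (at_right 0)" by simp
    show "\<forall>\<^sub>F e in at_right 0. a d \<le> M * sqrt ((a 0 + e) * (a (2 * d) + e))"
      using pos by (auto simp: eventually_at_right_field intro: exI[of _ 1])
  qed simp
qed

section \<open>Boundedness of the middle moment and passage to a supremum\<close>

text \<open>The polynomial is in Bernstein form with coefficients \<open>a\<close>, and
  differentiating a Bernstein form takes forward differences of its coefficients.\<close>

lemma DERIV_bernstein:
  "((\<lambda>x. umbral a ([:1 - x, x:] ^ k)) has_real_derivative
     real k * umbral (\<lambda>j. a (Suc j) - a j) ([:1 - x, x:] ^ (k - 1))) (at x)"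
proof (induction k arbitrary: a)
  case (Suc k)
  have step: "umbral b ([:1 - x, x:] ^ Suc m) = (1 - x) * umbral b ([:1 - x, x:] ^ m) + x * umbral (\<lambda>j. b (Suc j)) ([:1 - x, x:] ^ m)"
    for b :: "nat \<Rightarrow> real" and x m
    by (simp only: power_Suc umbral_mult_linear umbral_seq_add umbral_seq_mult)
  let ?D = "\<lambda>j. a (Suc j) - a j"
  have diff: "umbral (\<lambda>j. f j - g j) q = umbral f q - umbral g q" for f g :: "nat \<Rightarrow> real" and q
    using umbral_seq_add[of f "\<lambda>j. (- 1) * g j" q] by (simp only: umbral_seq_mult) simp
  have "((\<lambda>x. (1 - x) * umbral a ([:1 - x, x:] ^ k) + x * umbral (\<lambda>j. a (Suc j)) ([:1 - x, x:] ^ k)) has_real_derivative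
     (0 - 1) * umbral a ([:1 - x, x:] ^ k) + (real k * umbral ?D ([:1 - x, x:] ^ (k - 1))) * (1 - x)
     + (1 * umbral (\<lambda>j. a (Suc j)) ([:1 - x, x:] ^ k) + (real k * umbral (\<lambda>j. ?D (Suc j)) ([:1 - x, x:] ^ (k - 1))) * x)) (at x)"
    by (intro DERIV_add DERIV_mult DERIV_diff DERIV_const DERIV_ident Suc.IH)
  moreover have "(0 - 1) * umbral a ([:1 - x, x:] ^ k) + (real k * umbral ?D ([:1 - x, x:] ^ (k - 1))) * (1 - x)
     + (1 * umbral (\<lambda>j. a (Suc j)) ([:1 - x, x:] ^ k) + (real k * umbral (\<lambda>j. ?D (Suc j)) ([:1 - x, x:] ^ (k - 1))) * x)
     = real (Suc k) * umbral ?D ([:1 - x, x:] ^ k)"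
  proof (cases k)
    case 0
    then show ?thesis by simp
  next
    case (Suc m)
    have gen: "(0 - 1) * V + (r * P) * (1 - x) + (1 * W + (r * Q) * x) = (1 + r) * U"
      if "U = (1 - x) * P + x * Q" "W - V = U" for U V W P Q r :: real
    proof -
      have "(0 - 1) * V + (r * P) * (1 - x) + (1 * W + (r * Q) * x) = (W - V) + r * ((1 - x) * P + x * Q)"
        by (simp add: algebra_simps)
      also have "\<dots> = U + r * U" by (simp only: that(2) that(1)[symmetric])
      finally show ?thesis by (simp add: distrib_right)
    qed
    have "umbral ?D ([:1 - x, x:] ^ k) = (1 - x) * umbral ?D ([:1 - x, x:] ^ m) + x * umbral (\<lambda>j. ?D (Suc j)) ([:1 - x, x:] ^ m)"
      unfolding Suc by (rule step)
    moreover have "umbral (\<lambda>j. a (Suc j)) ([:1 - x, x:] ^ k) - umbral a ([:1 - x, x:] ^ k) = umbral ?D ([:1 - x, x:] ^ k)"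
      by (simp only: diff)
    moreover have "k - 1 = m" using Suc by simp
    ultimately show ?thesis unfolding of_nat_Suc by (simp only: gen)
  qed
  ultimately show ?case unfolding step diff_Suc_1 by simp
qed simp

text \<open>On the segment between the two vectors the form is convex with value 1 at both ends,
  hence at most 1; homogeneity carries (1, t) to the segment.\<close>

lemma convex_seq_segment_bound:
  assumes a: "a \<in> normalized_convex_seqs k" and "k \<ge> 2" and t: "t \<ge> 0"
  shows "umbral a ([:1, t:] ^ k) \<le> (1 + t) ^ k"
proof -
  have conv: "convex_seq k a" and ends: "a 0 = 1" "a k = 1" using a by (auto simp: normalized_convex_seqs_def)
  let ?f = "\<lambda>x. umbral a ([:1 - x, x:] ^ k)"
  let ?D = "\<lambda>a j. a (Suc j) - a j :: real"
  have "convex_on UNIV ?f"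
  proof (rule f''_ge0_imp_convex)
    show "((\<lambda>x. umbral a ([:1 - x, x:] ^ k)) has_real_derivative real k * umbral (?D a) ([:1 - x, x:] ^ (k - 1))) (at x)" for x
      by (rule DERIV_bernstein)
    show "((\<lambda>x. real k * umbral (?D a) ([:1 - x, x:] ^ (k - 1))) has_real_derivative
       real k * (real (k - 1) * umbral (?D (?D a)) ([:1 - x, x:] ^ (k - 1 - 1)))) (at x)" for x
      by (intro DERIV_cmult DERIV_bernstein)
    show "0 \<le> real k * (real (k - 1) * umbral (?D (?D a)) ([:1 - x, x:] ^ (k - 1 - 1)))" for x
    proof -
      \<comment> \<open>The second forward difference is the Hessian in direction (-1, 1), along the
        segment.\<close>
      have "?D (?D a) = (\<lambda>j. (- 1)\<^sup>2 * a j + 2 * (- 1) * 1 * a (Suc j) + 1\<^sup>2 * a (Suc (Suc j)))" by (auto simp: fun_eq_iff)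
      then have "umbral (?D (?D a)) ([:1 - x, x:] ^ (k - 2)) = umbral a ([:1 - x, x:] ^ (k - 2) * [:- 1, 1:] ^ 2)"
        by (simp only: umbral_mult_square)
      moreover have "\<dots> \<ge> 0" using conv unfolding convex_seq_def by blast
      moreover have "k - 1 - 1 = k - 2" by simp
      ultimately show ?thesis by simp
    qed
  qed simp
  moreover define x where "x = t / (1 + t)"
  ultimately have "?f ((1 - x) *\<^sub>R 0 + x *\<^sub>R 1) \<le> (1 - x) * ?f 0 + x * ?f 1"
    using t by (intro convex_onD[where A = UNIV]) (auto simp: x_def)
  moreover have "?f 0 = 1" using ends by (simp flip: one_pCons)
  moreover have "?f 1 = 1" using ends by (simp only: diff_self umbral_X_power)
  ultimately have "?f x \<le> 1" by simp
  moreover have "[:1, t:] = Polynomial.smult (1 + t) [:1 - x, x:]" using t by (simp add: x_def field_simps)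
  then have "umbral a ([:1, t:] ^ k) = (1 + t) ^ k * ?f x" by (simp only: smult_power umbral_smult)
  ultimately show ?thesis using t by (simp add: mult_left_le)
qed

text \<open>A quantitative form of the uniqueness of interpolation. Dividing q - q(x0) by X - x0
  lowers the degree and replaces the bound M by 2 M / \<delta>, where \<delta> is the least distance
  from x0 to the other nodes.\<close>

lemma poly_coeffs_bounded_by_values:
  fixes S :: "real set"
  assumes "finite S" "card S = Suc N"
  shows "\<exists>C. \<forall>q. degree q \<le> N \<longrightarrow> (\<forall>x\<in>S. \<bar>poly q x\<bar> \<le> M) \<longrightarrow> (\<forall>j. \<bar>coeff q j\<bar> \<le> C)"
  using assms
proof (induction N arbitrary: S M)
  case 0
  then obtain x where "S = {x}" by (auto simp: card_1_singleton_iff)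
  have "\<bar>coeff q j\<bar> \<le> \<bar>M\<bar>" if "degree q \<le> 0" "\<forall>x\<in>S. \<bar>poly q x\<bar> \<le> M" for q :: "real poly" and j
  proof -
    obtain c where "q = [:c:]" using \<open>degree q \<le> 0\<close> by (auto elim: degree_eq_zeroE)
    with that(2) \<open>S = {x}\<close> show ?thesis by (cases j) auto
  qed
  then show ?case by blast
next
  case (Suc N)
  then obtain x0 where x0: "x0 \<in> S" by fastforce
  let ?S = "S - {x0}"
  have fin: "finite ?S" "card ?S = Suc N" using Suc.prems x0 by auto
  define \<delta> where "\<delta> = Min ((\<lambda>x. \<bar>x - x0\<bar>) ` ?S)"
  have ne: "?S \<noteq> {}" using fin by (metis card.empty Zero_not_Suc)
  have \<delta>: "\<delta> > 0" unfolding \<delta>_def using fin ne by (subst Min_gr_iff) auto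
  have \<delta>_le: "\<delta> \<le> \<bar>x - x0\<bar>" if "x \<in> ?S" for x unfolding \<delta>_def using fin that by (intro Min_le) auto
  obtain C where C: "\<And>q. degree q \<le> N \<Longrightarrow> (\<forall>x\<in>?S. \<bar>poly q x\<bar> \<le> 2 * M / \<delta>) \<Longrightarrow> (\<forall>j. \<bar>coeff q j\<bar> \<le> C)"
    using Suc.IH[OF fin, of "2 * M / \<delta>"] by blast
  have "\<bar>coeff q j\<bar> \<le> M + C + \<bar>x0\<bar> * C" if deg: "degree q \<le> Suc N" and val: "\<forall>x\<in>S. \<bar>poly q x\<bar> \<le> M" for q j
  proof -
    have "poly (q - [:poly q x0:]) x0 = 0" by simp
    then obtain r where r: "q - [:poly q x0:] = [:- x0, 1:] * r"
      unfolding poly_eq_0_iff_dvd dvd_def by blast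
    have M: "M \<ge> 0" using val x0 by force
    have "degree r \<le> N"
    proof (cases "r = 0")
      case False
      then have "Suc (degree r) = degree ([:- x0, 1:] * r)"
        by (subst degree_mult_eq) auto
      also have "\<dots> \<le> Suc N" unfolding r[symmetric] using deg by (intro degree_diff_le) auto
      finally show ?thesis by simp
    qed simp
    moreover have "\<bar>poly r x\<bar> \<le> 2 * M / \<delta>" if x: "x \<in> ?S" for x
    proof -
      have "poly q x - poly q x0 = (x - x0) * poly r x" using arg_cong[OF r, of "\<lambda>p. poly p x"] by (simp add: algebra_simps)
      moreover have "\<bar>poly q x - poly q x0\<bar> \<le> 2 * M" using val x x0 by (smt (verit) DiffD1)
      ultimately have "\<bar>x - x0\<bar> * \<bar>poly r x\<bar> \<le> 2 * M" by (simp add: abs_mult)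
      moreover have "\<delta> * \<bar>poly r x\<bar> \<le> \<bar>x - x0\<bar> * \<bar>poly r x\<bar>" using \<delta>_le[OF x] by (intro mult_right_mono) auto
      ultimately show ?thesis using \<delta> by (simp add: pos_le_divide_eq mult.commute)
    qed
    ultimately have rC: "\<bar>coeff r j\<bar> \<le> C" for j using C by blast
    have C0: "C \<ge> 0" using rC[of 0] by linarith
    have q: "q = [:poly q x0:] + [:- x0, 1:] * r" using r by (simp add: algebra_simps)
    show ?thesis
    proof (cases j)
      case 0
      have "coeff q 0 = poly q x0 - x0 * coeff r 0" by (subst q) simp
      moreover have "\<bar>x0 * coeff r 0\<bar> \<le> \<bar>x0\<bar> * C" unfolding abs_mult using rC by (intro mult_left_mono) auto
      moreover have "\<bar>poly q x0\<bar> \<le> M" using val x0 by blast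
      ultimately show ?thesis unfolding 0 using C0 by linarith
    next
      case (Suc i)
      have "coeff q j = coeff r i - x0 * coeff r j" unfolding Suc by (subst q) simp
      moreover have "\<bar>x0 * coeff r j\<bar> \<le> \<bar>x0\<bar> * C" unfolding abs_mult using rC by (intro mult_left_mono) auto
      ultimately show ?thesis using rC[of i] M by linarith
    qed
  qed
  then show ?case by blast
qed

text \<open>For x in 0, ..., 2d the form at (1, x) lies between 0 and (1 + x)^(2d), and these 2d + 1
  nodes control all coefficients.\<close>

lemma normalized_middle_coeff_bounded:
  assumes d: "d \<ge> 1"
  shows "\<exists>M. \<forall>a\<in>normalized_convex_seqs (2 * d). a d \<le> M"
proof -
  let ?k = "2 * d"
  let ?S = "real ` {..?k}"
  let ?q = "\<lambda>a :: nat \<Rightarrow> real. \<Sum>l\<le>?k. monom (real (?k choose l) * a l) l"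
  have "finite ?S" "card ?S = Suc ?k" by (auto simp: card_image)
  then obtain C where C: "\<And>q j. degree q \<le> ?k \<Longrightarrow> (\<forall>x\<in>?S. \<bar>poly q x\<bar> \<le> (1 + real ?k) ^ ?k) \<Longrightarrow> \<bar>coeff q j\<bar> \<le> C"
    using poly_coeffs_bounded_by_values[of ?S ?k "(1 + real ?k) ^ ?k"] by blast
  have "a d \<le> C" if a: "a \<in> normalized_convex_seqs ?k" for a
  proof -
    have conv: "convex_seq ?k a" using a by (simp add: normalized_convex_seqs_def)
    have "degree (?q a) \<le> ?k"
      by (intro degree_sum_le) (auto intro: order_trans[OF degree_monom_le])
    moreover have "\<bar>poly (?q a) x\<bar> \<le> (1 + real ?k) ^ ?k" if "x \<in> ?S" for x
    proof -
      have x: "0 \<le> x" "x \<le> real ?k" using that by auto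
      have "poly (?q a) x = umbral a ([:1, x:] ^ ?k)"
        by (simp add: poly_sum poly_monom umbral_linear_power mult_ac)
      moreover have "0 \<le> umbral a ([:1, x:] ^ ?k)" using convex_seq_power_nonneg[OF conv] d by simp
      moreover have "umbral a ([:1, x:] ^ ?k) \<le> (1 + x) ^ ?k" using convex_seq_segment_bound[OF a _ x(1)] d by simp
      moreover have "(1 + x) ^ ?k \<le> (1 + real ?k) ^ ?k" using x by (intro power_mono) auto
      ultimately show ?thesis by linarith
    qed
    ultimately have "\<bar>coeff (?q a) d\<bar> \<le> C" using C by blast
    moreover have "coeff (?q a) d = real (?k choose d) * a d" by (simp add: coeff_sum coeff_monom)
    moreover have "real (?k choose d) \<ge> 1" by (simp add: Suc_leI)
    ultimately have le: "real (?k choose d) * \<bar>a d\<bar> \<le> C" by (simp add: abs_mult)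
    have "1 * \<bar>a d\<bar> \<le> real (?k choose d) * \<bar>a d\<bar>" using \<open>real (?k choose d) \<ge> 1\<close> by (intro mult_right_mono) auto
    with le show ?thesis by linarith
  qed
  then show ?thesis by blast
qed

text \<open>The supremum is itself an admissible constant, so the infimum is a minimum; the constant
  sequence 1 shows that it is nonnegative.\<close>

theorem Inf_A_convex_seq:
  assumes d: "d \<ge> 1"
  shows "Inf {A. A \<ge> 0 \<and> (\<forall>a. convex_seq (2 * d) a \<longrightarrow> a d \<le> A * sqrt (a 0 * a (2 * d)))} =
    Sup ((\<lambda>a. a d) ` normalized_convex_seqs (2 * d))" (is "Inf ?A = Sup ?S")
proof (rule cInf_eq_minimum)
  have bdd: "bdd_above ?S" using normalized_middle_coeff_bounded[OF d] by (auto simp: bdd_above_def)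
  have one: "1 \<in> ?S" using convex_seq_ones[OF d] by (force simp: normalized_convex_seqs_def)
  have "a d \<le> Sup ?S" if "a \<in> normalized_convex_seqs (2 * d)" for a
    using that bdd by (intro cSup_upper) auto
  then show "Sup ?S \<in> ?A"
    using normalized_bound_imp_bound[OF d] cSup_upper[OF one bdd] by auto
  fix A assume A: "A \<in> ?A"
  show "Sup ?S \<le> A"
  proof (rule cSup_least)
    show "?S \<noteq> {}" using one by blast
    fix x assume "x \<in> ?S"
    then obtain a where "x = a d" "convex_seq (2 * d) a" "a 0 = 1" "a (2 * d) = 1"
      by (auto simp: normalized_convex_seqs_def)
    with A show "x \<le> A" by force
  qed
qed

lemma normalized_Sup_eq_1:
  assumes d: "d \<ge> 1" and le: "\<And>a. a \<in> normalized_convex_seqs (2 * d) \<Longrightarrow> a d \<le> 1"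
  shows "Sup ((\<lambda>a. a d) ` normalized_convex_seqs (2 * d)) = 1"
proof (rule cSup_eq_maximum)
  show "1 \<in> (\<lambda>a. a d) ` normalized_convex_seqs (2 * d)"
    using convex_seq_ones[OF d] by (force simp: normalized_convex_seqs_def)
qed (use le in auto)

text \<open>The functional takes the value 2 - 2 a_d at (1 - X^d)^2. This polynomial is (1 - X)^2
  for d = 1, (1 + X)^2 (1 - X)^2 for d = 2, and half of (1 + X)^4 (1 - X)^2 + (1 - X)^2 + X^4 (1 -
  X)^2 for d = 3, so convexity makes the value nonnegative.\<close>

lemma normalized_middle_coeff_le_1:
  assumes "d \<in> {1, 2, 3}" "a \<in> normalized_convex_seqs (2 * d)"
  shows "a d \<le> 1"
proof -
  have ends: "a 0 = 1" "a (2 * d) = 1" using assms(2) by (auto simp: normalized_convex_seqs_def)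
  have conv: "umbral a ([:s, t:] ^ (2 * d - 2) * [:1, - 1:] ^ 2) \<ge> 0" for s t
    using assms(2) by (auto simp: normalized_convex_seqs_def convex_seq_def)
  consider "d = 1" | "d = 2" | "d = 3" using assms(1) by auto
  then show ?thesis
  proof cases
    case 1
    then show ?thesis using conv[of 1 1] ends unfolding umbral_hessian by (simp add: numeral_eq_Suc)
  next
    case 2
    then show ?thesis using conv[of 1 1] ends unfolding umbral_hessian by (simp add: numeral_eq_Suc)
  next
    case 3
    then show ?thesis using conv[of 1 1] conv[of 1 0] conv[of 0 1] ends unfolding umbral_hessian
      by (simp add: numeral_eq_Suc)
  qed
qed

subsection \<open>Even degree parameters\<close>

text \<open>On the compact set where h \<le> 0 the function g has no zero, hence a positive minimum,
  which absorbs a small negative multiple.\<close>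

lemma perturbation_nonneg:
  fixes g h :: "'a::topological_space \<Rightarrow> real"
  assumes S: "compact S" and g: "continuous_on S g" and h: "continuous_on S h"
    and nonneg: "\<And>x. x \<in> S \<Longrightarrow> g x \<ge> 0" and pos: "\<And>x. x \<in> S \<Longrightarrow> g x = 0 \<Longrightarrow> h x > 0"
  obtains e where "e > 0" "\<And>x. x \<in> S \<Longrightarrow> g x + e * h x \<ge> 0"
proof (cases "\<exists>x\<in>S. h x \<le> 0")
  case False
  then show ?thesis using that[of 1] nonneg by (auto simp: not_le intro: less_imp_le add_nonneg_nonneg)
next
  case True
  define K where "K = {x\<in>S. h x \<le> 0}"
  have "compact K"
  proof -
    have "closedin (top_of_set S) (S \<inter> h -` {..0})"
      by (rule continuous_closedin_preimage[OF h]) simp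
    moreover have "S \<inter> h -` {..0} = K" by (auto simp: K_def)
    ultimately show ?thesis using S closedin_compact by metis
  qed
  have "K \<noteq> {}" "K \<subseteq> S" using True by (auto simp: K_def)
  obtain x1 where x1: "x1 \<in> K" "\<And>x. x \<in> K \<Longrightarrow> g x1 \<le> g x"
    using continuous_attains_inf[OF \<open>compact K\<close> \<open>K \<noteq> {}\<close> continuous_on_subset[OF g \<open>K \<subseteq> S\<close>]] by blast
  obtain x2 where x2: "x2 \<in> S" "\<And>x. x \<in> S \<Longrightarrow> h x2 \<le> h x"
    using continuous_attains_inf[OF S _ h] True by blast
  have g1: "g x1 > 0"
    using x1(1) nonneg[of x1] pos[of x1] unfolding K_def by fastforce
  define e where "e = g x1 / (1 + \<bar>h x2\<bar>)"
  have e: "e > 0" using g1 by (simp add: e_def add_pos_nonneg)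
  have "g x + e * h x \<ge> 0" if x: "x \<in> S" for x
  proof (cases "x \<in> K")
    case True
    have "e * h x \<ge> e * - \<bar>h x2\<bar>" using x2(2)[OF x] e by (intro mult_left_mono) auto
    moreover have "e * \<bar>h x2\<bar> \<le> g x1" using g1 by (simp add: e_def field_simps)
    ultimately show ?thesis using x1(2)[OF True] by simp
  next
    case False
    then have "h x > 0" using x by (auto simp: K_def)
    then show ?thesis using nonneg[OF x] e by (simp add: add_nonneg_nonneg)
  qed
  with e that show ?thesis by blast
qed

text \<open>The Hessian form is homogeneous of even degree in each pair of variables, so it may be
  tested on a compact set.\<close>

lemma convex_seq_unit_circle:
  assumes k: "k > 2" "even k"
    and unit: "\<And>s t u v. s\<^sup>2 + t\<^sup>2 = 1 \<Longrightarrow> u\<^sup>2 + v\<^sup>2 = 1 \<Longrightarrow> umbral a ([:s, t:] ^ (k - 2) * [:u, v:] ^ 2) \<ge> 0"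
  shows "convex_seq k a"
  unfolding convex_seq_def
proof (intro allI)
  fix s t u v :: real
  have polar: "\<exists>c x' y'. x = c * x' \<and> y = c * y' \<and> x'\<^sup>2 + y'\<^sup>2 = 1" for x y :: real
  proof (cases "x = 0 \<and> y = 0")
    case True
    then show ?thesis by (intro exI[of _ 0] exI[of _ 1]) auto
  next
    case False
    define c where "c = sqrt (x\<^sup>2 + y\<^sup>2)"
    have "x\<^sup>2 + y\<^sup>2 > 0" using False by (simp add: sum_power2_gt_zero_iff)
    then have c: "c \<noteq> 0" "c\<^sup>2 = x\<^sup>2 + y\<^sup>2" by (auto simp: c_def)
    have "(x / c)\<^sup>2 + (y / c)\<^sup>2 = (x\<^sup>2 + y\<^sup>2) / c\<^sup>2" by (simp add: power_divide add_divide_distrib)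
    also have "\<dots> = 1" unfolding c(2)[symmetric] using c(1) by simp
    finally have "(x / c)\<^sup>2 + (y / c)\<^sup>2 = 1" .
    moreover have "x = c * (x / c)" "y = c * (y / c)" using c(1) by auto
    ultimately show ?thesis by blast
  qed
  obtain c s' t' where st: "s = c * s'" "t = c * t'" "s'\<^sup>2 + t'\<^sup>2 = 1" using polar by blast
  obtain e u' v' where uv: "u = e * u'" "v = e * v'" "u'\<^sup>2 + v'\<^sup>2 = 1" using polar by blast
  have "umbral a ([:s, t:] ^ (k - 2) * [:u, v:] ^ 2) = c ^ (k - 2) * e\<^sup>2 * umbral a ([:s', t':] ^ (k - 2) * [:u', v':] ^ 2)"
    unfolding st uv by (rule umbral_hessian_scale)
  also have "\<dots> \<ge> 0" using unit[OF st(3) uv(3)] k by (intro mult_nonneg_nonneg) (auto simp: zero_le_even_power)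
  finally show "0 \<le> umbral a ([:s, t:] ^ (k - 2) * [:u, v:] ^ 2)" .
qed

text \<open>The form \<open>((s + t)\<^bsup>2d\<^esup> + (s - t)\<^bsup>2d\<^esup>) / 2\<close> has middle coefficient \<open>1\<close>, and its Hessian degenerates
  only along \<open>s = \<plusminus>t\<close>. The perturbation adds a multiple of \<open>s\<^bsup>2d-2\<^esup> t\<^sup>2\<close>, whose Hessian is positive
  in the degenerate directions and outweighs that of \<open>s\<^sup>d t\<^sup>d\<close>.\<close>

lemma normalized_middle_coeff_gt_1:
  assumes "even d" "d \<ge> 4"
  obtains a where "a \<in> normalized_convex_seqs (2 * d)" "a d > 1"
proof -
  define m where "m = 2 * d - 2"
  have m: "2 * d = m + 2" "m \<ge> 6" "even m" using assms by (auto simp: m_def)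
  \<comment> \<open>\<open>E l\<close> is the weight of the l-th moment in the Hessian at (1, 1) in
    direction (1, -1), where the unperturbed form degenerates.\<close>
  define E where "E l = coeff ([:1, 1:] ^ m * [:1, - 1:] ^ 2 :: real poly) l" for l
  \<comment> \<open>The weight is (m choose 2) - 2 m + 1, positive for m \<ge> 6; for d = 2, that is
    m = 2, it would be negative.\<close>
  have E2: "E 2 > 0"
  proof -
    have "E 2 = real (m choose 2) - 2 * real m + 1"
      unfolding E_def numeral_2_eq_2 coeff_mult_square(3) using m(2) by (simp add: coeff_linear_power numeral_2_eq_2)
    moreover have "real (m choose 2) = real m * (real m - 1) / 2"
      using m(2) by (simp add: choose_two real_of_nat_div of_nat_diff)
    moreover have "real m * (real m - 1) \<ge> 6 * (real m - 1)" using m(2) by (intro mult_right_mono) auto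
    ultimately show ?thesis using m(2) by (simp add: field_simps)
  qed
  \<comment> \<open>Chosen so that K E(2) + E(d) = 1 + |E(d)| + E(d), which is at least 1.\<close>
  define K where "K = (1 + \<bar>E d\<bar>) / E 2"
  define q where "q j = (if j = 2 then K else if j = d then 1 else (0::real))" for j
  define p where "p j = (1 ^ (2 * d - j) * 1 ^ j + 1 ^ (2 * d - j) * (- 1) ^ j) / (2::real)" for j
  have q_umbral: "umbral q r = K * coeff r 2 + coeff r d" if "degree r \<le> 2 * d" for r
  proof -
    have "umbral q r = (\<Sum>j\<le>2 * d. q j * coeff r j)" by (rule umbral_altdef[OF that])
    also have "\<dots> = (\<Sum>j\<in>{2, d}. q j * coeff r j)"
      using assms by (intro sum.mono_neutral_right) (auto simp: q_def)
    finally show ?thesis using assms by (simp add: q_def)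
  qed
  have deg: "degree ([:s, t:] ^ m * [:u, v:] ^ 2) \<le> 2 * d" for s t u v :: real
    unfolding m_def using assms by (intro degree_hessian_symbol) simp
  have L1: "umbral q ([:1, 1:] ^ m * [:1, - 1:] ^ 2) \<ge> 1"
  proof -
    have "umbral q ([:1, 1:] ^ m * [:1, - 1:] ^ 2) = 1 + \<bar>E d\<bar> + E d"
      using E2 by (simp add: q_umbral[OF deg] K_def flip: E_def)
    then show ?thesis by linarith
  qed
  \<comment> \<open>Replacing X by -X exchanges the two degenerate directions, and it fixes the
    moments 2 and d because both are even.\<close>
  have L2: "umbral q ([:1, - 1:] ^ m * [:1, 1:] ^ 2) = umbral q ([:1, 1:] ^ m * [:1, - 1:] ^ 2)"
  proof -
    have pw: "pcompose (f ^ n) g = pcompose f g ^ n" for f g :: "real poly" and n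
      by (induction n) (simp_all add: pcompose_mult pcompose_1)
    have "[:1, - 1:] ^ m * [:1, 1:] ^ 2 = pcompose ([:1, 1:] ^ m * [:1, - 1:] ^ 2) [:0, - 1 :: real:]"
      by (simp add: pcompose_mult pw pcompose_pCons)
    then have "coeff ([:1, - 1:] ^ m * [:1, 1:] ^ 2) l = (- 1) ^ l * coeff ([:1, 1:] ^ m * [:1, - 1:] ^ 2 :: real poly) l" for l
      by (simp only: coeff_pcompose_linear)
    then show ?thesis using assms by (simp add: q_umbral[OF deg])
  qed
  define g where "g = (\<lambda>(s, t, u, v). ((s + t) ^ m * (u + v)\<^sup>2 + (s - t) ^ m * (u - v)\<^sup>2) / (2::real))"
  define h where "h = (\<lambda>(s, t, u, v). umbral q ([:s, t:] ^ m * [:u, v:] ^ 2))"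
  define S :: "(real \<times> real \<times> real \<times> real) set" where "S = {(s, t, u, v) | s t u v. s\<^sup>2 + t\<^sup>2 = 1 \<and> u\<^sup>2 + v\<^sup>2 = 1}"
  have p_umbral: "umbral p ([:s, t:] ^ m * [:u, v:] ^ 2) = g (s, t, u, v)" for s t u v
  proof -
    have "p = (\<lambda>j. (1 / 2) * (1 ^ (m + 2 - j) * 1 ^ j + 1 ^ (m + 2 - j) * (- 1) ^ j))"
      by (auto simp: p_def m(1))
    then show ?thesis unfolding g_def by (simp only: umbral_seq_mult umbral_seq_add umbral_hessian_rank_one) simp
  qed
  have "compact S"
  proof -
    have "closed {x :: real \<times> real \<times> real \<times> real. (fst x)\<^sup>2 + (fst (snd x))\<^sup>2 = 1 \<and> (fst (snd (snd x)))\<^sup>2 + (snd (snd (snd x)))\<^sup>2 = 1}"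
      by (intro closed_Collect_conj closed_Collect_eq continuous_intros)
    moreover have "S = {x. (fst x)\<^sup>2 + (fst (snd x))\<^sup>2 = 1 \<and> (fst (snd (snd x)))\<^sup>2 + (snd (snd (snd x)))\<^sup>2 = 1}"
      by (auto simp: S_def)
    ultimately have "closed S" by simp
    moreover have "S \<subseteq> {-1..1} \<times> {-1..1} \<times> {-1..1} \<times> {-1..1}"
    proof -
      have "x \<in> {-1..1}" "y \<in> {-1..1}" if "x\<^sup>2 + y\<^sup>2 = 1" for x y :: real
      proof -
        have "x\<^sup>2 \<le> 1" "y\<^sup>2 \<le> 1" using that zero_le_power2[of x] zero_le_power2[of y] by linarith+
        then show "x \<in> {-1..1}" "y \<in> {-1..1}" by (auto simp: abs_square_le_1 abs_le_iff)
      qed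
      then show ?thesis unfolding S_def by blast
    qed
    moreover have "compact ({-1..1 :: real} \<times> {-1..1 :: real} \<times> {-1..1 :: real} \<times> {-1..1 :: real})"
      by (intro compact_Times compact_Icc)
    ultimately show ?thesis using closed_Int_compact inf.absorb_iff1 by metis
  qed
  moreover have "continuous_on S g" unfolding g_def case_prod_beta by (intro continuous_intros) auto
  moreover have "continuous_on S h" unfolding h_def case_prod_beta umbral_hessian by (intro continuous_intros)
  moreover have "g x \<ge> 0" for x
    unfolding g_def case_prod_beta using m(3) by (auto intro!: add_nonneg_nonneg mult_nonneg_nonneg simp: zero_le_even_power)
  moreover have "h x > 0" if x_in: "x \<in> S" and gx: "g x = 0" for x
  proof -
    obtain s t u v where x: "x = (s, t, u, v)" "s\<^sup>2 + t\<^sup>2 = 1" "u\<^sup>2 + v\<^sup>2 = 1" using x_in by (auto simp: S_def)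
    have "(s + t) ^ m * (u + v)\<^sup>2 \<ge> 0" "(s - t) ^ m * (u - v)\<^sup>2 \<ge> 0" using m(3) by (auto simp: zero_le_even_power)
    then have "(s + t) ^ m * (u + v)\<^sup>2 = 0" "(s - t) ^ m * (u - v)\<^sup>2 = 0" using gx by (simp_all add: g_def x add_nonneg_eq_0_iff)
    then have "s + t = 0 \<or> u + v = 0" "s - t = 0 \<or> u - v = 0" using m(2) by auto
    \<comment> \<open>On the unit circles s + t and s - t do not vanish together, nor do u + v and u
      - v, so only the two mixed combinations remain.\<close>
    then consider "t = - s" "v = u" | "t = s" "v = - u" using x(2,3) by force
    then show ?thesis
    proof cases
      case 1
      then have nz: "s \<noteq> 0" "u \<noteq> 0" using x(2,3) by auto
      have "h x = s ^ m * u\<^sup>2 * umbral q ([:1, - 1:] ^ m * [:1, 1:] ^ 2)"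
        using umbral_hessian_scale[of q s 1 "- 1" m u 1 1] 1 by (simp add: h_def x)
      moreover have "s ^ m > 0" using nz m(3) by (simp add: zero_less_power_eq)
      ultimately show ?thesis using L1 L2 nz by simp
    next
      case 2
      then have nz: "s \<noteq> 0" "u \<noteq> 0" using x(2,3) by auto
      have "h x = s ^ m * u\<^sup>2 * umbral q ([:1, 1:] ^ m * [:1, - 1:] ^ 2)"
        using umbral_hessian_scale[of q s 1 1 m u 1 "- 1"] 2 by (simp add: h_def x)
      moreover have "s ^ m > 0" using nz m(3) by (simp add: zero_less_power_eq)
      ultimately show ?thesis using L1 nz by simp
    qed
  qed
  ultimately obtain e where e: "e > 0" "\<And>x. x \<in> S \<Longrightarrow> g x + e * h x \<ge> 0"
    using perturbation_nonneg[of S g h] by blast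
  let ?a = "\<lambda>j. p j + e * q j"
  have "convex_seq (2 * d) ?a"
  proof (rule convex_seq_unit_circle)
    fix s t u v :: real assume "s\<^sup>2 + t\<^sup>2 = 1" "u\<^sup>2 + v\<^sup>2 = 1"
    then have "(s, t, u, v) \<in> S" by (simp add: S_def)
    then show "0 \<le> umbral ?a ([:s, t:] ^ (2 * d - 2) * [:u, v:] ^ 2)"
      using e(2)[of "(s, t, u, v)"] p_umbral[of s t u v]
      unfolding m_def[symmetric] umbral_seq_add umbral_seq_mult by (simp add: h_def)
  qed (use assms in auto)
  moreover have "?a 0 = 1" "?a (2 * d) = 1" "?a d = 1 + e" using assms by (simp_all add: p_def q_def)
  ultimately show ?thesis using that[of ?a] e(1) by (simp add: normalized_convex_seqs_def)
qed

section \<open>Binary octics\<close>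

lemma quadratic_form_nonneg:
  fixes a b c x y :: real
  assumes "a \<ge> 0" "c \<ge> 0" "b\<^sup>2 \<le> a * c"
  shows "x\<^sup>2 * a + 2 * x * y * b + y\<^sup>2 * c \<ge> 0"
proof (cases "a = 0")
  case True
  then show ?thesis using assms by simp
next
  case False
  have "a * (x\<^sup>2 * a + 2 * x * y * b + y\<^sup>2 * c) = (x * a + y * b)\<^sup>2 + y\<^sup>2 * (a * c - b\<^sup>2)" by Groebner_Basis.algebra
  also have "\<dots> \<ge> 0" using assms(3) by (intro add_nonneg_nonneg mult_nonneg_nonneg) auto
  finally show ?thesis using False assms(1) by (simp add: zero_le_mult_iff)
qed

lemma quadratic_form_nonneg_det:
  fixes a b c :: real
  assumes "\<And>x y. x\<^sup>2 * a + 2 * x * y * b + y\<^sup>2 * c \<ge> 0"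
  shows "b\<^sup>2 \<le> a * c"
proof -
  have "psd2 [:a:] [:b:] [:c:]" using assms by (intro psd2I) simp
  then have "poly ([:a:] * [:c:] - [:b:]\<^sup>2) 0 \<ge> 0" unfolding psd2_def by blast
  then show ?thesis by (simp add: mult.commute)
qed

lemma umbral_hessian_6:
  fixes a :: "nat \<Rightarrow> real"
  shows "umbral a ([:s, t:] ^ 6 * [:u, v:] ^ 2) =
    s ^ 6 * (u\<^sup>2 * a 0 + 2 * u * v * a 1 + v\<^sup>2 * a 2) +
    6 * s ^ 5 * t * (u\<^sup>2 * a 1 + 2 * u * v * a 2 + v\<^sup>2 * a 3) +
    15 * s ^ 4 * t ^ 2 * (u\<^sup>2 * a 2 + 2 * u * v * a 3 + v\<^sup>2 * a 4) +
    20 * s ^ 3 * t ^ 3 * (u\<^sup>2 * a 3 + 2 * u * v * a 4 + v\<^sup>2 * a 5) +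
    15 * s ^ 2 * t ^ 4 * (u\<^sup>2 * a 4 + 2 * u * v * a 5 + v\<^sup>2 * a 6) +
    6 * s * t ^ 5 * (u\<^sup>2 * a 5 + 2 * u * v * a 6 + v\<^sup>2 * a 7) +
    t ^ 6 * (u\<^sup>2 * a 6 + 2 * u * v * a 7 + v\<^sup>2 * a 8)"
proof -
  have c: "6 choose 2 = (15::nat)" "6 choose 3 = (20::nat)" "6 choose 4 = (15::nat)" "6 choose 5 = (6::nat)"
    by (simp_all add: numeral_eq_Suc)
  have set: "{..6::nat} = {0, 1, 2, 3, 4, 5, 6}" by auto
  have S: "Suc 2 = 3" "Suc 3 = 4" "Suc 4 = 5" "Suc 5 = 6" "Suc 6 = 7" "Suc 7 = 8" by simp_all
  show ?thesis unfolding umbral_hessian set by (simp add: c S numeral_2_eq_2[symmetric])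
qed

text \<open>The determinant of the Hessian of a binary octic
  \<open>x\<^sup>8 + 28 b x\<^sup>6 y\<^sup>2 + 70 a x\<^sup>4 y\<^sup>4 + 28 b x\<^sup>2 y\<^sup>6 + y\<^sup>8\<close> is, up to a constant
  factor, a binary cubic in \<open>x\<^sup>4 + y\<^sup>4\<close> and \<open>x\<^sup>2 y\<^sup>2\<close>. Here \<open>S = x\<^sup>2\<close> and \<open>T = y\<^sup>2\<close>.\<close>

lemma octic_hessian_det:
  fixes S T a b :: real
  shows "(S ^ 3 + 15 * b * S\<^sup>2 * T + 15 * a * S * T\<^sup>2 + b * T ^ 3) * (b * S ^ 3 + 15 * a * S\<^sup>2 * T + 15 * b * S * T\<^sup>2 + T ^ 3)
      - S * T * (6 * b * S\<^sup>2 + 20 * a * S * T + 6 * b * T\<^sup>2)\<^sup>2 =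
    b * (S\<^sup>2 + T\<^sup>2) ^ 3 + (15 * a - 21 * b\<^sup>2) * (S\<^sup>2 + T\<^sup>2)\<^sup>2 * (S * T) + 12 * b * (S\<^sup>2 + T\<^sup>2) * (S * T)\<^sup>2
      + (1 + 196 * b\<^sup>2 - 30 * a - 175 * a\<^sup>2) * (S * T) ^ 3"
  by Groebner_Basis.algebra

text \<open>The optimum is parametrized by a root \<open>R\<close> of an irreducible cubic: the extremal Hessian degenerates
  at \<open>x\<^sup>4 + y\<^sup>4 = 2 \<surd>R x\<^sup>2 y\<^sup>2\<close>, and \<open>b = 2 \<surd>R \<beta>\<close>.\<close>

definition octic_alpha :: "real \<Rightarrow> real" where
  "octic_alpha R = (32 + 4 * R - R\<^sup>2) / 35"

definition octic_beta :: "real \<Rightarrow> real" where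
  "octic_beta R = (105 + 14 * R - 3 * R\<^sup>2) / 392"

text \<open>The bounds on R yield \<open>octic_alpha R > 1\<close>, \<open>octic_beta R > 0\<close>
  and 3 R > 7, on which the sign arguments rest.\<close>

lemma octic_root_exists: "\<exists>R::real. 278 / 100 \<le> R \<and> R \<le> 2781 / 1000 \<and> R ^ 3 - 7 * R\<^sup>2 - 21 * R + 91 = 0"
  by (rule IVT2') (auto simp: power2_eq_square power3_eq_cube intro!: continuous_intros)

text \<open>Each difference of the two sides is a multiple of the cubic, with the quotient written
  out. As to their origin, put p = x^4 + y^4, q = x^2 y^2 and w = 2 sqrt R. The second and third
  relations say that the cubic in p and q of \<open>octic_hessian_det\<close> has the double root p
  = w q and the remaining factor \<beta> (w p + (2 R - 6) q). The first and fourth say that on p = w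
  q, for a = \<alpha>, the determinant as a function of b / w is stationary at \<beta>, with value
  0. The fifth is a monic cubic for 35 \<alpha>.\<close>

lemma octic_relations:
  fixes R :: real
  assumes R: "R ^ 3 - 7 * R\<^sup>2 - 21 * R + 91 = 0"
  defines "\<alpha> \<equiv> octic_alpha R" and "\<beta> \<equiv> octic_beta R"
  shows "14 * (3 * R - 7) * \<beta> = R + 3"
    and "15 * \<alpha> - 84 * R * \<beta>\<^sup>2 = - \<beta> * (6 * R + 6)"
    and "1 + 784 * R * \<beta>\<^sup>2 - 30 * \<alpha> - 175 * \<alpha>\<^sup>2 = 8 * R * (R - 3) * \<beta>"
    and "- 112 * R * (3 * R - 7) * \<beta>\<^sup>2 + 16 * R * (R + 3) * \<beta> + (60 * R - 30) * \<alpha> + 1 - 175 * \<alpha>\<^sup>2 = 0"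
    and "(35 * \<alpha>) ^ 3 - 33 * (35 * \<alpha>)\<^sup>2 - 85 * (35 * \<alpha>) + 13 = 0"
proof -
  let ?C = "R ^ 3 - 7 * R\<^sup>2 - 21 * R + 91"
  have "14 * (3 * R - 7) * \<beta> - (R + 3) = ?C * (- 9 / 28)"
    by (simp add: \<beta>_def octic_beta_def field_simps power2_eq_square power3_eq_cube)
  then show "14 * (3 * R - 7) * \<beta> = R + 3" using R by simp
  have "15 * \<alpha> - 84 * R * \<beta>\<^sup>2 - - \<beta> * (6 * R + 6) = ?C * (33 / 196 + 9 / 784 * R - 27 / 5488 * R\<^sup>2)"
    by (simp add: \<alpha>_def \<beta>_def octic_alpha_def octic_beta_def field_simps power2_eq_square power3_eq_cube)
  then show "15 * \<alpha> - 84 * R * \<beta>\<^sup>2 = - \<beta> * (6 * R + 6)" using R by simp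
  have "1 + 784 * R * \<beta>\<^sup>2 - 30 * \<alpha> - 175 * \<alpha>\<^sup>2 - 8 * R * (R - 3) * \<beta> = ?C * (- 93 / 49 - 37 / 196 * R + 9 / 196 * R\<^sup>2)"
    by (simp add: \<alpha>_def \<beta>_def octic_alpha_def octic_beta_def field_simps power2_eq_square power3_eq_cube)
  then show "1 + 784 * R * \<beta>\<^sup>2 - 30 * \<alpha> - 175 * \<alpha>\<^sup>2 = 8 * R * (R - 3) * \<beta>" using R by simp
  have "- 112 * R * (3 * R - 7) * \<beta>\<^sup>2 + 16 * R * (R + 3) * \<beta> + (60 * R - 30) * \<alpha> + 1 - 175 * \<alpha>\<^sup>2 =
      ?C * (- 93 / 49 + 95 / 196 * R + 9 / 98 * R\<^sup>2 - 27 / 1372 * R ^ 3)"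
    by (simp add: \<alpha>_def \<beta>_def octic_alpha_def octic_beta_def field_simps power2_eq_square power3_eq_cube)
  then show "- 112 * R * (3 * R - 7) * \<beta>\<^sup>2 + 16 * R * (R + 3) * \<beta> + (60 * R - 30) * \<alpha> + 1 - 175 * \<alpha>\<^sup>2 = 0" using R by simp
  have "(35 * \<alpha>) ^ 3 - 33 * (35 * \<alpha>)\<^sup>2 - 85 * (35 * \<alpha>) + 13 = ?C * (- 41 + 29 * R + 5 * R\<^sup>2 - R ^ 3)"
    by (simp add: \<alpha>_def octic_alpha_def field_simps power2_eq_square power3_eq_cube)
  then show "(35 * \<alpha>) ^ 3 - 33 * (35 * \<alpha>)\<^sup>2 - 85 * (35 * \<alpha>) + 13 = 0" using R by simp
qed

lemma octic_alpha_beta_pos: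
  assumes "278 / 100 \<le> R" "R \<le> 2781 / 1000"
  shows "octic_alpha R > 1" "octic_beta R > 0"
proof -
  have "R\<^sup>2 \<le> (2781 / 1000)\<^sup>2" using assms by (intro power_mono) auto
  then have "R\<^sup>2 \<le> 7734 / 1000" by (simp add: power2_eq_square)
  then show "octic_alpha R > 1" "octic_beta R > 0"
    using assms by (simp_all add: octic_alpha_def octic_beta_def)
qed

text \<open>The Hessian is tested only where the extremal form degenerates. There its determinant
  is, up to a positive factor, a negative multiple of a square in b / w minus a term that is
  positive once \<open>a 4\<close> exceeds \<alpha>, whatever the value of b.\<close>

lemma normalized_middle_coeff_octic_le:
  assumes R: "278 / 100 \<le> R" "R \<le> 2781 / 1000" "R ^ 3 - 7 * R\<^sup>2 - 21 * R + 91 = 0"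
    and a: "a \<in> normalized_convex_seqs 8"
  shows "a 4 \<le> octic_alpha R"
proof (rule ccontr)
  define \<alpha> \<beta> where "\<alpha> = octic_alpha R" and "\<beta> = octic_beta R"
  note rel = octic_relations[OF R(3), folded \<alpha>_def \<beta>_def]
  assume "\<not> a 4 \<le> octic_alpha R"
  then have gt: "a 4 > \<alpha>" by (simp add: \<alpha>_def)
  define b A where "b = (a 2 + a 6) / 2" and "A = a 4"
  have conv: "umbral a ([:s, t:] ^ 6 * [:u, v:] ^ 2) \<ge> 0" for s t u v
    using a by (simp add: normalized_convex_seqs_def convex_seq_def)
  have ends: "a 0 = 1" "a 8 = 1" using a by (auto simp: normalized_convex_seqs_def)
  have a6: "a 6 = 2 * b - a 2" by (simp add: b_def field_simps)
  \<comment> \<open>Summing over a sign change and an exchange of the variables removes the odd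
    moments and averages \<open>a 2\<close> with \<open>a 6\<close>, while \<open>a 4\<close>
    stays.\<close>
  have quad: "x\<^sup>2 * (1 + 15 * b * t\<^sup>2 + 15 * A * t ^ 4 + b * t ^ 6) + 2 * x * y * (6 * b * t + 20 * A * t ^ 3 + 6 * b * t ^ 5)
      + y\<^sup>2 * (b + 15 * A * t\<^sup>2 + 15 * b * t ^ 4 + t ^ 6) \<ge> 0" (is "?Q \<ge> 0") for x y t
  proof -
    have "umbral a ([:1, t:] ^ 6 * [:x, y:] ^ 2) + umbral a ([:1, - t:] ^ 6 * [:x, - y:] ^ 2) +
        umbral a ([:t, 1:] ^ 6 * [:y, x:] ^ 2) + umbral a ([:- t, 1:] ^ 6 * [:- y, x:] ^ 2) = 4 * ?Q"
      unfolding umbral_hessian_6 ends a6 A_def[symmetric] power_one mult_1_left mult_1_right by Groebner_Basis.algebra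
    moreover have "0 \<le> umbral a ([:1, t:] ^ 6 * [:x, y:] ^ 2) + umbral a ([:1, - t:] ^ 6 * [:x, - y:] ^ 2) +
        umbral a ([:t, 1:] ^ 6 * [:y, x:] ^ 2) + umbral a ([:- t, 1:] ^ 6 * [:- y, x:] ^ 2)"
      by (intro add_nonneg_nonneg conv)
    ultimately have "0 \<le> 4 * ?Q" by (simp only:)
    moreover have "0 \<le> q" if "0 \<le> 4 * q" for q :: real using that by simp
    ultimately show ?thesis by blast
  qed
  define w where "w = 2 * sqrt R"
  have w2: "w\<^sup>2 = 4 * R" using R by (simp add: w_def power_mult_distrib)
  have w: "w > 0" using R by (simp add: w_def)
  \<comment> \<open>A root of u^2 - w u + 1, real because w \<ge> 2. With S = 1 and T = u it gives
    S^2 + T^2 = w S T, the degenerate point.\<close>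
  define u where "u = (w + sqrt (w\<^sup>2 - 4)) / 2"
  have "(sqrt (w\<^sup>2 - 4))\<^sup>2 = w\<^sup>2 - 4" using R w2 by simp
  then have u: "1 + u\<^sup>2 = w * u" by (simp add: u_def field_simps power2_eq_square)
  have u_pos: "u > 0" using w w2 R by (simp add: u_def add_pos_nonneg)
  define t where "t = sqrt u"
  have t: "t\<^sup>2 = u" using u_pos by (simp add: t_def)
  have "(6 * b * t + 20 * A * t ^ 3 + 6 * b * t ^ 5)\<^sup>2 \<le>
      (1 + 15 * b * t\<^sup>2 + 15 * A * t ^ 4 + b * t ^ 6) * (b + 15 * A * t\<^sup>2 + 15 * b * t ^ 4 + t ^ 6)"
    by (rule quadratic_form_nonneg_det) (rule quad)
  also have "(6 * b * t + 20 * A * t ^ 3 + 6 * b * t ^ 5)\<^sup>2 = 1 * u * (6 * b * 1\<^sup>2 + 20 * A * 1 * u + 6 * b * u\<^sup>2)\<^sup>2"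
    unfolding t[symmetric] power_one mult_1_left mult_1_right by Groebner_Basis.algebra
  also have "(1 + 15 * b * t\<^sup>2 + 15 * A * t ^ 4 + b * t ^ 6) * (b + 15 * A * t\<^sup>2 + 15 * b * t ^ 4 + t ^ 6) =
     (1 ^ 3 + 15 * b * 1\<^sup>2 * u + 15 * A * 1 * u\<^sup>2 + b * u ^ 3) * (b * 1 ^ 3 + 15 * A * 1\<^sup>2 * u + 15 * b * 1 * u\<^sup>2 + u ^ 3)"
    unfolding t[symmetric] power_one mult_1_left mult_1_right by Groebner_Basis.algebra
  finally have "0 \<le> b * (1\<^sup>2 + u\<^sup>2) ^ 3 + (15 * A - 21 * b\<^sup>2) * (1\<^sup>2 + u\<^sup>2)\<^sup>2 * (1 * u) + 12 * b * (1\<^sup>2 + u\<^sup>2) * (1 * u)\<^sup>2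
      + (1 + 196 * b\<^sup>2 - 30 * A - 175 * A\<^sup>2) * (1 * u) ^ 3"
    unfolding octic_hessian_det[symmetric] by linarith
  also have "\<dots> = u ^ 3 * (b * w ^ 3 + (15 * A - 21 * b\<^sup>2) * w\<^sup>2 + 12 * b * w + 1 + 196 * b\<^sup>2 - 30 * A - 175 * A\<^sup>2)"
    unfolding power_one u mult_1_left mult_1_right by Groebner_Basis.algebra
  finally have E: "0 \<le> b * w ^ 3 + (15 * A - 21 * b\<^sup>2) * w\<^sup>2 + 12 * b * w + 1 + 196 * b\<^sup>2 - 30 * A - 175 * A\<^sup>2"
    using u_pos by (simp add: zero_le_mult_iff)
  \<comment> \<open>In this variable the first relation completes the square about \<beta>, and the
    fourth removes the constant.\<close>
  define y where "y = b / w"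
  have b: "b = w * y" using w by (simp add: y_def)
  have "b * w ^ 3 + (15 * A - 21 * b\<^sup>2) * w\<^sup>2 + 12 * b * w + 1 + 196 * b\<^sup>2 - 30 * A - 175 * A\<^sup>2 =
      - (112 * R * (3 * R - 7) * (y - \<beta>)\<^sup>2) - (A - \<alpha>) * (175 * (A + \<alpha>) - (60 * R - 30))"
    using w2 b rel(1,4) by Groebner_Basis.algebra
  moreover have "112 * R * (3 * R - 7) * (y - \<beta>)\<^sup>2 \<ge> 0" using R by (intro mult_nonneg_nonneg) auto
  moreover have "(A - \<alpha>) * (175 * (A + \<alpha>) - (60 * R - 30)) > 0"
    using gt octic_alpha_beta_pos(1)[OF R(1,2)] R by (intro mult_pos_pos) (auto simp: A_def \<alpha>_def)
  ultimately show False using E by linarith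
qed

text \<open>By the second and third relations the determinant is a square times a linear factor, and
  the diagonal entries have nonnegative coefficients in S and T.\<close>

lemma normalized_octic_attained:
  assumes R: "278 / 100 \<le> R" "R \<le> 2781 / 1000" "R ^ 3 - 7 * R\<^sup>2 - 21 * R + 91 = 0"
  obtains a where "a \<in> normalized_convex_seqs 8" "a 4 = octic_alpha R"
proof -
  define \<alpha> \<beta> where "\<alpha> = octic_alpha R" and "\<beta> = octic_beta R"
  note rel = octic_relations[OF R(3), folded \<alpha>_def \<beta>_def]
  have pos: "\<alpha> > 0" "\<beta> > 0" using octic_alpha_beta_pos[OF R(1,2)] by (auto simp: \<alpha>_def \<beta>_def)
  define w where "w = 2 * sqrt R"
  have w2: "w\<^sup>2 = 4 * R" using R by (simp add: w_def power_mult_distrib)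
  have w: "w \<ge> 2" using R by (simp add: w_def)
  define b where "b = w * \<beta>"
  have b: "b > 0" using w pos by (simp add: b_def)
  define a where "a j = (if j = 0 \<or> j = 8 then 1 else if j = 2 \<or> j = 6 then b else if j = 4 then \<alpha> else 0)" for j :: nat
  have a_vals: "a 0 = 1" "a 1 = 0" "a 2 = b" "a 3 = 0" "a 4 = \<alpha>" "a 5 = 0" "a 6 = b" "a 7 = 0" "a 8 = 1"
    by (simp_all add: a_def)
  have "umbral a ([:s, t:] ^ 6 * [:u, v:] ^ 2) \<ge> 0" for s t u v
  proof -
    define S T where "S = s\<^sup>2" and "T = t\<^sup>2"
    let ?H0 = "S ^ 3 + 15 * b * S\<^sup>2 * T + 15 * \<alpha> * S * T\<^sup>2 + b * T ^ 3"
    let ?H1 = "s * t * (6 * b * S\<^sup>2 + 20 * \<alpha> * S * T + 6 * b * T\<^sup>2)"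
    let ?H2 = "b * S ^ 3 + 15 * \<alpha> * S\<^sup>2 * T + 15 * b * S * T\<^sup>2 + T ^ 3"
    have ST: "S \<ge> 0" "T \<ge> 0" by (simp_all add: S_def T_def)
    have "?H1\<^sup>2 = S * T * (6 * b * S\<^sup>2 + 20 * \<alpha> * S * T + 6 * b * T\<^sup>2)\<^sup>2"
      by (simp add: power_mult_distrib S_def T_def)
    then have "?H0 * ?H2 - ?H1\<^sup>2 = b * (S\<^sup>2 + T\<^sup>2) ^ 3 + (15 * \<alpha> - 21 * b\<^sup>2) * (S\<^sup>2 + T\<^sup>2)\<^sup>2 * (S * T) + 12 * b * (S\<^sup>2 + T\<^sup>2) * (S * T)\<^sup>2
      + (1 + 196 * b\<^sup>2 - 30 * \<alpha> - 175 * \<alpha>\<^sup>2) * (S * T) ^ 3"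
      using octic_hessian_det[of S b T \<alpha>] by linarith
    also have "\<dots> = ((S\<^sup>2 + T\<^sup>2) - w * (S * T))\<^sup>2 * (\<beta> * (w * (S\<^sup>2 + T\<^sup>2) + (2 * R - 6) * (S * T)))"
    proof -
      have b2: "b\<^sup>2 = 4 * R * \<beta>\<^sup>2" by (simp add: b_def power_mult_distrib w2)
      have c1: "15 * \<alpha> - 21 * b\<^sup>2 = - \<beta> * (6 * R + 6)" using rel(2) unfolding b2 by simp
      have c2: "1 + 196 * b\<^sup>2 - 30 * \<alpha> - 175 * \<alpha>\<^sup>2 = 8 * R * (R - 3) * \<beta>" using rel(3) unfolding b2 by simp
      have "w * \<beta> * p ^ 3 + (- \<beta> * (6 * R + 6)) * p\<^sup>2 * q + 12 * (w * \<beta>) * p * q\<^sup>2 + 8 * R * (R - 3) * \<beta> * q ^ 3 =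
          (p - w * q)\<^sup>2 * (\<beta> * (w * p + (2 * R - 6) * q))" for p q
        using w2 by Groebner_Basis.algebra
      then show ?thesis unfolding c1 c2 by (simp only: b_def)
    qed
    also have "\<dots> \<ge> 0"
    proof (intro mult_nonneg_nonneg)
      have "S\<^sup>2 + T\<^sup>2 \<ge> 2 * (S * T)" using zero_le_power2[of "S - T"] by (simp add: power2_eq_square algebra_simps)
      then have "w * (S\<^sup>2 + T\<^sup>2) \<ge> w * (2 * (S * T))" using w by (intro mult_left_mono) auto
      \<comment> \<open>The coefficient 2 R - 6 is negative, since R < 3; the term 2 w gained from
        S^2 + T^2 \<ge> 2 S T outweighs it.\<close>
      moreover have "(2 * w + (2 * R - 6)) * (S * T) \<ge> 0" using w R ST by (intro mult_nonneg_nonneg) auto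
      ultimately show "0 \<le> w * (S\<^sup>2 + T\<^sup>2) + (2 * R - 6) * (S * T)" by (simp add: algebra_simps)
    qed (use pos in auto)
    finally have "?H1\<^sup>2 \<le> ?H0 * ?H2" by simp
    moreover have "?H0 \<ge> 0" "?H2 \<ge> 0" using b pos ST by (auto intro!: add_nonneg_nonneg mult_nonneg_nonneg)
    ultimately have "u\<^sup>2 * ?H0 + 2 * u * v * ?H1 + v\<^sup>2 * ?H2 \<ge> 0" by (intro quadratic_form_nonneg)
    moreover have "umbral a ([:s, t:] ^ 6 * [:u, v:] ^ 2) = u\<^sup>2 * ?H0 + 2 * u * v * ?H1 + v\<^sup>2 * ?H2"
      unfolding umbral_hessian_6 a_vals S_def T_def by Groebner_Basis.algebra
    ultimately show ?thesis by simp
  qed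
  then have "a \<in> normalized_convex_seqs 8" by (simp add: normalized_convex_seqs_def convex_seq_def a_vals)
  then show ?thesis using that[of a] by (simp add: a_vals \<alpha>_def)
qed

subsection \<open>Degree of the optimal value for octics\<close>

text \<open>The cubic is monic, so a rational root is an integer dividing 13, which leaves finitely
  many candidates.\<close>

lemma octic_cubic_no_rational_root:
  fixes r :: rat
  assumes "r ^ 3 - 33 * r\<^sup>2 - 85 * r + 13 = 0"
  shows False
proof -
  obtain m n where mn: "quotient_of r = (m, n)" by force
  have n: "n > 0" and cop: "coprime m n" and r: "r = of_int m / of_int n"
    using quotient_of_denom_pos[OF mn] quotient_of_coprime[OF mn] quotient_of_div[OF mn] by auto
  have m: "of_int m = r * of_int n" using r n by simp
  have "of_int (m ^ 3 - 33 * m\<^sup>2 * n - 85 * m * n\<^sup>2 + 13 * n ^ 3) =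
      of_int n ^ 3 * (r ^ 3 - 33 * r\<^sup>2 - 85 * r + 13)"
    unfolding of_int_add of_int_diff of_int_mult of_int_power of_int_numeral m by Groebner_Basis.algebra
  then have "of_int (m ^ 3 - 33 * m\<^sup>2 * n - 85 * m * n\<^sup>2 + 13 * n ^ 3) = (0::rat)"
    unfolding assms by simp
  then have eq: "m ^ 3 - 33 * m\<^sup>2 * n - 85 * m * n\<^sup>2 + 13 * n ^ 3 = 0" by (simp only: of_int_eq_0_iff)
  then have "m ^ 3 = n * (33 * m\<^sup>2 + 85 * m * n - 13 * n\<^sup>2)" by Groebner_Basis.algebra
  then have "n dvd m ^ 3" by simp
  moreover have "coprime (m ^ 3) n" using cop by simp
  ultimately have "n dvd 1" using coprime_common_divisor[of "m ^ 3" n n] by simp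
  then have "n = 1" using n by simp
  with eq have eq1: "m ^ 3 - 33 * m\<^sup>2 - 85 * m + 13 = 0" by simp
  then have "13 = m * (85 + 33 * m - m\<^sup>2)" by Groebner_Basis.algebra
  then have "m dvd 13" by (rule dvdI)
  then have "\<bar>m\<bar> \<le> 13" using zdvd_imp_le[of "\<bar>m\<bar>" 13] by simp
  then have "m = - 13 \<or> m = - 12 \<or> m = - 11 \<or> m = - 10 \<or> m = - 9 \<or> m = - 8 \<or> m = - 7 \<or> m = - 6 \<or> m = - 5 \<or> m = - 4
    \<or> m = - 3 \<or> m = - 2 \<or> m = - 1 \<or> m = 0 \<or> m = 1 \<or> m = 2 \<or> m = 3 \<or> m = 4 \<or> m = 5 \<or> m = 6 \<or> m = 7 \<or> m = 8
    \<or> m = 9 \<or> m = 10 \<or> m = 11 \<or> m = 12 \<or> m = 13" by arith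
  then show False using eq1 by (elim disjE) simp_all
qed

text \<open>A quadratic relation \<open>x\<^sup>2 = r x + s\<close> splits off from the cubic the rational root \<open>33 - r\<close>.\<close>

lemma octic_cubic_minimal:
  fixes x :: real and c0 c1 c2 :: rat
  assumes x: "x ^ 3 - 33 * x\<^sup>2 - 85 * x + 13 = 0" and rel: "of_rat c0 + of_rat c1 * x + of_rat c2 * x\<^sup>2 = 0"
  shows "c0 = 0 \<and> c1 = 0 \<and> c2 = 0"
proof -
  have irrational: "x \<noteq> of_rat r" for r
  proof
    assume "x = of_rat r"
    then have "of_rat (r ^ 3 - 33 * r\<^sup>2 - 85 * r + 13) = (0::real)" using x
      by (simp add: of_rat_add of_rat_diff of_rat_mult of_rat_power)
    then show False using octic_cubic_no_rational_root by simp
  qed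
  have linear: "p = 0 \<and> q = 0" if "of_rat p * x + of_rat q = (0::real)" for p q
  proof (cases "p = 0")
    case True
    then show ?thesis using that by simp
  next
    case False
    then have "x = of_rat (- q / p)" using that by (simp add: of_rat_divide of_rat_minus field_simps)
    then show ?thesis using irrational by blast
  qed
  show ?thesis
  proof (cases "c2 = 0")
    case True
    then show ?thesis using rel linear[of c1 c0] by (simp add: add.commute)
  next
    case False
    define r s where "r = - c1 / c2" and "s = - c0 / c2"
    have x2: "x\<^sup>2 = of_rat r * x + of_rat s"
      using False rel by (simp add: r_def s_def of_rat_divide of_rat_minus field_simps)
    \<comment> \<open>This is the remainder of the cubic modulo X^2 - r X - s; irrationality of x
      makes both of its coefficients vanish.\<close>
    have "of_rat (r * r + s - 33 * r - 85) * x + of_rat (r * s - 33 * s + 13) = (0::real)"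
      unfolding of_rat_add of_rat_diff of_rat_mult of_rat_numeral_eq using x x2 by Groebner_Basis.algebra
    from linear[OF this] have "r * r + s - 33 * r - 85 = 0" "r * s - 33 * s + 13 = 0" by auto
    then have "(33 - r) ^ 3 - 33 * (33 - r)\<^sup>2 - 85 * (33 - r) + 13 = 0" by Groebner_Basis.algebra
    then show ?thesis using octic_cubic_no_rational_root by blast
  qed
qed

lemma
  assumes "(35 * y) ^ 3 - 33 * (35 * y)\<^sup>2 - 85 * (35 * y) + 13 = (0::real)"
  shows algebraic_octic: "algebraic y" and algebraic_degree_octic: "algebraic_degree y = 3"
proof -
  have root: "13 - 2975 * y - 40425 * y\<^sup>2 + 42875 * y ^ 3 = 0" using assms by Groebner_Basis.algebra
  show "algebraic y"
  proof (rule algebraicI[of "[:13, - 2975, - 40425, 42875:]"])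
    show "coeff [:13, - 2975, - 40425, 42875:] i \<in> (\<int> :: real set)" for i
      by (auto simp: coeff_pCons split: nat.splits)
    show "poly [:13, - 2975, - 40425, 42875:] y = 0"
      using root by (simp add: power2_eq_square power3_eq_cube algebra_simps)
  qed simp
  show "algebraic_degree y = 3"
    unfolding algebraic_degree_def
  proof (rule Least_equality)
    show "\<exists>q::rat poly. q \<noteq> 0 \<and> degree q = 3 \<and> poly (map_poly of_rat q) y = 0"
    proof (intro exI conjI)
      show "poly (map_poly of_rat [:13, - 2975, - 40425, 42875 :: rat:]) y = 0"
        using root by (simp add: map_poly_pCons of_rat_minus power2_eq_square power3_eq_cube algebra_simps)
    qed auto
  next
    fix k assume "\<exists>q::rat poly. q \<noteq> 0 \<and> degree q = k \<and> poly (map_poly of_rat q) y = 0"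
    then obtain q :: "rat poly" where q: "q \<noteq> 0" "degree q = k" "poly (map_poly of_rat q) y = 0" by blast
    show "3 \<le> k"
    proof (rule ccontr)
      assume "\<not> 3 \<le> k"
      then have deg: "degree q \<le> 2" using q(2) by simp
      define c where "c i = coeff q i" for i
      have q_eq: "q = [:c 0, c 1, c 2:]"
        using deg by (intro poly_eqI) (auto simp: c_def coeff_pCons numeral_2_eq_2 coeff_eq_0 split: nat.splits)
      have "of_rat (c 0) + of_rat (c 1) * y + of_rat (c 2) * y\<^sup>2 = 0"
        using q(3) unfolding q_eq by (simp add: map_poly_pCons power2_eq_square algebra_simps)
      \<comment> \<open>The coefficients are rescaled by powers of 35 to obtain a relation for the
        root 35 y of the monic cubic.\<close>
      then have "of_rat (c 0) + of_rat (c 1 / 35) * (35 * y) + of_rat (c 2 / 35 / 35) * (35 * y)\<^sup>2 = (0::real)"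
        by (simp add: of_rat_divide power2_eq_square)
      from octic_cubic_minimal[OF assms this] have "q = 0" using q_eq by simp
      then show False using q(1) by simp
    qed
  qed
qed

lemma normalized_Sup_octic:
  obtains R :: real where "(35 * octic_alpha R) ^ 3 - 33 * (35 * octic_alpha R)\<^sup>2 - 85 * (35 * octic_alpha R) + 13 = 0"
    "Sup ((\<lambda>a. a 4) ` normalized_convex_seqs 8) = octic_alpha R"
proof -
  obtain R :: real where R: "278 / 100 \<le> R" "R \<le> 2781 / 1000" "R ^ 3 - 7 * R\<^sup>2 - 21 * R + 91 = 0"
    using octic_root_exists by blast
  have "Sup ((\<lambda>a. a 4) ` normalized_convex_seqs 8) = octic_alpha R"
  proof (rule cSup_eq_maximum)
    show "octic_alpha R \<in> (\<lambda>a. a 4) ` normalized_convex_seqs 8"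
      using normalized_octic_attained[OF R] by (metis imageI)
  qed (use normalized_middle_coeff_octic_le[OF R] in auto)
  then show ?thesis using that octic_relations(5)[OF R(3)] by blast
qed

section \<open>The semidefinite program\<close>

text \<open>The Hessian entry depends only on \<alpha> + \<beta>, so three polynomials describe the
  matrix, and setting s = 1 leaves one variable.\<close>

lemma hessian_entry_psd2:
  assumes "convex_seq (2 * d) a" "d \<ge> 1"
  defines "H \<equiv> \<lambda>i. \<Sum>k\<le>2 * d - 2. monom (real (2 * d - 2 choose k) * a (k + i)) k"
  shows "psd2 (H 0) (H 1) (H 2)"
proof (rule psd2I)
  fix t x y
  have "x\<^sup>2 * poly (H 0) t + 2 * x * y * poly (H 1) t + y\<^sup>2 * poly (H 2) t =
      umbral a ([:1, t:] ^ (2 * d - 2) * [:x, y:] ^ 2)"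
    unfolding umbral_hessian H_def poly_sum poly_monom
    by (simp add: sum_distrib_left sum.distrib[symmetric] algebra_simps)
  then show "0 \<le> x\<^sup>2 * poly (H 0) t + 2 * x * y * poly (H 1) t + y\<^sup>2 * poly (H 2) t"
    using assms(1) by (simp add: convex_seq_def)
qed

lemma sum_antidiagonal:
  fixes f :: "nat \<Rightarrow> nat \<Rightarrow> 'a::comm_monoid_add"
  assumes "d \<ge> 1"
  shows "(\<Sum>i<d. \<Sum>j<d. f i j) = (\<Sum>k\<le>2 * d - 2. \<Sum>(i, j) | i < d \<and> j < d \<and> i + j = k. f i j)"
proof -
  have "(\<Sum>i<d. \<Sum>j<d. f i j) = (\<Sum>(i, j)\<in>{..<d} \<times> {..<d}. f i j)" by (rule sum.cartesian_product)
  also have "\<dots> = (\<Sum>k\<le>2 * d - 2. \<Sum>(i, j)\<in>{x \<in> {..<d} \<times> {..<d}. fst x + snd x = k}. f i j)"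
    by (rule sum.group[symmetric]) auto
  also have "\<dots> = (\<Sum>k\<le>2 * d - 2. \<Sum>(i, j) | i < d \<and> j < d \<and> i + j = k. f i j)"
    by (intro sum.cong) auto
  finally show ?thesis .
qed

lemma coeff_mult_antidiagonal:
  fixes f g :: "'a::comm_ring_1 poly"
  assumes "degree f < d" "degree g < d"
  shows "coeff (f * g) k = (\<Sum>(i, j) | i < d \<and> j < d \<and> i + j = k. coeff f i * coeff g j)"
proof -
  have "coeff (f * g) k = (\<Sum>i\<le>k. coeff f i * coeff g (k - i))" by (rule coeff_mult)
  also have "\<dots> = (\<Sum>(i, j)\<in>(\<lambda>i. (i, k - i)) ` {..k}. coeff f i * coeff g j)"
    by (subst sum.reindex) (auto simp: inj_on_def)
  also have "(\<lambda>i. (i, k - i)) ` {..k} = {(i, j). i + j = k}" by (auto simp: image_iff)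
  also have "(\<Sum>(i, j)\<in>{(i, j). i + j = k}. coeff f i * coeff g j) =
      (\<Sum>(i, j) | i < d \<and> j < d \<and> i + j = k. coeff f i * coeff g j)"
  proof (rule sum.mono_neutral_right)
    have "{(i, j). i + j = k} \<subseteq> {..k} \<times> {..k}" by auto
    then show "finite {(i, j). i + j = k}" by (rule finite_subset) auto
    show "\<forall>x\<in>{(i, j). i + j = k} - {(i, j). i < d \<and> j < d \<and> i + j = k}. (case x of (i, j) \<Rightarrow> coeff f i * coeff g j) = 0"
    proof
      fix x assume "x \<in> {(i, j). i + j = k} - {(i, j). i < d \<and> j < d \<and> i + j = k}"
      moreover obtain i j where x: "x = (i, j)" by force
      ultimately have "d \<le> i \<or> d \<le> j" by auto
      then have "coeff f i = 0 \<or> coeff g j = 0"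
        using assms by (meson coeff_eq_0 less_le_trans)
      then show "(case x of (i, j) \<Rightarrow> coeff f i * coeff g j) = 0" by (auto simp: x)
    qed
  qed auto
  finally show ?thesis .
qed

lemma finite_vars_A_sdp: "finite (vars (A_sdp d))"
  by (simp add: A_sdp_def)

lemma sum_vars_A_sdp:
  fixes f :: "sdp_var \<Rightarrow> 'a::comm_monoid_add"
  shows "(\<Sum>v\<in>vars (A_sdp d). f v) = (\<Sum>l\<le>2 * d. f (Coef l)) + (\<Sum>r<2 * d. \<Sum>s<2 * d. f (Gram r s))"
proof -
  have "(\<Sum>v\<in>vars (A_sdp d). f v) = (\<Sum>v\<in>Coef ` {..2 * d}. f v) + (\<Sum>v\<in>(\<lambda>(r, s). Gram r s) ` ({..<2 * d} \<times> {..<2 * d}). f v)"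
    unfolding A_sdp_def by (simp, rule sum.union_disjoint) auto
  also have "(\<Sum>v\<in>Coef ` {..2 * d}. f v) = (\<Sum>l\<le>2 * d. f (Coef l))"
    by (subst sum.reindex) (auto simp: inj_on_def)
  also have "(\<Sum>v\<in>(\<lambda>(r, s). Gram r s) ` ({..<2 * d} \<times> {..<2 * d}). f v) = (\<Sum>(r, s)\<in>{..<2 * d} \<times> {..<2 * d}. f (Gram r s))"
    by (subst sum.reindex) (auto simp: inj_on_def case_prod_beta)
  also have "\<dots> = (\<Sum>r<2 * d. \<Sum>s<2 * d. f (Gram r s))" by (rule sum.cartesian_product[symmetric])
  finally show ?thesis .
qed

lemma sum_vars_A_sdp_Coef:
  fixes x :: "sdp_var \<Rightarrow> real"
  assumes "l \<le> 2 * d"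
  shows "(\<Sum>v\<in>vars (A_sdp d). of_bool (v = Coef l) * x v) = x (Coef l)"
proof -
  have "(\<Sum>l'\<le>2 * d. of_bool (Coef l' = Coef l) * x (Coef l')) = (\<Sum>l'\<le>2 * d. if l' = l then x (Coef l') else 0)"
    by (intro sum.cong) auto
  also have "\<dots> = x (Coef l)" using assms by simp
  finally show ?thesis unfolding sum_vars_A_sdp by simp
qed

lemma sum_gram_index:
  fixes f :: "nat \<Rightarrow> 'a::comm_monoid_add"
  shows "(\<Sum>r<2 * d. f r) = (\<Sum>\<alpha><2. \<Sum>i<d. f (\<alpha> * d + i))"
proof -
  have "(\<Sum>r<2 * d. f r) = (\<Sum>r<d. f r) + (\<Sum>r = d..<d + d. f r)"
    unfolding mult_2 lessThan_atLeast0 by (rule sum.atLeastLessThan_concat[symmetric]) auto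
  also have "(\<Sum>r = d..<d + d. f r) = (\<Sum>i<d. f (d + i))"
    using sum.shift_bounds_nat_ivl[of f 0 d d] by (simp add: lessThan_atLeast0 add.commute)
  finally show ?thesis by (simp add: numeral_2_eq_2)
qed

lemma sdp_equation_hessian:
  assumes "d \<ge> 1" "\<alpha> < 2" "\<beta> < 2" "k \<le> 2 * d - 2"
  shows "(\<Sum>v\<in>vars (A_sdp d). hessian_eq d \<alpha> \<beta> k v * x v) =
    (\<Sum>(i, j) | i < d \<and> j < d \<and> i + j = k. x (Gram (\<alpha> * d + i) (\<beta> * d + j)))
      - real (2 * d - 2 choose k) * x (Coef (k + \<alpha> + \<beta>))"
proof -
  have mem: "k + \<alpha> + \<beta> \<le> 2 * d" using assms by simp
  have "(\<Sum>l\<le>2 * d. hessian_eq d \<alpha> \<beta> k (Coef l) * x (Coef l)) =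
      (\<Sum>l\<le>2 * d. if l = k + \<alpha> + \<beta> then - real (2 * d - 2 choose k) * x (Coef l) else 0)"
    by (intro sum.cong) auto
  also have "\<dots> = - real (2 * d - 2 choose k) * x (Coef (k + \<alpha> + \<beta>))" using mem by simp
  finally have coef: "(\<Sum>l\<le>2 * d. hessian_eq d \<alpha> \<beta> k (Coef l) * x (Coef l)) = - real (2 * d - 2 choose k) * x (Coef (k + \<alpha> + \<beta>))" .
  have "(\<Sum>r<2 * d. \<Sum>s<2 * d. hessian_eq d \<alpha> \<beta> k (Gram r s) * x (Gram r s)) =
     (\<Sum>\<alpha>'<2. \<Sum>i<d. \<Sum>\<beta>'<2. \<Sum>j<d. if \<alpha>' = \<alpha> \<and> \<beta>' = \<beta> \<and> i + j = k then x (Gram (\<alpha> * d + i) (\<beta> * d + j)) else 0)"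
    unfolding sum_gram_index using assms(1) by (intro sum.cong refl) auto
  also have "\<dots> = (\<Sum>\<alpha>'<2. if \<alpha>' = \<alpha> then \<Sum>i<d. \<Sum>j<d. if i + j = k then x (Gram (\<alpha> * d + i) (\<beta> * d + j)) else 0 else 0)"
  proof (rule sum.cong[OF refl])
    fix \<alpha>'
    let ?S = "\<lambda>i. \<Sum>j<d. if i + j = k then x (Gram (\<alpha> * d + i) (\<beta> * d + j)) else 0"
    have "(\<Sum>j<d. if \<alpha>' = \<alpha> \<and> \<beta>' = \<beta> \<and> i + j = k then x (Gram (\<alpha> * d + i) (\<beta> * d + j)) else 0) =
        (if \<beta>' = \<beta> then if \<alpha>' = \<alpha> then ?S i else 0 else 0)" for \<beta>' i by (cases "\<alpha>' = \<alpha>"; cases "\<beta>' = \<beta>") simp_all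
    then show "(\<Sum>i<d. \<Sum>\<beta>'<2. \<Sum>j<d. if \<alpha>' = \<alpha> \<and> \<beta>' = \<beta> \<and> i + j = k then x (Gram (\<alpha> * d + i) (\<beta> * d + j)) else 0) =
        (if \<alpha>' = \<alpha> then \<Sum>i<d. ?S i else 0)"
      using assms(3) by (cases "\<alpha>' = \<alpha>") simp_all
  qed
  also have "\<dots> = (\<Sum>i<d. \<Sum>j<d. if i + j = k then x (Gram (\<alpha> * d + i) (\<beta> * d + j)) else 0)"
    using assms(2) by simp
  also have "\<dots> = (\<Sum>(i, j)\<in>{..<d} \<times> {..<d}. if i + j = k then x (Gram (\<alpha> * d + i) (\<beta> * d + j)) else 0)"
    by (rule sum.cartesian_product)
  also have "\<dots> = (\<Sum>(i, j) | i < d \<and> j < d \<and> i + j = k. x (Gram (\<alpha> * d + i) (\<beta> * d + j)))"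
    by (rule sum.mono_neutral_cong_right) (auto split: if_splits)
  finally show ?thesis unfolding sum_vars_A_sdp coef by simp
qed

lemma lmi_matrix_A_sdp:
  "lmi_matrix (A_sdp d) x = Matrix.mat (2 * d) (2 * d) (\<lambda>(i, j). x (Gram i j) + x (Gram j i))"
proof (rule eq_matI)
  fix i j assume "i < dim_row (Matrix.mat (2 * d) (2 * d) (\<lambda>(i, j). x (Gram i j) + x (Gram j i)))"
    "j < dim_col (Matrix.mat (2 * d) (2 * d) (\<lambda>(i, j). x (Gram i j) + x (Gram j i)))"
  then have ij: "i < 2 * d" "j < 2 * d" by auto
  have "(\<Sum>v\<in>vars (A_sdp d). x v * (gram_coeff d v $$ (i, j))) =
      (\<Sum>r<2 * d. \<Sum>s<2 * d. x (Gram r s) * (of_bool (i = r \<and> j = s) + of_bool (i = s \<and> j = r)))"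
    unfolding sum_vars_A_sdp using ij by simp
  also have "\<dots> = (\<Sum>r<2 * d. \<Sum>s<2 * d. (if r = i then if s = j then x (Gram r s) else 0 else 0) + (if s = i then if r = j then x (Gram r s) else 0 else 0))"
    by (intro sum.cong refl) (auto simp: of_bool_def)
  also have "\<dots> = (\<Sum>r<2 * d. if r = i then \<Sum>s<2 * d. if s = j then x (Gram r s) else 0 else 0) +
      (\<Sum>s<2 * d. if s = i then \<Sum>r<2 * d. if r = j then x (Gram r s) else 0 else 0)"
  proof -
    have "(\<Sum>r<2 * d. \<Sum>s<2 * d. if s = i then if r = j then x (Gram r s) else 0 else 0) =
       (\<Sum>s<2 * d. \<Sum>r<2 * d. if s = i then if r = j then x (Gram r s) else 0 else 0)" by (rule sum.swap)
    moreover have "(\<Sum>s<2 * d. if r = i then if s = j then x (Gram r s) else 0 else 0) =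
        (if r = i then \<Sum>s<2 * d. if s = j then x (Gram r s) else 0 else 0)" for r by simp
    moreover have "(\<Sum>r<2 * d. if s = i then if r = j then x (Gram r s) else 0 else 0) =
        (if s = i then \<Sum>r<2 * d. if r = j then x (Gram r s) else 0 else 0)" for s by simp
    ultimately show ?thesis by (simp only: sum.distrib)
  qed
  also have "\<dots> = x (Gram i j) + x (Gram j i)" using ij by simp
  finally show "lmi_matrix (A_sdp d) x $$ (i, j) = Matrix.mat (2 * d) (2 * d) (\<lambda>(i, j). x (Gram i j) + x (Gram j i)) $$ (i, j)"
    using ij by (simp add: lmi_matrix_def) (simp add: A_sdp_def)
qed (simp_all add: lmi_matrix_def A_sdp_def)

lemma sdp_feasible_A_sdp_iff:
  assumes d: "d \<ge> 1"
  shows "x \<in> sdp_feasible (A_sdp d) \<longleftrightarrow> x (Coef 0) = 1 \<and> x (Coef (2 * d)) = 1 \<and>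
    (\<forall>\<alpha><2. \<forall>\<beta><2. \<forall>k\<le>2 * d - 2. (\<Sum>(i, j) | i < d \<and> j < d \<and> i + j = k. x (Gram (\<alpha> * d + i) (\<beta> * d + j))) =
      real (2 * d - 2 choose k) * x (Coef (k + \<alpha> + \<beta>))) \<and>
    psd (Matrix.mat (2 * d) (2 * d) (\<lambda>(i, j). x (Gram i j) + x (Gram j i)))"
proof -
  note coef = sum_vars_A_sdp_Coef
  have eqs: "equations (A_sdp d) = {(\<lambda>v. of_bool (v = Coef 0), 1), (\<lambda>v. of_bool (v = Coef (2 * d)), 1)} \<union>
       {(hessian_eq d \<alpha> \<beta> k, 0) | \<alpha> \<beta> k. \<alpha> < 2 \<and> \<beta> < 2 \<and> k \<le> 2 * d - 2}" by (simp add: A_sdp_def)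
  have gen: "(\<forall>(a, b)\<in>{(f, c), (g, c')} \<union> {(h \<alpha> \<beta> k, e) |\<alpha> \<beta> k. \<alpha> < m \<and> \<beta> < m \<and> k \<le> N}. Q a = b) \<longleftrightarrow>
      Q f = c \<and> Q g = c' \<and> (\<forall>\<alpha><m. \<forall>\<beta><m. \<forall>k\<le>N. Q (h \<alpha> \<beta> k) = e)"
    for f g :: "sdp_var \<Rightarrow> real" and h :: "nat \<Rightarrow> nat \<Rightarrow> nat \<Rightarrow> sdp_var \<Rightarrow> real" and c c' e Q and m N :: nat
    by (simp only: ball_Un ball_simps case_prod_conv) (auto, blast)
  have "(\<forall>(a, b)\<in>equations (A_sdp d). (\<Sum>v\<in>vars (A_sdp d). a v * x v) = b) \<longleftrightarrow>
     (\<Sum>v\<in>vars (A_sdp d). of_bool (v = Coef 0) * x v) = 1 \<and> (\<Sum>v\<in>vars (A_sdp d). of_bool (v = Coef (2 * d)) * x v) = 1 \<and>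
     (\<forall>\<alpha><2. \<forall>\<beta><2. \<forall>k\<le>2 * d - 2. (\<Sum>v\<in>vars (A_sdp d). hessian_eq d \<alpha> \<beta> k v * x v) = 0)"
    unfolding eqs by (rule gen)
  also have "\<dots> \<longleftrightarrow> x (Coef 0) = 1 \<and> x (Coef (2 * d)) = 1 \<and>
    (\<forall>\<alpha><2. \<forall>\<beta><2. \<forall>k\<le>2 * d - 2. (\<Sum>(i, j) | i < d \<and> j < d \<and> i + j = k. x (Gram (\<alpha> * d + i) (\<beta> * d + j))) =
      real (2 * d - 2 choose k) * x (Coef (k + \<alpha> + \<beta>)))"
    using sdp_equation_hessian[OF d] by (simp add: coef)
  finally have eqv: "(\<forall>(a, b)\<in>equations (A_sdp d). (\<Sum>v\<in>vars (A_sdp d). a v * x v) = b) \<longleftrightarrow>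
     x (Coef 0) = 1 \<and> x (Coef (2 * d)) = 1 \<and>
    (\<forall>\<alpha><2. \<forall>\<beta><2. \<forall>k\<le>2 * d - 2. (\<Sum>(i, j) | i < d \<and> j < d \<and> i + j = k. x (Gram (\<alpha> * d + i) (\<beta> * d + j))) =
      real (2 * d - 2 choose k) * x (Coef (k + \<alpha> + \<beta>)))" .
  show ?thesis by (simp only: sdp_feasible_def mem_Collect_eq lmi_matrix_A_sdp eqv conj_assoc)
qed

text \<open>Evaluated at the vector of values of the Gram monomials, the Gram matrix reproduces the
  Hessian form; \<open>?M\<close> is twice its symmetric part.\<close>

lemma sdp_feasible_imp_normalized:
  assumes d: "d \<ge> 1" and x: "x \<in> sdp_feasible (A_sdp d)"
  shows "(\<lambda>j. x (Coef j)) \<in> normalized_convex_seqs (2 * d)"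
proof -
  let ?a = "\<lambda>j. x (Coef j)"
  let ?M = "Matrix.mat (2 * d) (2 * d) (\<lambda>(i, j). x (Gram i j) + x (Gram j i))"
  have eq: "(\<Sum>(i, j) | i < d \<and> j < d \<and> i + j = k. x (Gram (\<alpha> * d + i) (\<beta> * d + j))) =
      real (2 * d - 2 choose k) * ?a (k + \<alpha> + \<beta>)" if "\<alpha> < 2" "\<beta> < 2" "k \<le> 2 * d - 2" for \<alpha> \<beta> k
    using x that unfolding sdp_feasible_A_sdp_iff[OF d] by blast
  have psd: "psd ?M" and ends: "?a 0 = 1" "?a (2 * d) = 1" using x unfolding sdp_feasible_A_sdp_iff[OF d] by auto
  have "umbral ?a ([:s, t:] ^ (2 * d - 2) * [:u, v:] ^ 2) \<ge> 0" for s t u v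
  proof -
    define c where "c \<alpha> = (if \<alpha> = (0::nat) then u else v)" for \<alpha>
    define y where "y i = s ^ (d - 1 - i) * t ^ i" for i
    define w where "w = Matrix.vec (2 * d) (\<lambda>r. c (r div d) * y (r mod d))"
    let ?G = "\<lambda>r q. x (Gram r q)"
    \<comment> \<open>Since \<open>y i * y j\<close> depends only on i + j, nothing but the
      antidiagonal sums prescribed by the equations enters.\<close>
    have block: "(\<Sum>i<d. \<Sum>j<d. y i * y j * ?G (\<alpha> * d + i) (\<beta> * d + j)) =
       (\<Sum>k\<le>2 * d - 2. s ^ (2 * d - 2 - k) * t ^ k * (real (2 * d - 2 choose k) * ?a (k + \<alpha> + \<beta>)))"
      if "\<alpha> < 2" "\<beta> < 2" for \<alpha> \<beta>
      unfolding sum_antidiagonal[OF d]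
    proof (rule sum.cong[OF refl])
      fix k assume "k \<in> {..2 * d - 2}"
      then have k: "k \<le> 2 * d - 2" by simp
      have "(\<Sum>(i, j) | i < d \<and> j < d \<and> i + j = k. y i * y j * ?G (\<alpha> * d + i) (\<beta> * d + j)) =
          (\<Sum>(i, j) | i < d \<and> j < d \<and> i + j = k. s ^ (2 * d - 2 - k) * t ^ k * ?G (\<alpha> * d + i) (\<beta> * d + j))"
      proof (rule sum.cong[OF refl])
        fix p assume "p \<in> {(i, j). i < d \<and> j < d \<and> i + j = k}"
        then obtain i j where p: "p = (i, j)" "i < d" "j < d" "i + j = k" by blast
        then have "2 * d - 2 - k = (d - 1 - i) + (d - 1 - j)" by simp
        then have "y i * y j = s ^ (2 * d - 2 - k) * t ^ k"
          by (simp add: y_def power_add mult_ac flip: p(4))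
        then show "(case p of (i, j) \<Rightarrow> y i * y j * ?G (\<alpha> * d + i) (\<beta> * d + j)) =
            (case p of (i, j) \<Rightarrow> s ^ (2 * d - 2 - k) * t ^ k * ?G (\<alpha> * d + i) (\<beta> * d + j))" by (simp add: p(1))
      qed
      also have "\<dots> = s ^ (2 * d - 2 - k) * t ^ k * (real (2 * d - 2 choose k) * ?a (k + \<alpha> + \<beta>))"
        unfolding eq[OF that k, symmetric] by (simp add: sum_distrib_left case_prod_beta)
      finally show "(\<Sum>(i, j) | i < d \<and> j < d \<and> i + j = k. y i * y j * ?G (\<alpha> * d + i) (\<beta> * d + j)) =
          s ^ (2 * d - 2 - k) * t ^ k * (real (2 * d - 2 choose k) * ?a (k + \<alpha> + \<beta>))" .
    qed
    have "scalar_prod w (?M *\<^sub>v w) = (\<Sum>r<2 * d. \<Sum>q<2 * d. w $ r * w $ q * (?G r q + ?G q r))"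
      by (simp add: scalar_prod_def w_def atLeast0LessThan sum_distrib_left mult_ac)
    also have "\<dots> = (\<Sum>r<2 * d. \<Sum>q<2 * d. w $ r * w $ q * ?G r q) + (\<Sum>r<2 * d. \<Sum>q<2 * d. w $ r * w $ q * ?G q r)"
      by (simp add: distrib_left sum.distrib)
    also have "(\<Sum>r<2 * d. \<Sum>q<2 * d. w $ r * w $ q * ?G q r) = (\<Sum>r<2 * d. \<Sum>q<2 * d. w $ r * w $ q * ?G r q)"
      by (subst sum.swap) (simp add: mult_ac)
    finally have "scalar_prod w (?M *\<^sub>v w) = 2 * (\<Sum>r<2 * d. \<Sum>q<2 * d. w $ r * w $ q * ?G r q)" by simp
    moreover have "scalar_prod w (?M *\<^sub>v w) \<ge> 0" using psd unfolding psd_def by (simp add: w_def)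
    moreover have "(\<Sum>r<2 * d. \<Sum>q<2 * d. w $ r * w $ q * ?G r q) =
       (\<Sum>\<alpha><2. \<Sum>\<beta><2. c \<alpha> * c \<beta> * (\<Sum>i<d. \<Sum>j<d. y i * y j * ?G (\<alpha> * d + i) (\<beta> * d + j)))"
    proof -
      have w: "w $ (\<alpha> * d + i) = c \<alpha> * y i" if "\<alpha> < 2" "i < d" for \<alpha> i
      proof -
        have "\<alpha> * d + i < 2 * d" using that by (cases \<alpha>) auto
        then show ?thesis using that by (simp add: w_def)
      qed
      have "(\<Sum>r<2 * d. \<Sum>q<2 * d. w $ r * w $ q * ?G r q) =
         (\<Sum>\<alpha><2. \<Sum>i<d. \<Sum>\<beta><2. \<Sum>j<d. c \<alpha> * y i * (c \<beta> * y j) * ?G (\<alpha> * d + i) (\<beta> * d + j))"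
        unfolding sum_gram_index by (intro sum.cong refl) (simp add: w)
      also have "\<dots> = (\<Sum>\<alpha><2. \<Sum>\<beta><2. \<Sum>i<d. \<Sum>j<d. c \<alpha> * y i * (c \<beta> * y j) * ?G (\<alpha> * d + i) (\<beta> * d + j))"
        by (intro sum.cong refl sum.swap)
      finally show ?thesis by (simp add: sum_distrib_left mult_ac)
    qed
    moreover have "\<dots> = umbral ?a ([:s, t:] ^ (2 * d - 2) * [:u, v:] ^ 2)"
    proof -
      have "(\<Sum>\<alpha><2. \<Sum>\<beta><2. c \<alpha> * c \<beta> * (\<Sum>i<d. \<Sum>j<d. y i * y j * ?G (\<alpha> * d + i) (\<beta> * d + j))) =
        (\<Sum>\<alpha><2. \<Sum>\<beta><2. c \<alpha> * c \<beta> * (\<Sum>k\<le>2 * d - 2. s ^ (2 * d - 2 - k) * t ^ k * (real (2 * d - 2 choose k) * ?a (k + \<alpha> + \<beta>))))"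
        by (intro sum.cong refl) (simp add: block)
      also have "\<dots> = umbral ?a ([:s, t:] ^ (2 * d - 2) * [:u, v:] ^ 2)"
        unfolding umbral_hessian
        by (simp add: numeral_2_eq_2 c_def sum_distrib_left sum.distrib[symmetric] del: diff_Suc_Suc) (simp add: algebra_simps power2_eq_square)
      finally show ?thesis .
    qed
    ultimately show ?thesis by linarith
  qed
  then show ?thesis using ends by (simp add: normalized_convex_seqs_def convex_seq_def)
qed

text \<open>The coefficient vectors in a decomposition of the Hessian into squares are the factors
  of a Gram matrix. They fit into size 2d because \<open>sum_squares_degree\<close> keeps all
  degrees below d.\<close>

lemma normalized_imp_sdp_feasible:
  assumes d: "d \<ge> 1" and a: "a \<in> normalized_convex_seqs (2 * d)"
  obtains x where "x \<in> sdp_feasible (A_sdp d)" "x (Coef d) = a d"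
proof -
  have conv: "convex_seq (2 * d) a" and ends: "a 0 = 1" "a (2 * d) = 1" using a by (auto simp: normalized_convex_seqs_def)
  define H where "H i = (\<Sum>k\<le>2 * d - 2. monom (real (2 * d - 2 choose k) * a (k + i)) k)" for i
  have coeff_H: "coeff (H i) k = real (2 * d - 2 choose k) * a (k + i)" if "k \<le> 2 * d - 2" for i k
    using that by (simp add: H_def coeff_sum coeff_monom)
  have deg_H: "degree (H i) \<le> 2 * (d - 1)" for i
    unfolding H_def by (intro degree_sum_le) (auto intro!: order_trans[OF degree_monom_le])
  have "sos2 (H 0) (H 1) (H 2)"
    unfolding H_def by (intro psd2_imp_sos2 hessian_entry_psd2 conv d)
  then obtain fs where fs: "H 0 = (\<Sum>(f, g)\<leftarrow>fs. f * f)" "H 1 = (\<Sum>(f, g)\<leftarrow>fs. f * g)" "H 2 = (\<Sum>(f, g)\<leftarrow>fs. g * g)"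
    unfolding sos2_def by blast
  define F where "F \<alpha> p = (if \<alpha> = (0::nat) then fst p else snd p)" for \<alpha> and p :: "real poly \<times> real poly"
  have deg: "degree (F \<alpha> p) < d" if "p \<in> set fs" for \<alpha> p
  proof -
    have "H 0 = (\<Sum>f\<leftarrow>map fst fs. f * f)" "H 2 = (\<Sum>f\<leftarrow>map snd fs. f * f)"
      unfolding fs by (simp_all add: case_prod_unfold o_def)
    then have "degree (fst p) \<le> d - 1" "degree (snd p) \<le> d - 1"
      using sum_squares_degree[of "map fst fs" "d - 1" "fst p"] sum_squares_degree[of "map snd fs" "d - 1" "snd p"]
        deg_H[of 0] deg_H[of 2] that by auto
    then have "degree (fst p) < d" "degree (snd p) < d" using d by linarith+
    then show ?thesis by (simp add: F_def)
  qed
  have H_F: "H (\<alpha> + \<beta>) = (\<Sum>p\<leftarrow>fs. F \<alpha> p * F \<beta> p)" if "\<alpha> < 2" "\<beta> < 2" for \<alpha> \<beta>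
  proof -
    have "H 0 = (\<Sum>p\<leftarrow>fs. F 0 p * F 0 p)" "H 1 = (\<Sum>p\<leftarrow>fs. F 0 p * F 1 p)"
      "H 1 = (\<Sum>p\<leftarrow>fs. F 1 p * F 0 p)" "H 2 = (\<Sum>p\<leftarrow>fs. F 1 p * F 1 p)"
      unfolding fs by (simp_all add: F_def case_prod_unfold mult.commute)
    moreover have "\<alpha> = 0 \<or> \<alpha> = 1" "\<beta> = 0 \<or> \<beta> = 1" using that by (simp_all add: less_2_cases_iff)
    ultimately show ?thesis by (auto simp: numeral_2_eq_2)
  qed
  define x where "x v = (case v of Coef j \<Rightarrow> a j | Gram r q \<Rightarrow>
    (\<Sum>p\<leftarrow>fs. coeff (F (r div d) p) (r mod d) * coeff (F (q div d) p) (q mod d)))" for v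
  have "x \<in> sdp_feasible (A_sdp d)"
    unfolding sdp_feasible_A_sdp_iff[OF d]
  proof (intro conjI allI impI)
    show "x (Coef 0) = 1" "x (Coef (2 * d)) = 1" using ends by (simp_all add: x_def)
    fix \<alpha> \<beta> k :: nat assume *: "\<alpha> < 2" "\<beta> < 2" "k \<le> 2 * d - 2"
    have coeff_sum_list: "coeff (sum_list (map G ps)) k = (\<Sum>p\<leftarrow>ps. coeff (G p) k)"
      for G :: "real poly \<times> real poly \<Rightarrow> real poly" and ps by (induction ps) auto
    have "(\<Sum>(i, j) | i < d \<and> j < d \<and> i + j = k. x (Gram (\<alpha> * d + i) (\<beta> * d + j))) =
       (\<Sum>(i, j) | i < d \<and> j < d \<and> i + j = k. \<Sum>p\<leftarrow>fs. coeff (F \<alpha> p) i * coeff (F \<beta> p) j)"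
      by (intro sum.cong refl) (auto simp: x_def)
    also have "\<dots> = (\<Sum>p\<leftarrow>fs. \<Sum>(i, j) | i < d \<and> j < d \<and> i + j = k. coeff (F \<alpha> p) i * coeff (F \<beta> p) j)"
      by (induction fs) (simp_all add: sum.distrib case_prod_beta)
    also have "\<dots> = (\<Sum>p\<leftarrow>fs. coeff (F \<alpha> p * F \<beta> p) k)"
      using coeff_mult_antidiagonal[OF deg deg] by (intro arg_cong[of _ _ sum_list] map_cong refl) simp
    also have "\<dots> = coeff (H (\<alpha> + \<beta>)) k" unfolding H_F[OF *(1,2)] coeff_sum_list ..
    finally show "(\<Sum>(i, j) | i < d \<and> j < d \<and> i + j = k. x (Gram (\<alpha> * d + i) (\<beta> * d + j))) =
        real (2 * d - 2 choose k) * x (Coef (k + \<alpha> + \<beta>))" by (simp add: coeff_H[OF *(3)] x_def add.assoc)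
  next
    let ?M = "Matrix.mat (2 * d) (2 * d) (\<lambda>(i, j). x (Gram i j) + x (Gram j i))"
    let ?e = "\<lambda>p r. coeff (F (r div d) p) (r mod d)"
    show "psd ?M"
      unfolding psd_def
    proof (intro conjI ballI)
      show "transpose_mat ?M = ?M" by (intro eq_matI) (auto simp: add.commute)
      fix w :: "real Matrix.vec" assume "w \<in> carrier_vec (dim_row ?M)"
      then have w: "dim_vec w = 2 * d" by auto
      have "scalar_prod w (?M *\<^sub>v w) = (\<Sum>r<2 * d. \<Sum>q<2 * d. w $ r * w $ q * (x (Gram r q) + x (Gram q r)))"
        using w by (simp add: scalar_prod_def atLeast0LessThan sum_distrib_left mult_ac)
      also have "\<dots> = (\<Sum>r<2 * d. \<Sum>q<2 * d. \<Sum>p\<leftarrow>fs. 2 * (w $ r * ?e p r) * (w $ q * ?e p q))"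
        by (intro sum.cong refl) (simp add: x_def sum_list_const_mult[symmetric] sum_list_addf[symmetric] algebra_simps)
      also have "\<dots> = (\<Sum>p\<leftarrow>fs. \<Sum>r<2 * d. \<Sum>q<2 * d. 2 * (w $ r * ?e p r) * (w $ q * ?e p q))"
        by (induction fs) (simp_all add: sum.distrib)
      also have "\<dots> = (\<Sum>p\<leftarrow>fs. 2 * (\<Sum>r<2 * d. w $ r * ?e p r)\<^sup>2)"
      proof -
        have "(\<Sum>r<n. \<Sum>q<n. 2 * f r * f q) = 2 * (\<Sum>r<n. f r)\<^sup>2" for f :: "nat \<Rightarrow> real" and n
          unfolding power2_eq_square sum_product by (simp add: sum_distrib_left mult.assoc)
        then show ?thesis by (simp only:)
      qed
      also have "\<dots> \<ge> 0" by (intro sum_list_nonneg) auto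
      finally show "0 \<le> scalar_prod w (?M *\<^sub>v w)" .
    qed simp
  qed
  moreover have "x (Coef d) = a d" by (simp add: x_def)
  ultimately show ?thesis using that by blast
qed

lemma is_sdp_A_sdp: "is_sdp (A_sdp d)"
proof -
  have fin: "finite {(hessian_eq d \<alpha> \<beta> k, 0 :: real) | \<alpha> \<beta> k. \<alpha> < 2 \<and> \<beta> < 2 \<and> k \<le> 2 * d - 2}"
  proof -
    have "{(hessian_eq d \<alpha> \<beta> k, 0 :: real) | \<alpha> \<beta> k. \<alpha> < 2 \<and> \<beta> < 2 \<and> k \<le> 2 * d - 2} \<subseteq>
        (\<lambda>(\<alpha>, \<beta>, k). (hessian_eq d \<alpha> \<beta> k, 0)) ` ({..<2} \<times> {..<2} \<times> {..2 * d - 2})"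
      by force
    then show ?thesis by (rule finite_subset) simp
  qed
  have "gram_coeff d v \<in> carrier_mat (2 * d) (2 * d) \<and> transpose_mat (gram_coeff d v) = gram_coeff d v" for v
  proof (cases v)
    case (Gram r s)
    have "transpose_mat (gram_coeff d (Gram r s)) = gram_coeff d (Gram r s)"
      by (rule eq_matI) (simp_all add: conj_commute add.commute)
    then show ?thesis unfolding Gram by simp
  qed simp
  moreover have "lmi_size (A_sdp d) = 2 * d" "lmi_const (A_sdp d) = 0\<^sub>m (2 * d) (2 * d)"
    "lmi_coeff (A_sdp d) = gram_coeff d" by (simp_all add: A_sdp_def)
  moreover have "finite (equations (A_sdp d))"
    using fin by (simp add: A_sdp_def)
  ultimately show ?thesis using finite_vars_A_sdp[of d] unfolding is_sdp_def by (simp only:) simp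
qed

theorem sdp_max_value_A_sdp:
  assumes d: "d \<ge> 1"
  shows "sdp_max_value (A_sdp d) = ereal (Sup ((\<lambda>a. a d) ` normalized_convex_seqs (2 * d)))"
proof -
  have obj: "(\<Sum>v\<in>vars (A_sdp d). objective (A_sdp d) v * x v) = x (Coef d)" for x
  proof -
    have "objective (A_sdp d) = (\<lambda>v. of_bool (v = Coef d))" by (simp add: A_sdp_def)
    then show ?thesis by (simp only:) (rule sum_vars_A_sdp_Coef, simp)
  qed
  have "(\<lambda>x. x (Coef d)) ` sdp_feasible (A_sdp d) = (\<lambda>a. a d) ` normalized_convex_seqs (2 * d)"
  proof (intro equalityI subsetI)
    fix y assume "y \<in> (\<lambda>x. x (Coef d)) ` sdp_feasible (A_sdp d)"
    then show "y \<in> (\<lambda>a. a d) ` normalized_convex_seqs (2 * d)"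
      using sdp_feasible_imp_normalized[OF d] by force
  next
    fix y assume "y \<in> (\<lambda>a. a d) ` normalized_convex_seqs (2 * d)"
    then obtain a where "a \<in> normalized_convex_seqs (2 * d)" "y = a d" by blast
    with normalized_imp_sdp_feasible[OF d] show "y \<in> (\<lambda>x. x (Coef d)) ` sdp_feasible (A_sdp d)" by (metis imageI)
  qed
  then have "sdp_max_value (A_sdp d) = (SUP y\<in>(\<lambda>a. a d) ` normalized_convex_seqs (2 * d). ereal y)"
    unfolding sdp_max_value_def obj by (metis image_image)
  also have "\<dots> = ereal (Sup ((\<lambda>a. a d) ` normalized_convex_seqs (2 * d)))"
  \<comment> \<open>To transfer the real supremum, the extended one must be finite; the constant
    sequence 1 and the uniform bound on the middle moment ensure this.\<close>
  proof (rule ereal_Sup[symmetric])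
    let ?S = "(\<lambda>a. a d) ` normalized_convex_seqs (2 * d)"
    obtain M where "\<forall>a\<in>normalized_convex_seqs (2 * d). a d \<le> M"
      using normalized_middle_coeff_bounded[OF d] by blast
    then have "(SUP y\<in>?S. ereal y) \<le> ereal M" by (intro SUP_least) auto
    moreover have "1 \<in> ?S" using convex_seq_ones[OF d] by (force simp: normalized_convex_seqs_def)
    then have "ereal 1 \<le> (SUP y\<in>?S. ereal y)" by (rule SUP_upper)
    ultimately show "\<bar>SUP y\<in>?S. ereal y\<bar> \<noteq> \<infinity>" by (cases "SUP y\<in>?S. ereal y") auto
  qed
  finally show ?thesis .
qed

section \<open>The optimal constants\<close>

theorem theorem3p4:
  shows "(\<forall>d::nat. d \<ge> 1 \<longrightarrow> B_star d = real ((2 * (d - 1)) choose (d - 1)) / real d) \<and>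
    A_star 1 = 1 \<and> A_star 2 = 1 \<and> A_star 3 = 1 \<and>
    algebraic (A_star 4) \<and> algebraic_degree (A_star 4) = 3 \<and>
    (\<forall>d::nat. even d \<and> d \<ge> 4 \<longrightarrow> A_star d > 1) \<and>
    (\<forall>d::nat. d \<ge> 1 \<longrightarrow> is_sdp (A_sdp d) \<and> sdp_max_value (A_sdp d) = ereal (A_star d))"
proof -
  have A: "A_star d = Sup ((\<lambda>a. a d) ` normalized_convex_seqs (2 * d))" if "d \<ge> 1" for d
    using A_star_convex_seq[OF that] Inf_A_convex_seq[OF that] by (rule trans)
  have B: "B_star d = real ((2 * (d - 1)) choose (d - 1)) / real d" if "d \<ge> 1" for d
    using B_star_convex_seq[OF that] Inf_B_convex_seq[OF that] by (rule trans)
  have A_1: "A_star d = 1" if "d \<in> {1, 2, 3}" for d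
  proof -
    have d: "d \<ge> 1" using that by auto
    have "Sup ((\<lambda>a. a d) ` normalized_convex_seqs (2 * d)) = 1"
      by (rule normalized_Sup_eq_1[OF d]) (rule normalized_middle_coeff_le_1[OF that])
    then show ?thesis using A[OF d] by simp
  qed
  obtain R :: real where R: "(35 * octic_alpha R) ^ 3 - 33 * (35 * octic_alpha R)\<^sup>2 - 85 * (35 * octic_alpha R) + 13 = 0"
    "Sup ((\<lambda>a. a 4) ` normalized_convex_seqs 8) = octic_alpha R"
    by (rule normalized_Sup_octic)
  have A_4: "A_star 4 = octic_alpha R" using A[of 4] R(2) by simp
  have A_even: "A_star d > 1" if d: "even d" "d \<ge> 4" for d
  proof -
    obtain a where a: "a \<in> normalized_convex_seqs (2 * d)" "a d > 1"
      using normalized_middle_coeff_gt_1[OF d] by blast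
    have "bdd_above ((\<lambda>a. a d) ` normalized_convex_seqs (2 * d))"
      using normalized_middle_coeff_bounded[of d] d by (auto simp: bdd_above_def)
    then have "a d \<le> A_star d" using A[of d] a(1) d by (simp add: cSup_upper)
    with a(2) show ?thesis by simp
  qed
  have "is_sdp (A_sdp d) \<and> sdp_max_value (A_sdp d) = ereal (A_star d)" if "d \<ge> 1" for d
    using is_sdp_A_sdp sdp_max_value_A_sdp[OF that] A[OF that] by simp
  then show ?thesis
    using B A_1[of 1] A_1[of 2] A_1[of 3] A_even algebraic_octic[OF R(1)] algebraic_degree_octic[OF R(1)]
    unfolding A_4 by simp
qed

end
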